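(* Let $V$ be a vertex operator algebra, $W$ a $V$-module with grading operator $\mathbf d_W$, and $F:V\to W$ a derivation. For any $N\in\mathbb N$, define $f:A_N(V)\to A_N(W)$ by $f(v+O_N(V))=F(v)+O_N(W)$. Then $f$ is a (well-defined) derivation from the associative algebra $A_N(V)$ to the $A_N(V)$-bimodule $A_N(W)$. The map $F\mapsto f$ gives a linear map $H^1(V,W)\to H^1(A_N(V),A_N(W))$.
   Context: Gradings and derivations. $V=(V,Y,\mathbf 1,\omega)$ is a vertex operator algebra over $\mathbb C$, $Y(\omega,x)=\sum_nL(n)x^{-n-2}$, graded by $L(0)$. $(W,Y_W)$ is a generalized $V$-module: a direct sum of generalized $L(0)$-eigenspaces such that for each $m\in\mathbb C$ the generalized eigenspace of eigenvalue $m-n$ vanishes for all sufficiently large $n\in\mathbb Z_+$. $\mathbf d_W$ is a grading operator which on each irreducible component equals $L(0)_s+\alpha$ ($L(0)_s$ the semisimple part of $L(0)$, $\alpha\in\mathbb C$ a constant possibly depending on the component). Put $Y_{WV}^W(w,x)v=e^{xL(-1)}Y_W(v,-x)w=\sum_nw_nv\,x^{-n-1}$. A (grading-preserving) derivation is a linear map $F:V\to W$ with $F\circ L(0)=\mathbf d_W\circ F$ and $F(Y(u,x)v)=Y_W(u,x)F(v)+Y_{WV}^W(F(u),x)v$ for all $u,v\in V$; $H^1(V,W)$ is (identified with) the space of all such derivations. Level-$N$ Zhu algebra. $\mathbb N=\{0,1,\dots\}$. $A_N(V)=V/O_N(V)$, where $O_N(V)$ is spanned by the elements $\mathrm{Res}_x\,x^{-2N-2-n}Y((1+x)^{L(0)+N}u,x)v$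 ($u,v\in V$, $n\in\mathbb N$) and $L(0)v+L(-1)v$ ($v\in V$). It is an associative algebra with product induced by $u*_Nv=\sum_{m=0}^N(-1)^m\binom{m+N}N\mathrm{Res}_x\,x^{-N-m-1}Y((1+x)^{L(0)+N}u,x)v$. Bimodule. $A_N(W)=W/O_N(W)$, where $O_N(W)$ is spanned by the elements $\mathrm{Res}_x\,x^{-2N-2}Y_W((1+x)^{L(0)+N}v,x)w$ ($v\in V,w\in W$) and $\mathbf d_Ww+L(-1)w$ ($w\in W$). It is an $A_N(V)$-bimodule (a result of Huang–Yang) with actions induced by $v*_Nw=\sum_{m=0}^N(-1)^m\binom{m+N}N\mathrm{Res}_x\,x^{-N-m-1}Y_W((1+x)^{L(0)+N}v,x)w$ and $w*_Nv=\sum_{m=0}^N(-1)^m\binom{m+N}N\mathrm{Res}_x\,x^{-N-m-1}Y_{WV}^W((1+x)^{\mathbf d_W+N}w,x)v$. Associative algebra cohomology. For an associative algebra $(A,* )$ and an $A$-bimodule $B$, a derivation is a linear map $f:A\to B$ with $f(u*v)=u*f(v)+f(u)*v$; it is inner if $f(v)=v*w-w*v$ for some $w\in B$; $H^1(A,B)$ is the quotient of the space of derivations by the inner ones. *)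

theory Defs
  imports Complex_Main "HOL-Library.FuncSet" "HOL-Library.Groups_Big_Fun"
    "HOL-Algebra.Module" "HOL-Algebra.QuotRing"
begin

section \<open>Vertex operator algebras and modules\<close>

text \<open>
  The underlying vector spaces are whole types with an explicit complex scalar multiplication.
  A vertex operator is given by its modes: \<open>vmode V u n v\<close> is \<open>u\<^sub>n v\<close>, where
  \<open>Y(u,x)v = (\<Sum>n. u\<^sub>n v x^(-n-1))\<close>, and likewise \<open>wmode\<close> for the module.
  The field \<open>dgrad\<close> is the grading operator of the module.
\<close>

record 'v voa =
  vscale :: "complex \<Rightarrow> 'v \<Rightarrow> 'v"
  vmode :: "'v \<Rightarrow> int \<Rightarrow> 'v \<Rightarrow> 'v"
  vacuum :: 'v
  conformal :: 'v

record ('v, 'w) voa_module =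
  wscale :: "complex \<Rightarrow> 'w \<Rightarrow> 'w"
  wmode :: "'v \<Rightarrow> int \<Rightarrow> 'w \<Rightarrow> 'w"
  dgrad :: "'w \<Rightarrow> 'w"

text \<open>\<open>Y(\<omega>,x) = (\<Sum>n. L(n) x^(-n-2))\<close>, so \<open>L(n)\<close> is the mode of \<open>\<omega>\<close> of index \<open>n + 1\<close>.\<close>

definition vir :: "'v voa \<Rightarrow> int \<Rightarrow> 'v \<Rightarrow> 'v" where
  "vir V n = vmode V (conformal V) (n + 1)"

definition wvir :: "'v voa \<Rightarrow> ('v, 'w) voa_module \<Rightarrow> int \<Rightarrow> 'w \<Rightarrow> 'w" where
  "wvir V W n = wmode W (conformal V) (n + 1)"

definition eigenspace :: "(complex \<Rightarrow> 'a \<Rightarrow> 'a) \<Rightarrow> ('a \<Rightarrow> 'a) \<Rightarrow> complex \<Rightarrow> 'a set" where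
  "eigenspace s T m = {w. T w = s m w}"

definition gen_eigenspace ::
    "(complex \<Rightarrow> 'a \<Rightarrow> 'a) \<Rightarrow> ('a \<Rightarrow> 'a) \<Rightarrow> complex \<Rightarrow> 'a::ab_group_add set" where
  "gen_eigenspace s T m = {w. \<exists>k. ((\<lambda>y. T y - s m y) ^^ k) w = 0}"

text \<open>
  The Jacobi identity in components (Borcherds identity), for the vertex operators with modes
  \<open>Ym\<close> on a space with scalar multiplication \<open>s\<close>. All sums have finite support because of the
  truncation condition.
\<close>

definition jacobi_identity ::
    "'v voa \<Rightarrow> (complex \<Rightarrow> 'w \<Rightarrow> 'w) \<Rightarrow> ('v \<Rightarrow> int \<Rightarrow> 'w \<Rightarrow> 'w::ab_group_add) \<Rightarrow> bool" where
  "jacobi_identity V s Ym \<longleftrightarrow> (\<forall>u v w. \<forall>l m n :: int.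
     Sum_any (\<lambda>i::nat. s (of_int m gchoose i) (Ym (vmode V u (l + int i) v) (m + n - int i) w)) =
     Sum_any (\<lambda>i::nat. s ((- 1) ^ i * (of_int l gchoose i))
        (Ym u (m + l - int i) (Ym v (n + int i) w)
         - s ((- 1) powi l) (Ym v (n + l - int i) (Ym u (m + int i) w)))))"

definition virasoro_relations ::
    "(complex \<Rightarrow> 'v \<Rightarrow> 'v) \<Rightarrow> (int \<Rightarrow> 'v \<Rightarrow> 'v::ab_group_add) \<Rightarrow> complex \<Rightarrow> bool" where
  "virasoro_relations s L c \<longleftrightarrow> (\<forall>m n v.
     L m (L n v) - L n (L m v) =
       s (of_int (m - n)) (L (m + n) v)
       + (if m + n = 0 then s (of_int (m ^ 3 - m) / 12 * c) v else 0))"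

locale vertex_operator_algebra =
  fixes V :: "'v::ab_group_add voa"
  assumes vector_space: "vector_space (vscale V)"
    and linear_left: "Vector_Spaces.linear (vscale V) (vscale V) (\<lambda>u. vmode V u n v)"
    and linear_right: "Vector_Spaces.linear (vscale V) (vscale V) (vmode V u n)"
    and truncation: "\<exists>K. \<forall>n\<ge>K. vmode V u n v = 0"
    and vacuum: "vmode V (vacuum V) n v = (if n = - 1 then v else 0)"
    and creation: "vmode V v (- 1) (vacuum V) = v" "n \<ge> 0 \<Longrightarrow> vmode V v n (vacuum V) = 0"
    and jacobi: "jacobi_identity V (vscale V) (vmode V)"
    and virasoro: "\<exists>c. virasoro_relations (vscale V) (vir V) c"
    and derivative: "vmode V (vir V (- 1) u) n v = vscale V (- of_int n) (vmode V u (n - 1) v)"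
    and grading: "module.span (vscale V) (\<Union>n::int. eigenspace (vscale V) (vir V 0) (of_int n)) = UNIV"
    and finite_dim: "\<exists>B. finite B \<and>
          eigenspace (vscale V) (vir V 0) (of_int n) \<subseteq> module.span (vscale V) B"
    and lower_bound: "\<exists>K::int. \<forall>n<K. eigenspace (vscale V) (vir V 0) (of_int n) = {0}"

text \<open>Sums of generalized eigenspaces are automatically direct.\<close>

locale generalized_module =
  fixes V :: "'v::ab_group_add voa" and W :: "('v, 'w::ab_group_add) voa_module"
  assumes vector_space: "vector_space (wscale W)"
    and linear_left: "Vector_Spaces.linear (vscale V) (wscale W) (\<lambda>u. wmode W u n w)"
    and linear_right: "Vector_Spaces.linear (wscale W) (wscale W) (wmode W u n)"
    and truncation: "\<exists>K. \<forall>n\<ge>K. wmode W u n w = 0"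
    and vacuum: "wmode W (vacuum V) n w = (if n = - 1 then w else 0)"
    and jacobi: "jacobi_identity V (wscale W) (wmode W)"
    and derivative: "wmode W (vir V (- 1) u) n w = wscale W (- of_int n) (wmode W u (n - 1) w)"
    and grading: "module.span (wscale W) (\<Union>m. gen_eigenspace (wscale W) (wvir V W 0) m) = UNIV"
    and lower_truncation:
      "\<exists>K::nat. \<forall>n\<ge>K. gen_eigenspace (wscale W) (wvir V W 0) (m - of_nat n) = {0}"

definition submodule_of :: "('v, 'w::ab_group_add) voa_module \<Rightarrow> 'w set \<Rightarrow> bool" where
  "submodule_of W U \<longleftrightarrow>
     module.subspace (wscale W) U \<and> (\<forall>v n. \<forall>w\<in>U. wmode W v n w \<in> U)"

definition semisimple_part ::
    "(complex \<Rightarrow> 'a \<Rightarrow> 'a) \<Rightarrow> ('a \<Rightarrow> 'a) \<Rightarrow> 'a::ab_group_add \<Rightarrow> 'a" where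
  "semisimple_part s T =
     (THE S. Vector_Spaces.linear s s S \<and> (\<forall>m. \<forall>w\<in>gen_eigenspace s T m. S w = s m w))"

definition internal_direct_sum ::
    "(complex \<Rightarrow> 'a \<Rightarrow> 'a) \<Rightarrow> 'a::ab_group_add set set \<Rightarrow> bool" where
  "internal_direct_sum s C \<longleftrightarrow>
     module.span s (\<Union>C) = UNIV \<and> (\<forall>U\<in>C. U \<inter> module.span s (\<Union>(C - {U})) = {0})"

text \<open>
  The grading operator equals \<open>L(0)\<^sub>s + \<alpha>\<close> on each component of \<open>W\<close>, with \<open>\<alpha>\<close> depending on the
  component. The components need not be irreducible, since \<open>W\<close> is not assumed
  completely reducible; a decomposition into irreducible modules is an instance, and for
  irreducible \<open>W\<close> the condition says that \<open>d\<^sub>W\<close> is \<open>L(0)\<^sub>s\<close> plus a constant. Equivalently,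
  \<open>d\<^sub>W\<close> is diagonalizable and has the same commutators as \<open>L(0)\<close> with all vertex operators.
\<close>

definition grading_operator ::
    "'v voa \<Rightarrow> ('v, 'w::ab_group_add) voa_module \<Rightarrow> bool" where
  "grading_operator V W \<longleftrightarrow>
     Vector_Spaces.linear (wscale W) (wscale W) (dgrad W) \<and>
     (\<exists>C \<alpha>. (\<forall>U\<in>C. submodule_of W U) \<and> internal_direct_sum (wscale W) C \<and>
        (\<forall>U\<in>C. \<forall>w\<in>U. dgrad W w = semisimple_part (wscale W) (wvir V W 0) w + wscale W (\<alpha> U) w))"


section \<open>Formal series\<close>

text \<open>
  A formal series in \<open>x\<close> is the function sending \<open>j\<close> to the coefficient of \<open>x^j\<close>.
\<close>

definition Yser :: "('v \<Rightarrow> int \<Rightarrow> 'w \<Rightarrow> 'w) \<Rightarrow> 'v \<Rightarrow> 'w \<Rightarrow> int \<Rightarrow> 'w" where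
  "Yser Ym u w j = Ym u (- j - 1) w"

text \<open>\<open>e^(xL(-1)) Y\<^sub>W(v,-x) w\<close>\<close>

definition Yskew ::
    "'v voa \<Rightarrow> ('v, 'w::ab_group_add) voa_module \<Rightarrow> 'w \<Rightarrow> 'v \<Rightarrow> int \<Rightarrow> 'w" where
  "Yskew V W w v j = Sum_any (\<lambda>k::nat.
     wscale W (1 / fact k)
       ((wvir V W (- 1) ^^ k) (wscale W ((- 1) powi (j - int k)) (Yser (wmode W) v w (j - int k)))))"

text \<open>
  The operator \<open>A (A - 1) \<dots> (A - k + 1) / k!\<close>, that is, the coefficient of \<open>x^k\<close> in \<open>(1 + x)^A\<close>.
\<close>

primrec op_choose ::
    "(complex \<Rightarrow> 'a \<Rightarrow> 'a) \<Rightarrow> ('a \<Rightarrow> 'a) \<Rightarrow> nat \<Rightarrow> 'a::ab_group_add \<Rightarrow> 'a" where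
  "op_choose s A 0 w = w"
| "op_choose s A (Suc k) w =
     s (1 / of_nat (Suc k)) (A (op_choose s A k w) - s (of_nat k) (op_choose s A k w))"

text \<open>The series \<open>I((1 + x)^(d + N) u, x) v\<close>, where \<open>I u v\<close> stands for \<open>I(u,x)v\<close>.\<close>

definition twisted ::
    "(complex \<Rightarrow> 'a \<Rightarrow> 'a) \<Rightarrow> ('a \<Rightarrow> 'a) \<Rightarrow> nat \<Rightarrow> ('a \<Rightarrow> 'b \<Rightarrow> int \<Rightarrow> 'c) \<Rightarrow>
      'a::ab_group_add \<Rightarrow> 'b \<Rightarrow> int \<Rightarrow> 'c::ab_group_add" where
  "twisted s d N I u v j =
     Sum_any (\<lambda>k::nat. I (op_choose s (\<lambda>y. d y + s (of_nat N) y) k u) v (j - int k))"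

text \<open>\<open>Res\<^sub>x x^p S(x)\<close>\<close>

definition Res_xpow :: "int \<Rightarrow> (int \<Rightarrow> 'a) \<Rightarrow> 'a" where
  "Res_xpow p S = S (- 1 - p)"

definition star_residue ::
    "(complex \<Rightarrow> 'a \<Rightarrow> 'a) \<Rightarrow> nat \<Rightarrow> (int \<Rightarrow> 'a) \<Rightarrow> 'a::ab_group_add" where
  "star_residue s N S =
     (\<Sum>m\<le>N. s ((- 1) ^ m * of_nat ((m + N) choose N)) (Res_xpow (- int N - int m - 1) S))"


section \<open>Derivations of the vertex operator algebra\<close>

definition voa_derivation ::
    "'v::ab_group_add voa \<Rightarrow> ('v, 'w::ab_group_add) voa_module \<Rightarrow> ('v \<Rightarrow> 'w) \<Rightarrow> bool" where
  "voa_derivation V W F \<longleftrightarrow>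
     Vector_Spaces.linear (vscale V) (wscale W) F \<and>
     (\<forall>v. F (vir V 0 v) = dgrad W (F v)) \<and>
     (\<forall>u v j. F (Yser (vmode V) u v j) = Yser (wmode W) u (F v) j + Yskew V W (F u) v j)"

text \<open>
  Vector spaces are records of the type of modules of the library; where there is no
  multiplication, the fields \<open>mult\<close> and \<open>one\<close> are irrelevant and left undefined.
\<close>

definition voa_H1 ::
    "'v::ab_group_add voa \<Rightarrow> ('v, 'w::ab_group_add) voa_module \<Rightarrow> (complex, 'v \<Rightarrow> 'w) module" where
  "voa_H1 V W =
     \<lparr>carrier = {F. voa_derivation V W F}, mult = undefined, one = undefined,
      zero = (\<lambda>v. 0), add = (\<lambda>F G v. F v + G v), smult = (\<lambda>c F v. wscale W c (F v))\<rparr>"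


section \<open>Linear maps, quotients and cohomology of associative algebras\<close>

text \<open>Extensional, so that equal maps on the carrier are equal.\<close>

definition linear_maps ::
    "(complex, 'a, 'm) module_scheme \<Rightarrow> (complex, 'b, 'n) module_scheme \<Rightarrow> ('a \<Rightarrow> 'b) set" where
  "linear_maps A B = {f \<in> carrier A \<rightarrow>\<^sub>E carrier B.
     (\<forall>x\<in>carrier A. \<forall>y\<in>carrier A. f (x \<oplus>\<^bsub>A\<^esub> y) = f x \<oplus>\<^bsub>B\<^esub> f y) \<and>
     (\<forall>c. \<forall>x\<in>carrier A. f (c \<odot>\<^bsub>A\<^esub> x) = c \<odot>\<^bsub>B\<^esub> f x)}"

text \<open>As the library's \<open>M Quot U\<close>, but with scalar multiplication.\<close>

definition quotient ::
    "(complex, 'a, 'm) module_scheme \<Rightarrow> 'a set \<Rightarrow> (complex, 'a set) module" where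
  "quotient M U =
     \<lparr>carrier = a_rcosets\<^bsub>M\<^esub> U, mult = rcoset_mult M U, one = U +>\<^bsub>M\<^esub> \<one>\<^bsub>M\<^esub>,
      zero = U, add = set_add M, smult = (\<lambda>c X. \<Union>x\<in>X. U +>\<^bsub>M\<^esub> (c \<odot>\<^bsub>M\<^esub> x))\<rparr>"

record ('a, 'b) bimodule = "(complex, 'b) module" +
  lact :: "'a \<Rightarrow> 'b \<Rightarrow> 'b"
  ract :: "'b \<Rightarrow> 'a \<Rightarrow> 'b"

definition derivations ::
    "(complex, 'a) module \<Rightarrow> ('a, 'b) bimodule \<Rightarrow> ('a \<Rightarrow> 'b) set" where
  "derivations A B = {f \<in> linear_maps A B. \<forall>u\<in>carrier A. \<forall>v\<in>carrier A.
     f (u \<otimes>\<^bsub>A\<^esub> v) = lact B u (f v) \<oplus>\<^bsub>B\<^esub> ract B (f u) v}"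

definition inner_derivations ::
    "(complex, 'a) module \<Rightarrow> ('a, 'b) bimodule \<Rightarrow> ('a \<Rightarrow> 'b) set" where
  "inner_derivations A B =
     {(\<lambda>v\<in>carrier A. lact B v w \<ominus>\<^bsub>B\<^esub> ract B w v) | w. w \<in> carrier B}"

definition derivation_space ::
    "(complex, 'a) module \<Rightarrow> ('a, 'b) bimodule \<Rightarrow> (complex, 'a \<Rightarrow> 'b) module" where
  "derivation_space A B =
     \<lparr>carrier = derivations A B, mult = undefined, one = undefined,
      zero = (\<lambda>v\<in>carrier A. \<zero>\<^bsub>B\<^esub>),
      add = (\<lambda>f g. \<lambda>v\<in>carrier A. f v \<oplus>\<^bsub>B\<^esub> g v),
      smult = (\<lambda>c f. \<lambda>v\<in>carrier A. c \<odot>\<^bsub>B\<^esub> f v)\<rparr>"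

definition assoc_H1 ::
    "(complex, 'a) module \<Rightarrow> ('a, 'b) bimodule \<Rightarrow> (complex, ('a \<Rightarrow> 'b) set) module" where
  "assoc_H1 A B = quotient (derivation_space A B) (inner_derivations A B)"

definition H1_class ::
    "(complex, 'a) module \<Rightarrow> ('a, 'b) bimodule \<Rightarrow> ('a \<Rightarrow> 'b) \<Rightarrow> ('a \<Rightarrow> 'b) set" where
  "H1_class A B f = inner_derivations A B +>\<^bsub>derivation_space A B\<^esub> f"


section \<open>The algebra \<open>A\<^sub>N(V)\<close> and the bimodule \<open>A\<^sub>N(W)\<close>\<close>

definition O_alg :: "'v::ab_group_add voa \<Rightarrow> nat \<Rightarrow> 'v set" where
  "O_alg V N = module.span (vscale V)
     ({Res_xpow (- 2 * int N - 2 - int n) (twisted (vscale V) (vir V 0) N (Yser (vmode V)) u v)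
         | u v (n::nat). True}
      \<union> {vir V 0 v + vir V (- 1) v | v. True})"

definition star_alg :: "'v::ab_group_add voa \<Rightarrow> nat \<Rightarrow> 'v \<Rightarrow> 'v \<Rightarrow> 'v" where
  "star_alg V N u v =
     star_residue (vscale V) N (twisted (vscale V) (vir V 0) N (Yser (vmode V)) u v)"

definition pre_alg :: "'v::ab_group_add voa \<Rightarrow> nat \<Rightarrow> (complex, 'v) module" where
  "pre_alg V N =
     \<lparr>carrier = UNIV, mult = star_alg V N, one = vacuum V, zero = 0, add = (+), smult = vscale V\<rparr>"

definition A_alg :: "'v::ab_group_add voa \<Rightarrow> nat \<Rightarrow> (complex, 'v set) module" where
  "A_alg V N = quotient (pre_alg V N) (O_alg V N)"

definition cls_alg :: "'v::ab_group_add voa \<Rightarrow> nat \<Rightarrow> 'v \<Rightarrow> 'v set" where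
  "cls_alg V N v = O_alg V N +>\<^bsub>pre_alg V N\<^esub> v"

definition O_mod :: "'v::ab_group_add voa \<Rightarrow> ('v, 'w::ab_group_add) voa_module \<Rightarrow> nat \<Rightarrow> 'w set" where
  "O_mod V W N = module.span (wscale W)
     ({Res_xpow (- 2 * int N - 2) (twisted (vscale V) (vir V 0) N (Yser (wmode W)) v w)
         | v w. True}
      \<union> {dgrad W w + wvir V W (- 1) w | w. True})"

definition star_left ::
    "'v::ab_group_add voa \<Rightarrow> ('v, 'w::ab_group_add) voa_module \<Rightarrow> nat \<Rightarrow> 'v \<Rightarrow> 'w \<Rightarrow> 'w" where
  "star_left V W N v w =
     star_residue (wscale W) N (twisted (vscale V) (vir V 0) N (Yser (wmode W)) v w)"

definition star_right ::
    "'v::ab_group_add voa \<Rightarrow> ('v, 'w::ab_group_add) voa_module \<Rightarrow> nat \<Rightarrow> 'w \<Rightarrow> 'v \<Rightarrow> 'w" where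
  "star_right V W N w v =
     star_residue (wscale W) N (twisted (wscale W) (dgrad W) N (Yskew V W) w v)"

definition pre_mod :: "('v, 'w::ab_group_add) voa_module \<Rightarrow> (complex, 'w) module" where
  "pre_mod W =
     \<lparr>carrier = UNIV, mult = undefined, one = undefined, zero = 0, add = (+), smult = wscale W\<rparr>"

definition cls_mod ::
    "'v::ab_group_add voa \<Rightarrow> ('v, 'w::ab_group_add) voa_module \<Rightarrow> nat \<Rightarrow> 'w \<Rightarrow> 'w set" where
  "cls_mod V W N w = O_mod V W N +>\<^bsub>pre_mod W\<^esub> w"

text \<open>The actions are induced on cosets in the same way as the library's \<open>rcoset_mult\<close>.\<close>

definition A_mod ::
    "'v::ab_group_add voa \<Rightarrow> ('v, 'w::ab_group_add) voa_module \<Rightarrow> nat \<Rightarrow>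
      ('v set, 'w set) bimodule" where
  "A_mod V W N = module.extend (quotient (pre_mod W) (O_mod V W N))
     \<lparr>lact = (\<lambda>X Z. \<Union>v\<in>X. \<Union>w\<in>Z. cls_mod V W N (star_left V W N v w)),
      ract = (\<lambda>Z X. \<Union>w\<in>Z. \<Union>v\<in>X. cls_mod V W N (star_right V W N w v))\<rparr>"

text \<open>
  The candidate for \<open>v + O\<^sub>N(V) \<mapsto> F(v) + O\<^sub>N(W)\<close>. It satisfies this equation for all \<open>v\<close> iff
  the prescription is well defined.
\<close>

definition induced ::
    "'v::ab_group_add voa \<Rightarrow> ('v, 'w::ab_group_add) voa_module \<Rightarrow> nat \<Rightarrow> ('v \<Rightarrow> 'w) \<Rightarrow>
      'v set \<Rightarrow> 'w set" where
  "induced V W N F = (\<lambda>X\<in>carrier (A_alg V N). \<Union>v\<in>X. cls_mod V W N (F v))"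

end

theory Submission
  imports Defs "HOL-Computational_Algebra.Formal_Power_Series"
begin

text \<open>
  Applying a derivation \<open>F\<close> to the residues that define \<open>u *\<^sub>N v\<close> and \<open>O\<^sub>N(V)\<close> gives the corresponding
  residues for \<open>Y\<^sub>W(u,x)F(v)\<close> and \<open>Y\<^bsub>WV\<^esub>\<^sup>W(F(u),x)v\<close>, because \<open>F\<close> turns \<open>(1 + x)^(L(0) + N)\<close> into
  \<open>(1 + x)^(d\<^sub>W + N)\<close>; and \<open>F\<close> commutes with \<open>L(-1)\<close> because \<open>F(1) = 0\<close>. The point is that both kinds of
  residues lie in \<open>O\<^sub>N(W)\<close> and that the two actions descend to the quotients. For the left action this
  follows from the Jacobi identity with the weights \<open>(1 + x)^k\<close>, as for the Zhu algebra. Modulo \<open>O\<^sub>N(W)\<close>,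
  where \<open>L(-1) = - d\<^sub>W\<close>, the substitution \<open>y = -x/(1 + x)\<close> turns residues of \<open>Y\<^bsub>WV\<^esub>\<^sup>W\<close> into residues of
  \<open>Y\<^sub>W\<close>, which gives \<open>v * w - w * v = Res\<^sub>x Y\<^sub>W((1 + x)^(L(0) - 1) v,x)w\<close> and so reduces the right
  action to the left one. In general \<open>W\<close> is not completely reducible, but \<open>d\<^sub>W\<close> is still
  diagonalizable and has the same commutators with vertex operators as \<open>L(0)\<close>.
\<close>

section \<open>Invariant subspaces and the semisimple part\<close>

text \<open>On a vector \<open>u\<close> of weight \<open>a\<close> the operator series (1 +
  x)^(L(0) + c) u is \<open>bin (a + c)\<close> times \<open>u\<close>. So, after splitting into
  homogeneous vectors, every residue has a scalar weight x^p f(x), and membership in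
  \<open>O_W\<close> becomes bookkeeping with the exponents \<open>p\<close> and \<open>c\<close>.
  The decisive range is \<open>- 1 \<le> c\<close> and \<open>p + c + 1 \<le> 0\<close>: there the
  residue operator sends the generators of \<open>O_W\<close> with a pole of order 2N + 2 back into
  \<open>O_W\<close>. The terms of the left product have c = N and p = -N - m - 1; the residue that
  measures the difference of the two actions has c = -1 and p = 0. One computation therefore serves
  both. They differ only in the treatment of L(0) + L(-1): for the product the error terms telescope
  because of its binomial coefficients, for the difference they vanish identically. A mismatch has
  to be removed as well: \<open>O_alg\<close> has generators of every pole order from 2N + 2 on,
  \<open>O_mod\<close> only of order 2N + 2. Inserting L(-1)u for u produces the higher poles, so
  that the algebra becomes the case W = V of the module.\<close>

locale complex_vector_space = Vector_Spaces.vector_space scale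
  for scale :: "complex \<Rightarrow> 'a::ab_group_add \<Rightarrow> 'a"
begin

lemma funpow_shift_linear:
  assumes T: "Vector_Spaces.linear scale scale T"
  shows "Vector_Spaces.linear scale scale ((\<lambda>y. T y - scale c y) ^^ k)"
proof (induction k)
  case 0
  show ?case by (simp add: Vector_Spaces.linear_iff vector_space_axioms id_def)
next
  case (Suc k)
  with T show ?case
    by (simp add: Vector_Spaces.linear_iff scale_right_distrib scale_right_diff_distrib mult.commute)
qed

lemma funpow_shift_commute:
  assumes T: "Vector_Spaces.linear scale scale T"
  shows "((\<lambda>y. T y - scale c y) ^^ k) (((\<lambda>y. T y - scale d y) ^^ j) w) =
    ((\<lambda>y. T y - scale d y) ^^ j) (((\<lambda>y. T y - scale c y) ^^ k) w)"
proof -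
  define A where "A c y = T y - scale c y" for c y
  have 1: "A c (A d y) = A d (A c y)" for c d y
    using T by (simp add: A_def Vector_Spaces.linear_iff scale_right_diff_distrib module_hom.diff[OF T[folded module_hom_iff_linear]] mult.commute)
  have 2: "A c ((A d ^^ j) y) = (A d ^^ j) (A c y)" for y
  proof (induction j)
    case (Suc j)
    then show ?case by (simp add: 1[of c d "(A d ^^ j) y"])
  qed simp
  have "(A c ^^ k) ((A d ^^ j) w) = (A d ^^ j) ((A c ^^ k) w)"
    by (induction k) (simp_all add: 2)
  then show ?thesis by (simp add: A_def [abs_def])
qed

lemma subspace_gen_eigenspace:
  assumes T: "Vector_Spaces.linear scale scale T"
  shows "subspace (gen_eigenspace scale T m)"
proof (rule subspaceI)
  note lin = funpow_shift_linear[OF T, where c = m]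
  let ?A = "\<lambda>y. T y - scale m y"
  have z: "(?A ^^ k) 0 = 0" for k
    by (rule module_hom.zero[OF lin[folded module_hom_iff_linear]])
  have up: "(?A ^^ (k + j)) w = 0" if "(?A ^^ j) w = 0" for k j w
    using that z by (simp add: funpow_add)
  show "0 \<in> gen_eigenspace scale T m"
    by (auto simp: gen_eigenspace_def intro!: exI[of _ 0])
  show "x + y \<in> gen_eigenspace scale T m"
    if "x \<in> gen_eigenspace scale T m" "y \<in> gen_eigenspace scale T m" for x y
  proof -
    from that obtain i j where "(?A ^^ i) x = 0" "(?A ^^ j) y = 0"
      by (auto simp: gen_eigenspace_def)
    then have "(?A ^^ (i + j)) (x + y) = 0"
      using lin[of "i + j"] up[of i x j] up[of j y i] by (simp add: Vector_Spaces.linear_iff add.commute)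
    then show ?thesis by (auto simp: gen_eigenspace_def)
  qed
  show "scale c x \<in> gen_eigenspace scale T m" if "x \<in> gen_eigenspace scale T m" for c x
    using that module_hom.scale[OF lin[folded module_hom_iff_linear]]
    by (force simp: gen_eigenspace_def)
qed

text \<open>Modulo \<open>U\<close>, the vector \<open>w\<close> is killed by \<open>T - m0\<close>
  and by a power of \<open>T - m\<close>. These polynomials in \<open>T\<close> are coprime, so
  \<open>w\<close> is zero modulo \<open>U\<close>. The induction replaces Bezout's identity: the
  two shifts differ by the nonzero scalar \<open>m0 - m\<close>.\<close>

lemma mem_if_shift_mem:
  assumes T: "Vector_Spaces.linear scale scale T"
    and U: "subspace U" "T ` U \<subseteq> U"
    and ne: "m \<noteq> m0"
  shows "((\<lambda>y. T y - scale m y) ^^ j) w = 0 \<Longrightarrow> T w - scale m0 w \<in> U \<Longrightarrow> w \<in> U"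
proof (induction j arbitrary: w)
  case 0
  then show ?case using U(1) by (simp add: subspace_0)
next
  case (Suc j)
  let ?y = "T w - scale m w"
  have diff: "T (x - y) = T x - T y" for x y
    by (rule module_hom.diff[OF T[folded module_hom_iff_linear]])
  have "T ?y - scale m0 ?y = T (T w - scale m0 w) - scale m (T w - scale m0 w)"
    using T by (simp add: diff Vector_Spaces.linear_iff scale_right_diff_distrib mult.commute)
  also have "\<dots> \<in> U"
    using U Suc.prems(2) subspace_scale[OF U(1) Suc.prems(2), of m]
    by (intro subspace_diff[OF U(1)]) auto
  finally have "?y \<in> U"
    by (rule Suc.IH[OF Suc.prems(1)[unfolded funpow_Suc_right comp_def]])
  then have "?y - (T w - scale m0 w) \<in> U"
    by (rule subspace_diff[OF U(1) _ Suc.prems(2)])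
  moreover have "?y - (T w - scale m0 w) = scale (m0 - m) w"
    by (simp add: scale_left_diff_distrib)
  ultimately have "scale (1 / (m0 - m)) (scale (m0 - m) w) \<in> U"
    using U(1) by (simp only: subspace_scale)
  then show ?case using ne by simp
qed

lemma mem_if_funpow_shift_mem:
  assumes T: "Vector_Spaces.linear scale scale T"
    and U: "subspace U" "T ` U \<subseteq> U"
    and ne: "m \<noteq> m0"
    and w: "((\<lambda>y. T y - scale m y) ^^ j) w = 0"
  shows "((\<lambda>y. T y - scale m0 y) ^^ k) w \<in> U \<Longrightarrow> w \<in> U"
proof (induction k)
  case (Suc k)
  have "((\<lambda>y. T y - scale m y) ^^ j) (((\<lambda>y. T y - scale m0 y) ^^ k) w) = 0"
    using w funpow_shift_commute[OF T, where c = m and k = j and d = m0 and j = k and w = w]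
    by (simp add: module_hom.zero[OF funpow_shift_linear[OF T, folded module_hom_iff_linear]])
  moreover have "T (((\<lambda>y. T y - scale m0 y) ^^ k) w) - scale m0 (((\<lambda>y. T y - scale m0 y) ^^ k) w) \<in> U"
    using Suc.prems by simp
  ultimately have "((\<lambda>y. T y - scale m0 y) ^^ k) w \<in> U"
    by (rule mem_if_shift_mem[OF T U ne])
  then show ?case by (rule Suc.IH)
qed simp

text \<open>A power of \<open>T - m0\<close> kills the component at \<open>m0\<close>; the induction
  hypothesis puts the images of the others into \<open>U\<close>, and that power can be cancelled
  modulo \<open>U\<close> because the eigenvalues differ. \<open>U = {0}\<close> gives the
  independence of the generalized eigenspaces; a submodule \<open>U\<close> turns out to be spanned
  by its intersections with them.\<close>

lemma gen_eigenspace_component_mem: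
  assumes T: "Vector_Spaces.linear scale scale T"
    and U: "subspace U" "T ` U \<subseteq> U"
    and M: "finite M"
  shows "(\<And>m. m \<in> M \<Longrightarrow> c m \<in> gen_eigenspace scale T m) \<Longrightarrow> sum c M \<in> U \<Longrightarrow> m \<in> M \<Longrightarrow> c m \<in> U"
  using M
proof (induction M arbitrary: c m)
  case (insert m0 M)
  let ?A = "\<lambda>m y. T y - scale m y"
  obtain k where k: "(?A m0 ^^ k) (c m0) = 0"
    using insert.prems(1)[of m0] by (auto simp: gen_eigenspace_def)
  have lin: "Vector_Spaces.linear scale scale (?A m0 ^^ k)"
    by (rule funpow_shift_linear[OF T])
  have inv: "(?A m0 ^^ k) y \<in> U" if "y \<in> U" for y
  proof (induction k)
    case (Suc k)
    then show ?case
      using subspace_diff[OF U(1) _ subspace_scale[OF U(1) Suc]] U(2) by auto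
  qed (simp add: that)
  have "(?A m0 ^^ k) (sum c (insert m0 M)) \<in> U"
    using insert.prems(2) by (rule inv)
  moreover have "(?A m0 ^^ k) (sum c (insert m0 M)) = (\<Sum>m\<in>M. (?A m0 ^^ k) (c m))"
    using insert.hyps k
    by (simp add: module_hom.sum[OF lin[folded module_hom_iff_linear]]
        module_hom.add[OF lin[folded module_hom_iff_linear]])
  ultimately have s: "(\<Sum>m\<in>M. (?A m0 ^^ k) (c m)) \<in> U" by simp
  have g: "(?A m0 ^^ k) (c m) \<in> gen_eigenspace scale T m" if "m \<in> M" for m
  proof -
    obtain j where j: "(?A m ^^ j) (c m) = 0"
      using insert.prems(1)[OF insertI2[OF \<open>m \<in> M\<close>]] by (auto simp: gen_eigenspace_def)
    have "(?A m ^^ j) ((?A m0 ^^ k) (c m)) = 0"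
      using funpow_shift_commute[OF T, where c = m and k = j and d = m0 and j = k and w = "c m"] j
      by (simp add: module_hom.zero[OF lin[folded module_hom_iff_linear]])
    then show ?thesis by (auto simp: gen_eigenspace_def)
  qed
  have M: "c m \<in> U" if "m \<in> M" for m
  proof -
    obtain j where j: "(?A m ^^ j) (c m) = 0"
      using insert.prems(1)[OF insertI2[OF \<open>m \<in> M\<close>]] by (auto simp: gen_eigenspace_def)
    have "(?A m0 ^^ k) (c m) \<in> U"
      using insert.IH[of "\<lambda>m. (?A m0 ^^ k) (c m)" m] g s \<open>m \<in> M\<close> by blast
    moreover have "m \<noteq> m0" using insert.hyps \<open>m \<in> M\<close> by blast
    ultimately show ?thesis
      using mem_if_funpow_shift_mem[OF T U _ j] by metis
  qed
  have "c m0 = sum c (insert m0 M) - sum c M"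
    using insert.hyps by simp
  also have "\<dots> \<in> U"
    by (rule subspace_diff[OF U(1) insert.prems(2) subspace_sum[OF U(1) M]])
  finally show ?case using insert.prems(3) M by auto
qed simp

lemma gen_eigenspace_decomposition:
  assumes T: "Vector_Spaces.linear scale scale T"
    and w: "w \<in> span (\<Union>m. gen_eigenspace scale T m)"
  obtains c where "finite {m. c m \<noteq> 0}" "\<And>m. c m \<in> gen_eigenspace scale T m" "Sum_any c = w"
proof -
  have "\<exists>c. finite {m. c m \<noteq> 0} \<and> (\<forall>m. c m \<in> gen_eigenspace scale T m) \<and> Sum_any c = w"
    using w
  proof (induction rule: span_induct_alt)
    case base
    show ?case
      by (rule exI[of _ "\<lambda>_. 0"]) (simp add: subspace_0[OF subspace_gen_eigenspace[OF T]])
  next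
    case (step r x y)
    then obtain m c where x: "x \<in> gen_eigenspace scale T m"
      and c: "finite {m. c m \<noteq> 0}" "\<And>m. c m \<in> gen_eigenspace scale T m" "Sum_any c = y"
      by auto
    let ?e = "\<lambda>k. if k = m then scale r x else 0"
    have fin: "finite {k. ?e k \<noteq> 0}"
      by (rule finite_subset[of _ "{m}"]) auto
    have "finite {k. ?e k + c k \<noteq> 0}"
      by (rule finite_subset[of _ "{k. ?e k \<noteq> 0} \<union> {k. c k \<noteq> 0}"]) (use fin c in auto)
    moreover have "?e k + c k \<in> gen_eigenspace scale T k" for k
      using x c(2) subspace_gen_eigenspace[OF T, of k]
      by (auto intro: subspace_add subspace_scale)
    moreover have "Sum_any (\<lambda>k. ?e k + c k) = scale r x + y"
      using Sum_any.distrib[OF fin c(1)] c(3) by simp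
    ultimately show ?case
      by (intro exI[of _ "\<lambda>k. ?e k + c k"]) simp
  qed
  with that show ?thesis by blast
qed

lemma gen_eigenspace_decomposition_unique:
  assumes T: "Vector_Spaces.linear scale scale T"
    and c: "finite {m. c m \<noteq> 0}" "\<And>m. c m \<in> gen_eigenspace scale T m"
    and d: "finite {m. d m \<noteq> 0}" "\<And>m. d m \<in> gen_eigenspace scale T m"
    and eq: "Sum_any c = Sum_any d"
  shows "c = d"
proof
  fix m
  let ?M = "{m. c m \<noteq> 0} \<union> {m. d m \<noteq> 0} \<union> {m}"
  have fin: "finite ?M" using c d by simp
  have "sum c ?M = sum d ?M"
    using eq Sum_any.expand_superset[OF fin, of c] Sum_any.expand_superset[OF fin, of d] by (simp add: subset_iff)
  then have "(\<Sum>m\<in>?M. c m - d m) \<in> {0}"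
    by (simp add: sum_subtractf)
  moreover have "c m - d m \<in> gen_eigenspace scale T m" for m
    using c d subspace_gen_eigenspace[OF T] by (blast intro: subspace_diff)
  moreover have "T ` {0} \<subseteq> {0}"
    by (simp add: module_hom.zero[OF T[folded module_hom_iff_linear]])
  ultimately have "c m - d m \<in> {0}"
    using gen_eigenspace_component_mem[OF T _ _ fin, of "{0}" "\<lambda>m. c m - d m" m] by (simp add: subspace_def)
  then show "c m = d m" by simp
qed

text \<open>\<open>semisimple_part\<close> is a definite description and carries information only
  once exactly one such map is known. Existence: multiply each component by its eigenvalue.
  Uniqueness: the values are prescribed on a spanning set.\<close>

lemma semisimple_part_linear_and_eigen:
  assumes T: "Vector_Spaces.linear scale scale T"
    and span: "span (\<Union>m. gen_eigenspace scale T m) = UNIV"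
  shows "Vector_Spaces.linear scale scale (semisimple_part scale T) \<and>
    (\<forall>m. \<forall>w\<in>gen_eigenspace scale T m. semisimple_part scale T w = scale m w)"
proof -
  define comp where "comp w = (SOME c. finite {m. c m \<noteq> 0} \<and>
    (\<forall>m. c m \<in> gen_eigenspace scale T m) \<and> Sum_any c = w)" for w
  have "\<exists>c. finite {m. c m \<noteq> 0} \<and> (\<forall>m. c m \<in> gen_eigenspace scale T m) \<and> Sum_any c = w" for w
    by (rule gen_eigenspace_decomposition[OF T, of w]) (auto simp: span)
  then have comp: "finite {m. comp w m \<noteq> 0} \<and> (\<forall>m. comp w m \<in> gen_eigenspace scale T m)
      \<and> Sum_any (comp w) = w" for w
    unfolding comp_def by (rule someI_ex)
  have uniq: "comp w = c"
    if "finite {m. c m \<noteq> 0}" "\<And>m. c m \<in> gen_eigenspace scale T m" "Sum_any c = w" for c w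
    using gen_eigenspace_decomposition_unique[OF T, of "comp w" c] comp that by simp
  note sub = subspace_gen_eigenspace[OF T]
  have fin: "finite {m. scale (r m) (comp w m) \<noteq> 0}" for r w
    by (rule finite_subset[of _ "{m. comp w m \<noteq> 0}"]) (use comp in auto)
  have sc: "Sum_any (\<lambda>m. scale r (g m)) = scale r (Sum_any g)" if g: "finite {m. g m \<noteq> 0}" for r and g :: "complex \<Rightarrow> 'a"
  proof -
    have "Sum_any (\<lambda>m. scale r (g m)) = (\<Sum>m | g m \<noteq> 0. scale r (g m))"
      by (rule Sum_any.expand_superset) (use g in auto)
    then show ?thesis by (simp add: scale_sum_right Sum_any.expand_set)
  qed
  \<comment> \<open>\<open>comp\<close> is an arbitrary choice; uniqueness of the decomposition
    makes it linear.\<close>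
  have comp_add: "comp (x + y) = (\<lambda>m. comp x m + comp y m)" for x y
  proof (rule uniq)
    show "finite {m. comp x m + comp y m \<noteq> 0}"
      by (rule finite_subset[of _ "{m. comp x m \<noteq> 0} \<union> {m. comp y m \<noteq> 0}"]) (use comp in auto)
    show "comp x m + comp y m \<in> gen_eigenspace scale T m" for m
      using comp sub by (auto intro: subspace_add)
    show "Sum_any (\<lambda>m. comp x m + comp y m) = x + y"
      using comp Sum_any.distrib[of "comp x" "comp y"] by simp
  qed
  have comp_scale: "comp (scale r x) = (\<lambda>m. scale r (comp x m))" for r x
  proof (rule uniq)
    show "finite {m. scale r (comp x m) \<noteq> 0}" by (rule fin)
    show "scale r (comp x m) \<in> gen_eigenspace scale T m" for m
      using comp sub by (auto intro: subspace_scale)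
    show "Sum_any (\<lambda>m. scale r (comp x m)) = scale r x"
      using comp sc[of "comp x"] by simp
  qed
  define S where "S w = Sum_any (\<lambda>m. scale m (comp w m))" for w
  have S_lin: "Vector_Spaces.linear scale scale S"
    unfolding Vector_Spaces.linear_iff
  proof (intro conjI allI vector_space_axioms)
    show "S (x + y) = S x + S y" for x y
      using Sum_any.distrib[OF fin fin, of "\<lambda>m. m" x "\<lambda>m. m" y]
      by (simp add: S_def comp_add scale_right_distrib)
    show "S (scale r x) = scale r (S x)" for r x
      using sc[OF fin, of r "\<lambda>m. m" x] by (simp add: S_def comp_scale mult.commute)
  qed
  have S_eig: "S w = scale m w" if w: "w \<in> gen_eigenspace scale T m" for m w
  proof -
    have "comp w = (\<lambda>k. if k = m then w else 0)"
    proof (rule uniq)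
      show "finite {k. (if k = m then w else 0) \<noteq> 0}"
        by (rule finite_subset[of _ "{m}"]) auto
    qed (use w sub in \<open>auto simp: subspace_0\<close>)
    then have "S w = Sum_any (\<lambda>k. if k = m then scale m w else 0)"
      by (simp add: S_def if_distrib cong: if_cong)
    then show ?thesis by simp
  qed
  have uniqS: "S' = S" if lin: "Vector_Spaces.linear scale scale S'"
    and eig: "\<forall>m. \<forall>w\<in>gen_eigenspace scale T m. S' w = scale m w" for S'
  proof
    fix w
    have "w \<in> span (\<Union>m. gen_eigenspace scale T m)" by (simp add: span)
    then show "S' w = S w"
    proof (induction rule: span_induct_alt)
      case base
      show ?case
        using module_hom.zero[OF lin[folded module_hom_iff_linear]]
          module_hom.zero[OF S_lin[folded module_hom_iff_linear]] by simp
    next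
      case (step r x y)
      then show ?case using lin S_lin eig S_eig by (auto simp: Vector_Spaces.linear_iff)
    qed
  qed
  have "\<exists>!S. Vector_Spaces.linear scale scale S \<and> (\<forall>m. \<forall>w\<in>gen_eigenspace scale T m. S w = scale m w)"
    using S_lin S_eig uniqS by blast
  then show ?thesis
    unfolding semisimple_part_def by (rule theI')
qed

end

section \<open>Binomial series and graded vertex operator algebras\<close>

lemma op_choose_add_scale:
  assumes "Vector_Spaces.linear s s A"
  shows "op_choose s A k (u + v) = op_choose s A k u + op_choose s A k v"
    and "op_choose s A k (s c u) = s c (op_choose s A k u)"
proof -
  interpret Vector_Spaces.vector_space s
    using assms by (simp add: Vector_Spaces.linear_iff)
  have A: "A (x + y) = A x + A y" "A (s r x) = s r (A x)" for x y r
    using assms by (auto simp: Vector_Spaces.linear_iff)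
  show "op_choose s A k (u + v) = op_choose s A k u + op_choose s A k v"
  proof (induction k)
    case (Suc k)
    then show ?case by (simp add: A scale_right_distrib scale_right_diff_distrib)
  qed simp
  show "op_choose s A k (s c u) = s c (op_choose s A k u)"
    by (induction k) (simp_all add: A scale_right_diff_distrib mult.commute)
qed

lemma op_choose_eigenvector:
  assumes A: "Vector_Spaces.linear s s A" and u: "A u = s a u"
  shows "op_choose s A k u = s (a gchoose k) u"
proof (induction k)
  interpret Vector_Spaces.vector_space s
    using A by (simp add: Vector_Spaces.linear_iff)
  case 0
  show ?case by simp
next
  interpret Vector_Spaces.vector_space s
    using A by (simp add: Vector_Spaces.linear_iff)
  case (Suc k)
  have "of_nat (Suc k) * (a gchoose Suc k) = (a - of_nat k) * (a gchoose k)"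
    using gbinomial_mult_1[of a k] by (simp add: algebra_simps)
  then have e: "a gchoose Suc k = (a - of_nat k) * (a gchoose k) / of_nat (Suc k)"
    by (simp add: field_simps del: of_nat_Suc)
  show ?case
    using A u Suc
    by (simp add: Vector_Spaces.linear_iff e scale_left_diff_distrib[symmetric] left_diff_distrib
        del: of_nat_Suc)
qed

lemma op_choose_intertwine:
  assumes "Vector_Spaces.linear s t F" and "\<And>u. F (A u) = B (F u)"
  shows "F (op_choose s A k u) = op_choose t B k (F u)"
  using assms module_hom.diff[OF assms(1)[folded module_hom_iff_linear]]
  by (induction k) (simp_all add: Vector_Spaces.linear_iff)

text \<open>The series (1 + x)^e. The weights of \<open>V\<close> are integers, so integer exponents
  are enough; negative ones do occur, for instance for (1 + x)^(L(0) - 1) in weight 0.\<close>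

definition bin :: "int \<Rightarrow> complex fps" where
  "bin e = fps_binomial (of_int e)"

lemma bin_nth [simp]: "fps_nth (bin e) k = of_int e gchoose k"
  by (simp add: bin_def)

lemma bin_add: "bin (d + e) = bin d * bin e"
  by (simp add: bin_def fps_binomial_add_mult)

lemma bin_1: "bin 1 = 1 + fps_X"
  by (simp add: bin_def fps_binomial_1)

lemma bin_of_nat: "bin (int n) = (1 + fps_X) ^ n"
  using fps_binomial_of_nat[where 'a = complex, of n] by (simp add: bin_def)

lemma bin_plus_1: "bin (e + 1) = bin e + fps_X * bin e"
  by (simp add: bin_add bin_1 algebra_simps)

lemma fps_deriv_bin: "fps_deriv (bin e) = fps_const (of_int e) * bin (e - 1)"
proof (rule fps_ext)
  fix k
  have "of_nat (Suc k) * (of_int e gchoose Suc k) = (of_int e :: complex) * ((of_int e - 1) gchoose k)"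
    by (rule gbinomial_absorption)
  then show "fps_nth (fps_deriv (bin e)) k = fps_nth (fps_const (of_int e) * bin (e - 1)) k"
    by (simp del: of_nat_Suc)
qed

text \<open>
  \<open>hasse k p f\<close> is \<open>x^(k-p)\<close> times the Hasse derivative of order \<open>k\<close> of \<open>x^p f(x)\<close>.
\<close>

definition hasse :: "nat \<Rightarrow> int \<Rightarrow> complex fps \<Rightarrow> complex fps" where
  "hasse k p f = Abs_fps (\<lambda>r. (of_int (p + int r) gchoose k) * fps_nth f r)"

text \<open>Leibniz rule for the Hasse derivative of the product of x^p and (1 + x)^e: the index
  \<open>j\<close> counts the derivatives that fall on the second factor. On coefficients,
  Vandermonde's identity splits the binomial \<open>p + r\<close> over \<open>k\<close>, and
  trinomial revision shifts the exponent from \<open>e\<close> to \<open>e - j\<close>.\<close>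

lemma hasse_bin:
  "hasse k p (bin e) =
    (\<Sum>j\<le>k. fps_const ((of_int p gchoose (k - j)) * (of_int e gchoose j)) * (fps_X ^ j * bin (e - int j)))"
proof (rule fps_ext)
  fix r
  have trinomial: "(of_nat r gchoose j) * (of_int e gchoose r) =
      (if j \<le> r then (of_int e gchoose j) * (of_int e - of_nat j gchoose (r - j)) else (0::complex))" for j
    using gbinomial_trinomial_revision[of j r "of_int e :: complex"]
    by (simp add: mult.commute flip: binomial_gbinomial)
  have "fps_nth (hasse k p (bin e)) r = (\<Sum>j\<le>k. (of_nat r gchoose j) * (of_int p gchoose (k - j))) * (of_int e gchoose r)"
    using gbinomial_Vandermonde[where 'a = complex, of "of_nat r" "of_int p" k]
    by (simp add: hasse_def add.commute atLeast0AtMost)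
  also have "\<dots> = (\<Sum>j\<le>k. (of_int p gchoose (k - j)) *
      ((of_nat r gchoose j) * (of_int e gchoose r)))"
    by (simp add: sum_distrib_left sum_distrib_right mult_ac)
  finally show "fps_nth (hasse k p (bin e)) r = fps_nth (\<Sum>j\<le>k.
      fps_const ((of_int p gchoose (k - j)) * (of_int e gchoose j)) * (fps_X ^ j * bin (e - int j))) r"
    by (auto simp: trinomial fps_sum_nth fps_X_power_mult_nth intro!: sum.cong)
qed

lemma hasse_0_bin:
  "hasse k 0 (bin e) = fps_const (of_int e gchoose k) * (fps_X ^ k * bin (e - int k))"
proof -
  have "hasse k 0 (bin e) = (\<Sum>j\<le>k. if j = k then
      fps_const (of_int e gchoose k) * (fps_X ^ k * bin (e - int k)) else 0)"
    unfolding hasse_bin by (intro sum.cong) (auto simp: gbinomial_0_left)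
  then show ?thesis by simp
qed

section \<open>Homogeneous vectors and finite forms of the Jacobi identity\<close>

context vertex_operator_algebra
begin

sublocale complex_vector_space "vscale V"
  by (simp add: complex_vector_space_def vector_space)

lemma vir_linear: "Vector_Spaces.linear (vscale V) (vscale V) (vir V n)"
  using linear_right by (simp add: vir_def [abs_def])

lemma vmode_add_right: "vmode V u n (v + v') = vmode V u n v + vmode V u n v'"
  and vmode_scale_right: "vmode V u n (vscale V c v) = vscale V c (vmode V u n v)"
  using linear_right[of u n] by (auto simp: Vector_Spaces.linear_iff)

text \<open>Phrased with \<open>eventually\<close> so that finitely many truncation bounds can be
  merged into one by \<open>eventually_conj\<close> and
  \<open>eventually_ball_finite\<close>.\<close>

lemma vmode_eventually_zero: "\<forall>\<^sub>F T in sequentially. \<forall>i\<ge>T. vmode V u (p + int i) v = 0"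
proof -
  obtain K where "\<forall>n\<ge>K. vmode V u n v = 0" using truncation by blast
  then have "\<forall>i\<ge>nat (K - p). vmode V u (p + int i) v = 0" by auto
  then show ?thesis
    unfolding eventually_sequentially by (intro exI[of _ "nat (K - p)"]) auto
qed

text \<open>A multiple of a homogeneous vector is homogeneous of the same weight, so the scalars of
  a linear combination are absorbed and only additivity of \<open>P\<close> remains to be
  checked.\<close>

lemma homogeneous_induct [case_names homogeneous add]:
  assumes "\<And>a u. vir V 0 u = vscale V (of_int a) u \<Longrightarrow> P u"
    and "\<And>u v. P u \<Longrightarrow> P v \<Longrightarrow> P (u + v)"
  shows "P u"
proof -
  have "u \<in> span (\<Union>n::int. eigenspace (vscale V) (vir V 0) (of_int n))"
    using grading by simp
  then show ?thesis
  proof (induction rule: span_induct_alt)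
    case base
    show ?case
      by (rule assms(1)[of _ 0])
        (simp add: module_hom.zero[OF vir_linear[folded module_hom_iff_linear]])
  next
    case (step c x y)
    then obtain n where "vir V 0 x = vscale V (of_int n) x"
      by (auto simp: eigenspace_def)
    then have "vir V 0 (vscale V c x) = vscale V (of_int n) (vscale V c x)"
      using vir_linear[of 0] by (simp add: Vector_Spaces.linear_iff mult.commute)
    then show ?case using assms step.IH by blast
  qed
qed

end

lemma Sum_any_eq_sum_lessThan:
  assumes "\<And>i. i \<ge> K \<Longrightarrow> g i = 0"
  shows "Sum_any g = sum g {..<K::nat}"
proof (rule Sum_any.expand_superset)
  show "{a. g a \<noteq> 0} \<subseteq> {..<K}"
    using assms by (auto simp: not_le[symmetric])
qed simp

lemma finite_if_eventually_zero:
  fixes g :: "nat \<Rightarrow> 'a::zero"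
  assumes "\<forall>\<^sub>F T in sequentially. \<forall>i\<ge>T. g i = 0"
  shows "finite {i::nat. g i \<noteq> 0}"
proof -
  obtain T where T: "\<forall>i\<ge>T. g i = 0"
    using eventually_happens'[OF sequentially_bot assms] by blast
  have "i < T" if "g i \<noteq> 0" for i
    using spec[OF T, of i] that by linarith
  then show ?thesis
    by (auto intro: finite_subset[of _ "{..<T}"])
qed

lemma (in vertex_operator_algebra) jacobi_sums:
  fixes s :: "complex \<Rightarrow> 'w \<Rightarrow> 'w::ab_group_add"
  assumes "jacobi_identity V s Ym" and "Vector_Spaces.vector_space s"
    and left: "\<And>n w. Vector_Spaces.linear (vscale V) s (\<lambda>u. Ym u n w)"
    and right: "\<And>u n. Vector_Spaces.linear s s (Ym u n)"
    and K: "\<And>i. i \<ge> K \<Longrightarrow> vmode V u (l + int i) v = 0"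
    and M: "\<And>i. i \<ge> M \<Longrightarrow> Ym v (n + int i) w = 0" "\<And>i. i \<ge> M \<Longrightarrow> Ym u (m + int i) w = 0"
  shows "(\<Sum>i<K. s (of_int m gchoose i) (Ym (vmode V u (l + int i) v) (m + n - int i) w)) =
     (\<Sum>i<M. s ((- 1) ^ i * (of_int l gchoose i))
        (Ym u (m + l - int i) (Ym v (n + int i) w)
         - s ((- 1) powi l) (Ym v (n + l - int i) (Ym u (m + int i) w))))"
proof -
  interpret s: Vector_Spaces.vector_space s by fact
  have [simp]: "Ym 0 n w = 0" "Ym u n 0 = 0" for u n w
    using module_hom.zero[OF left[folded module_hom_iff_linear]]
      module_hom.zero[OF right[folded module_hom_iff_linear]] by auto
  show ?thesis
    using assms(1)[unfolded jacobi_identity_def, rule_format, of m u l v n w] K M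
    by (subst (asm) Sum_any_eq_sum_lessThan[of K], simp, subst (asm) Sum_any_eq_sum_lessThan[of M], simp_all)
qed

section \<open>Residues of vertex operators\<close>

lemma sum_lessThan_head:
  assumes "K > 0" and "\<And>i. i > 0 \<Longrightarrow> g i = 0"
  shows "sum g {..<K::nat} = g 0"
  using sum.mono_neutral_right[of "{..<K}" "{0}" g] assms by auto

text \<open>These axioms hold for \<open>W\<close> and for \<open>V\<close> acting on itself.
  Separating them from the gradings makes every residue lemma below available in both
  situations.\<close>

locale weak_voa_module = vertex_operator_algebra V
  for V :: "'v::ab_group_add voa" +
  fixes W :: "('v, 'w::ab_group_add) voa_module"
  assumes wscale_vector_space: "Vector_Spaces.vector_space (wscale W)"
    and wmode_linear_left: "Vector_Spaces.linear (vscale V) (wscale W) (\<lambda>u. wmode W u n w)"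
    and wmode_linear_right: "Vector_Spaces.linear (wscale W) (wscale W) (wmode W u n)"
    and wmode_truncation: "\<exists>K. \<forall>n\<ge>K. wmode W u n w = 0"
    and wmode_vacuum: "wmode W (vacuum V) n w = (if n = - 1 then w else 0)"
    and wmode_jacobi: "jacobi_identity V (wscale W) (wmode W)"
    and wmode_derivative:
      "wmode W (vir V (- 1) u) n w = wscale W (- of_int n) (wmode W u (n - 1) w)"
begin

sublocale W: complex_vector_space "wscale W"
  by (simp add: complex_vector_space_def wscale_vector_space)

lemma wmode_add_left: "wmode W (u + u') n w = wmode W u n w + wmode W u' n w"
  and wmode_scale_left: "wmode W (vscale V c u) n w = wscale W c (wmode W u n w)"
  and wmode_add_right: "wmode W u n (w + w') = wmode W u n w + wmode W u n w'"
  and wmode_scale_right: "wmode W u n (wscale W c w) = wscale W c (wmode W u n w)"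
  using wmode_linear_left[of n w] wmode_linear_right[of u n]
  by (auto simp: Vector_Spaces.linear_iff)

lemma wmode_zero_left [simp]: "wmode W 0 n w = 0"
  and wmode_zero_right [simp]: "wmode W u n 0 = 0"
  and wmode_sum_right: "wmode W u n (sum g A) = (\<Sum>i\<in>A. wmode W u n (g i))"
  using module_hom.zero[OF wmode_linear_left[folded module_hom_iff_linear]]
    module_hom.zero[OF wmode_linear_right[folded module_hom_iff_linear]]
    module_hom.sum[OF wmode_linear_right[folded module_hom_iff_linear]] by auto

lemma wmode_eventually_zero: "\<forall>\<^sub>F T in sequentially. \<forall>i\<ge>T. wmode W u (p + int i) w = 0"
proof -
  obtain K where "\<forall>n\<ge>K. wmode W u n w = 0" using wmode_truncation by blast
  then have "\<forall>i\<ge>nat (K - p). wmode W u (p + int i) w = 0" by auto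
  then show ?thesis
    unfolding eventually_sequentially by (intro exI[of _ "nat (K - p)"]) auto
qed

lemmas wmode_jacobi_sums = jacobi_sums[OF wmode_jacobi wscale_vector_space wmode_linear_left wmode_linear_right]

text \<open>The case l = 0 of the Jacobi identity: on the right only the summand i = 0 has a nonzero
  binomial, and \<open>M > 0\<close> keeps it in range.\<close>

lemma wmode_commutator:
  assumes K: "\<And>i. i \<ge> K \<Longrightarrow> vmode V u (int i) v = 0"
  shows "wmode W u m (wmode W v n w) - wmode W v n (wmode W u m w) =
    (\<Sum>i<K. wscale W (of_int m gchoose i) (wmode W (vmode V u (int i) v) (m + n - int i) w))"
proof -
  obtain M where M: "\<And>i. i \<ge> M \<Longrightarrow> wmode W v (n + int i) w = 0"
      "\<And>i. i \<ge> M \<Longrightarrow> wmode W u (m + int i) w = 0" "M > 0"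
    using eventually_conj[OF eventually_conj[OF wmode_eventually_zero[of v n w] wmode_eventually_zero[of u m w]]
        eventually_gt_at_top[of 0]]
    unfolding eventually_sequentially by blast
  show ?thesis
    using wmode_jacobi_sums[of K u 0 v M n w m] K M
    by (simp add: sum_lessThan_head gbinomial_0_left)
qed

lemma wvir_minus_1_commutator:
  "wvir V W (- 1) (wmode W v n w) = wmode W v n (wvir V W (- 1) w) - wscale W (of_int n) (wmode W v (n - 1) w)"
proof -
  obtain K where K: "\<And>i. i \<ge> K \<Longrightarrow> vmode V (conformal V) (int i) v = 0" "K > 0"
    using eventually_conj[OF vmode_eventually_zero[of "conformal V" 0 v] eventually_gt_at_top[of 0]]
    unfolding eventually_sequentially by auto
  have "wvir V W (- 1) (wmode W v n w) - wmode W v n (wvir V W (- 1) w) = wmode W (vir V (- 1) v) n w"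
    using wmode_commutator[of K "conformal V" v 0 n w] K
    by (simp add: sum_lessThan_head wvir_def vir_def gbinomial_0_left)
  then show ?thesis by (simp add: wmode_derivative algebra_simps)
qed

text \<open>\<open>L(0)\<close> is the mode of index 1 of the conformal vector, so two terms of the
  commutator formula survive: the mode of \<open>L(-1)v\<close> contributes the factor -n - 1 and
  that of \<open>L(0)v\<close> the factor a.\<close>

lemma wvir_0_commutator:
  assumes v: "vir V 0 v = vscale V (of_int a) v"
  shows "wvir V W 0 (wmode W v n w) = wmode W v n (wvir V W 0 w) + wscale W (of_int (a - n - 1)) (wmode W v n w)"
proof -
  obtain K where K: "\<And>i. i \<ge> K \<Longrightarrow> vmode V (conformal V) (int i) v = 0" "K > 1"
    using eventually_conj[OF vmode_eventually_zero[of "conformal V" 0 v] eventually_gt_at_top[of 1]]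
    unfolding eventually_sequentially by auto
  have c: "(1::complex) gchoose i = (if i = 0 \<or> i = 1 then 1 else 0)" for i
  proof (cases "i = 0 \<or> i = 1")
    case False
    then have "(of_nat 1 :: complex) gchoose i = 0" by (subst binomial_gbinomial[symmetric]) simp
    with False show ?thesis by simp
  qed auto
  have "wvir V W 0 (wmode W v n w) - wmode W v n (wvir V W 0 w) =
    (\<Sum>i<K. if i = 0 \<or> i = 1 then wmode W (vir V (int i - 1) v) (n + 1 - int i) w else 0)"
    using wmode_commutator[of K "conformal V" v 1 n w] K
    by (auto simp: wvir_def vir_def c algebra_simps intro!: sum.cong)
  also have "\<dots> = (\<Sum>i\<in>{0,1}. wmode W (vir V (int i - 1) v) (n + 1 - int i) w)"
    using K(2) by (intro sum.mono_neutral_cong_right) auto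
  also have "\<dots> = wscale W (of_int (a - n - 1)) (wmode W v n w)"
    by (simp add: wmode_derivative v wmode_scale_left W.scale_left_diff_distrib W.scale_left_distrib
        flip: W.scale_left_distrib)
  finally show ?thesis by (simp add: algebra_simps)
qed

text \<open>\<open>Res\<^sub>x x^p f(x) Y\<^sub>W(u,x)w\<close>\<close>

definition res :: "int \<Rightarrow> complex fps \<Rightarrow> 'v \<Rightarrow> 'w \<Rightarrow> 'w" where
  "res p f u w = Sum_any (\<lambda>i. wscale W (fps_nth f i) (wmode W u (p + int i) w))"

lemma res_eq_sum:
  assumes "\<And>i. i \<ge> K \<Longrightarrow> wmode W u (p + int i) w = 0"
  shows "res p f u w = (\<Sum>i<K. wscale W (fps_nth f i) (wmode W u (p + int i) w))"
  unfolding res_def by (rule Sum_any_eq_sum_lessThan) (simp add: assms)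

lemma eventually_res_eq_sum:
  "\<forall>\<^sub>F K in sequentially. res p f u w = (\<Sum>i<K. wscale W (fps_nth f i) (wmode W u (p + int i) w))"
  using wmode_eventually_zero[of u p w] by eventually_elim (rule res_eq_sum, blast)

lemma res_add_right: "res p f u (w + w') = res p f u w + res p f u w'"
proof -
  from eventually_conj[OF eventually_res_eq_sum[of p f u w]
      eventually_conj[OF eventually_res_eq_sum[of p f u w'] eventually_res_eq_sum[of p f u "w + w'"]]]
  obtain K where "res p f u w = (\<Sum>i<K. wscale W (fps_nth f i) (wmode W u (p + int i) w))"
    "res p f u w' = (\<Sum>i<K. wscale W (fps_nth f i) (wmode W u (p + int i) w'))"
    "res p f u (w + w') = (\<Sum>i<K. wscale W (fps_nth f i) (wmode W u (p + int i) (w + w')))"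
    using eventually_happens'[OF sequentially_bot] by blast
  then show ?thesis by (simp add: wmode_add_right W.scale_right_distrib sum.distrib)
qed

lemma res_add_fps: "res p (f + g) u w = res p f u w + res p g u w"
proof -
  from eventually_conj[OF eventually_res_eq_sum[of p f u w]
      eventually_conj[OF eventually_res_eq_sum[of p g u w] eventually_res_eq_sum[of p "f + g" u w]]]
  obtain K where "res p f u w = (\<Sum>i<K. wscale W (fps_nth f i) (wmode W u (p + int i) w))"
    "res p g u w = (\<Sum>i<K. wscale W (fps_nth g i) (wmode W u (p + int i) w))"
    "res p (f + g) u w = (\<Sum>i<K. wscale W (fps_nth (f + g) i) (wmode W u (p + int i) w))"
    using eventually_happens'[OF sequentially_bot] by blast
  then show ?thesis by (simp add: W.scale_left_distrib sum.distrib)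
qed

lemma res_scale_fps: "res p (fps_const c * f) u w = wscale W c (res p f u w)"
proof -
  from eventually_conj[OF eventually_res_eq_sum[of p f u w] eventually_res_eq_sum[of p "fps_const c * f" u w]]
  obtain K where "res p f u w = (\<Sum>i<K. wscale W (fps_nth f i) (wmode W u (p + int i) w))"
    "res p (fps_const c * f) u w = (\<Sum>i<K. wscale W (fps_nth (fps_const c * f) i) (wmode W u (p + int i) w))"
    using eventually_happens'[OF sequentially_bot] by blast
  then show ?thesis by (simp add: W.scale_sum_right)
qed

lemma res_zero_fps [simp]: "res p 0 u w = 0"
  by (simp add: res_def)

lemma res_sum_fps: "res p (sum f A) u w = (\<Sum>i\<in>A. res p (f i) u w)"
  by (induction A rule: infinite_finite_induct) (simp_all add: res_add_fps)

lemma res_X: "res p (fps_X * f) u w = res (p + 1) f u w"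
proof -
  from eventually_conj[OF wmode_eventually_zero[of u "p + 1" w] wmode_eventually_zero[of u p w]]
  obtain K where K: "\<forall>i\<ge>K. wmode W u (p + 1 + int i) w = 0" "\<forall>i\<ge>K. wmode W u (p + int i) w = 0"
    using eventually_happens'[OF sequentially_bot] by blast
  have "res p (fps_X * f) u w = (\<Sum>i<Suc K. wscale W (fps_nth (fps_X * f) i) (wmode W u (p + int i) w))"
    using K by (intro res_eq_sum) auto
  also have "\<dots> = (\<Sum>i<K. wscale W (fps_nth f i) (wmode W u (p + 1 + int i) w))"
    by (subst sum.lessThan_Suc_shift) (simp add: add_ac)
  also have "\<dots> = res (p + 1) f u w"
    using K by (intro res_eq_sum[symmetric]) auto
  finally show ?thesis .
qed

lemma res_X_power: "res p (fps_X ^ k * f) u w = res (p + int k) f u w"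
  by (induction k arbitrary: p) (simp_all add: mult.assoc res_X add_ac)

text \<open>Integration by parts, \<open>Y\<^sub>W(L(-1)u,x)\<close> being the derivative of \<open>Y\<^sub>W(u,x)\<close>.\<close>

lemma res_derivative:
  "res p f (vir V (- 1) u) w = - res (p - 1) (fps_const (of_int p) * f + fps_X * fps_deriv f) u w"
proof -
  let ?g = "fps_const (of_int p) * f + fps_X * fps_deriv f"
  from eventually_conj[OF eventually_res_eq_sum[of p f "vir V (- 1) u" w]
      eventually_res_eq_sum[of "p - 1" ?g u w]]
  obtain K where K: "res p f (vir V (- 1) u) w =
      (\<Sum>i<K. wscale W (fps_nth f i) (wmode W (vir V (- 1) u) (p + int i) w))"
    "res (p - 1) ?g u w = (\<Sum>i<K. wscale W (fps_nth ?g i) (wmode W u (p - 1 + int i) w))"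
    using eventually_happens'[OF sequentially_bot] by blast
  have g: "fps_nth ?g i = (of_int p + of_nat i) * fps_nth f i" for i
    by (cases i) (simp_all add: algebra_simps)
  show ?thesis
    unfolding K g sum_negf[symmetric]
    by (intro sum.cong)
      (simp_all add: wmode_derivative algebra_simps flip: W.scale_minus_left W.scale_left_distrib)
qed

lemma res_commutes_wvir:
  "wvir V W (- 1) (res p f u w) = res p f u (wvir V W (- 1) w) + res p f (vir V (- 1) u) w"
proof -
  have wvir_sum: "wvir V W (- 1) (sum g A) = (\<Sum>i\<in>A. wvir V W (- 1) (g i))" for g and A :: "nat set"
    by (simp add: wvir_def wmode_sum_right)
  have wvir_scale: "wvir V W (- 1) (wscale W c y) = wscale W c (wvir V W (- 1) y)" for c y
    by (simp add: wvir_def wmode_scale_right)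
  from eventually_conj[OF eventually_res_eq_sum[of p f u w]
      eventually_conj[OF eventually_res_eq_sum[of p f u "wvir V W (- 1) w"]
        eventually_res_eq_sum[of p f "vir V (- 1) u" w]]]
  obtain K where "res p f u w = (\<Sum>i<K. wscale W (fps_nth f i) (wmode W u (p + int i) w))"
    "res p f u (wvir V W (- 1) w) = (\<Sum>i<K. wscale W (fps_nth f i) (wmode W u (p + int i) (wvir V W (- 1) w)))"
    "res p f (vir V (- 1) u) w = (\<Sum>i<K. wscale W (fps_nth f i) (wmode W (vir V (- 1) u) (p + int i) w))"
    using eventually_happens'[OF sequentially_bot] by blast
  then show ?thesis
    by (simp add: wvir_sum wvir_scale wvir_minus_1_commutator wmode_derivative
        W.scale_right_diff_distrib sum_subtractf)
      (simp add: algebra_simps flip: sum_negf)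
qed

text \<open>The square of indices differs from the triangle of the Cauchy product only where
  \<open>r + s \<ge> T\<close>, and there the mode is zero.\<close>

lemma res_mult:
  assumes T: "\<And>t. t \<ge> T \<Longrightarrow> wmode W u (p + int t) w = 0"
  shows "(\<Sum>r<T. \<Sum>s<T. wscale W (fps_nth f r * fps_nth g s) (wmode W u (p + int r + int s) w)) =
    res p (f * g) u w"
proof -
  let ?h = "\<lambda>i j. wscale W (fps_nth f i * fps_nth g j) (wmode W u (p + int i + int j) w)"
  have z: "?h i j = 0" if "i + j \<ge> T" for i j
    using T[OF that] by (simp add: add.assoc)
  have "(\<Sum>r<T. \<Sum>s<T. ?h r s) = (\<Sum>(i, j)\<in>{..<T} \<times> {..<T}. ?h i j)"
    by (simp add: sum.cartesian_product)
  also have "\<dots> = (\<Sum>(i, j)\<in>{(i, j). i + j < T}. ?h i j)"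
  proof (intro sum.mono_neutral_right ballI)
    show "(case x of (i, j) \<Rightarrow> ?h i j) = 0" if "x \<in> {..<T} \<times> {..<T} - {(i, j). i + j < T}" for x
      using z[of "fst x" "snd x"] that by (cases x) simp
  qed auto
  also have "\<dots> = (\<Sum>t<T. \<Sum>i\<le>t. ?h i (t - i))"
    by (rule sum.triangle_reindex)
  also have "\<dots> = (\<Sum>t<T. wscale W (fps_nth (f * g) t) (wmode W u (p + int t) w))"
    by (intro sum.cong refl)
      (simp add: fps_mult_nth W.scale_sum_left atLeast0AtMost add.assoc flip: of_nat_add)
  also have "\<dots> = res p (f * g) u w"
    by (rule res_eq_sum[symmetric]) (rule T)
  finally show ?thesis .
qed

text \<open>The bounds come in a fixed order: \<open>S\<close> truncates the inner operator, and
  only then are the finitely many inner vectors known for which \<open>T\<close> must truncate the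
  outer one.\<close>

lemma sum_sum_eq_res_res:
  assumes S: "\<And>s. s \<ge> S \<Longrightarrow> wmode W v (q + int s) w = 0"
    and T: "\<And>r s. s < S \<Longrightarrow> r \<ge> T \<Longrightarrow> wmode W u (p + int r) (wmode W v (q + int s) w) = 0"
    and "S \<le> T"
  shows "(\<Sum>r<T. \<Sum>s<T. wscale W (fps_nth f r * fps_nth g s)
      (wmode W u (p + int r) (wmode W v (q + int s) w))) = res p f u (res q g v w)"
proof -
  have z: "wmode W u (p + int r) (wmode W v (q + int s) w) = 0" if "r \<ge> T" for r s
    using S T that by (cases "s < S") auto
  have "res q g v w = (\<Sum>s<T. wscale W (fps_nth g s) (wmode W v (q + int s) w))"
    using S \<open>S \<le> T\<close> by (intro res_eq_sum) auto
  moreover have "res p f u (\<Sum>s<T. wscale W (fps_nth g s) (wmode W v (q + int s) w)) =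
      (\<Sum>r<T. wscale W (fps_nth f r)
        (wmode W u (p + int r) (\<Sum>s<T. wscale W (fps_nth g s) (wmode W v (q + int s) w))))"
    using z by (intro res_eq_sum) (simp add: wmode_sum_right wmode_scale_right)
  ultimately show ?thesis
    by (simp add: wmode_sum_right wmode_scale_right W.scale_sum_right)
qed

text \<open>
  The Jacobi identity applied to the function \<open>x^p f(x) y^q g(y) (x - y)^l\<close>.
\<close>

lemma res_jacobi:
  assumes K: "\<And>i. i \<ge> K \<Longrightarrow> vmode V u (l + int i) v = 0"
    and M: "\<And>i. i \<ge> M \<Longrightarrow> wmode W v (q + int i) w = 0" "\<And>i. i \<ge> M \<Longrightarrow> wmode W u (p + int i) w = 0"
  shows "(\<Sum>k<K. res (p + q - int k) (hasse k p f * g) (vmode V u (l + int k) v) w) =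
    (\<Sum>i<M. wscale W ((- 1) ^ i * (of_int l gchoose i))
      (res (p + l - int i) f u (res (q + int i) g v w)
       - wscale W ((- 1) powi l) (res (q + l - int i) g v (res (p + int i) f u w))))"
proof -
  \<comment> \<open>A single \<open>T\<close> has to truncate all products and both kinds of
    iterated modes. It is chosen after \<open>K\<close> and \<open>M\<close>, which leave finitely
    many conditions.\<close>
  have ev1: "\<forall>\<^sub>F T in sequentially. \<forall>k\<in>{..<K}. \<forall>t\<ge>T.
      wmode W (vmode V u (l + int k) v) (p + q - int k + int t) w = 0"
    by (intro eventually_ball_finite ballI wmode_eventually_zero) auto
  have ev2: "\<forall>\<^sub>F T in sequentially. \<forall>i\<in>{..<M}. \<forall>s\<in>{..<M}. \<forall>r\<ge>T.
      wmode W u (p + l - int i + int r) (wmode W v (q + int i + int s) w) = 0"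
    by (intro eventually_ball_finite ballI wmode_eventually_zero) auto
  have ev3: "\<forall>\<^sub>F T in sequentially. \<forall>i\<in>{..<M}. \<forall>s\<in>{..<M}. \<forall>r\<ge>T.
      wmode W v (q + l - int i + int r) (wmode W u (p + int i + int s) w) = 0"
    by (intro eventually_ball_finite ballI wmode_eventually_zero) auto
  obtain T where T1: "\<And>k t. k < K \<Longrightarrow> t \<ge> T \<Longrightarrow>
        wmode W (vmode V u (l + int k) v) (p + q - int k + int t) w = 0"
    and T2: "\<And>i s r. i < M \<Longrightarrow> s < M \<Longrightarrow> r \<ge> T \<Longrightarrow>
        wmode W u (p + l - int i + int r) (wmode W v (q + int i + int s) w) = 0"
    and T3: "\<And>i s r. i < M \<Longrightarrow> s < M \<Longrightarrow> r \<ge> T \<Longrightarrow>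
        wmode W v (q + l - int i + int r) (wmode W u (p + int i + int s) w) = 0"
    and "M \<le> T"
    using eventually_conj[OF eventually_conj[OF ev1 ev2] eventually_conj[OF ev3 eventually_ge_at_top[of M]]]
    unfolding eventually_sequentially by (metis lessThan_iff order_refl)
  define c where "c i = (- 1) ^ i * (of_int l gchoose i :: complex)" for i
  have M': "wmode W v (q + int i + int s) w = 0" "wmode W u (p + int i + int s) w = 0" if "s \<ge> M" for i s
    using M[of "i + s"] that by (auto simp: add.assoc)
  have sw: "(\<Sum>s<T. \<Sum>r<T. wscale W (fps_nth g s * fps_nth f r)
          (wmode W v (q + l - int i + int s) (wmode W u (p + int i + int r) w))) =
      (\<Sum>r<T. \<Sum>s<T. wscale W (fps_nth g s * fps_nth f r)
          (wmode W v (q + l - int i + int s) (wmode W u (p + int i + int r) w)))" for i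
    by (rule sum.swap)
  \<comment> \<open>The identity for the monomials x^(p + r) y^(q + s). Weighting it by the
    coefficients of \<open>f\<close> and \<open>g\<close> and summing gives the claim; the binomial
    \<open>p + r\<close> over \<open>k\<close> is the factor by which \<open>hasse k p f\<close>
    differs from \<open>f\<close>.\<close>
  have jac: "(\<Sum>k<K. wscale W (of_int (p + int r) gchoose k)
        (wmode W (vmode V u (l + int k) v) ((p + int r) + (q + int s) - int k) w)) =
      (\<Sum>i<M. wscale W (c i) (wmode W u (p + int r + l - int i) (wmode W v (q + int s + int i) w)
         - wscale W ((- 1) powi l) (wmode W v (q + int s + l - int i) (wmode W u (p + int r + int i) w))))"
    for r s
    unfolding c_def
  proof (rule wmode_jacobi_sums)
    show "wmode W v (q + int s + int i) w = 0" "wmode W u (p + int r + int i) w = 0" if "i \<ge> M" for i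
      using M'[OF that, of s] M'[OF that, of r] by (simp_all add: add_ac)
  qed (rule K)
  have "(\<Sum>k<K. res (p + q - int k) (hasse k p f * g) (vmode V u (l + int k) v) w) =
      (\<Sum>k<K. \<Sum>r<T. \<Sum>s<T. wscale W (fps_nth (hasse k p f) r * fps_nth g s)
        (wmode W (vmode V u (l + int k) v) (p + q - int k + int r + int s) w))"
    using T1 by (intro sum.cong refl res_mult[symmetric]) auto
  also have "\<dots> = (\<Sum>r<T. \<Sum>s<T. \<Sum>k<K. wscale W (fps_nth (hasse k p f) r * fps_nth g s)
        (wmode W (vmode V u (l + int k) v) (p + q - int k + int r + int s) w))"
    by (subst sum.swap) (rule sum.cong[OF refl], rule sum.swap)
  also have "\<dots> = (\<Sum>r<T. \<Sum>s<T. wscale W (fps_nth f r * fps_nth g s) (\<Sum>k<K.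
        wscale W (of_int (p + int r) gchoose k)
          (wmode W (vmode V u (l + int k) v) ((p + int r) + (q + int s) - int k) w)))"
    by (intro sum.cong refl) (simp add: W.scale_sum_right hasse_def algebra_simps)
  also have "\<dots> = (\<Sum>r<T. \<Sum>s<T. wscale W (fps_nth f r * fps_nth g s) (\<Sum>i<M. wscale W (c i)
        (wmode W u (p + int r + l - int i) (wmode W v (q + int s + int i) w)
         - wscale W ((- 1) powi l) (wmode W v (q + int s + l - int i) (wmode W u (p + int r + int i) w)))))"
    by (simp only: jac)
  also have "\<dots> = (\<Sum>r<T. \<Sum>s<T. \<Sum>i<M. wscale W (c i)
        (wscale W (fps_nth f r * fps_nth g s)
          (wmode W u (p + l - int i + int r) (wmode W v (q + int i + int s) w))
         - wscale W ((- 1) powi l) (wscale W (fps_nth g s * fps_nth f r)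
          (wmode W v (q + l - int i + int s) (wmode W u (p + int i + int r) w)))))"
    by (intro sum.cong refl) (simp add: W.scale_sum_right W.scale_right_diff_distrib algebra_simps)
  also have "\<dots> = (\<Sum>i<M. \<Sum>r<T. \<Sum>s<T. wscale W (c i)
        (wscale W (fps_nth f r * fps_nth g s)
          (wmode W u (p + l - int i + int r) (wmode W v (q + int i + int s) w))
         - wscale W ((- 1) powi l) (wscale W (fps_nth g s * fps_nth f r)
          (wmode W v (q + l - int i + int s) (wmode W u (p + int i + int r) w)))))"
    by (subst (2) sum.swap, subst sum.swap) (rule sum.cong[OF refl], rule refl)
  also have "\<dots> = (\<Sum>i<M. wscale W (c i)
        ((\<Sum>r<T. \<Sum>s<T. wscale W (fps_nth f r * fps_nth g s)
          (wmode W u (p + l - int i + int r) (wmode W v (q + int i + int s) w)))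
         - wscale W ((- 1) powi l) (\<Sum>s<T. \<Sum>r<T. wscale W (fps_nth g s * fps_nth f r)
          (wmode W v (q + l - int i + int s) (wmode W u (p + int i + int r) w)))))"
    unfolding sw by (simp add: W.scale_sum_right W.scale_right_diff_distrib sum_subtractf)
  also have "\<dots> = (\<Sum>i<M. wscale W (c i)
      (res (p + l - int i) f u (res (q + int i) g v w)
       - wscale W ((- 1) powi l) (res (q + l - int i) g v (res (p + int i) f u w))))"
    using T2 T3 M' \<open>M \<le> T\<close>
    by (intro sum.cong refl) (subst (1 2) sum_sum_eq_res_res[of M], auto)
  finally show ?thesis by (simp add: c_def)
qed

end

section \<open>The subspace \<open>O\<^sub>N(W)\<close> and the left action\<close>

text \<open>\<open>V\<close> as a module over itself with \<open>L(0)\<close> as grading operator,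
  so that the product of the algebra is the left action of this module.\<close>

definition adjoint :: "'v voa \<Rightarrow> ('v, 'v) voa_module" where
  "adjoint V = \<lparr>wscale = vscale V, wmode = vmode V, dgrad = vir V 0\<rparr>"

lemma adjoint_simps [simp]:
  "wscale (adjoint V) = vscale V" "wmode (adjoint V) = vmode V" "dgrad (adjoint V) = vir V 0"
  "wvir V (adjoint V) = vir V"
  by (simp_all add: adjoint_def wvir_def vir_def fun_eq_iff)

context vertex_operator_algebra
begin

lemma weak_voa_module_adjoint: "weak_voa_module V (adjoint V)"
  by (intro weak_voa_module.intro weak_voa_module_axioms.intro vertex_operator_algebra_axioms;
      unfold adjoint_simps)
    (fact vector_space linear_left linear_right truncation vacuum jacobi derivative)+

lemma vmode_homogeneous:
  assumes "vir V 0 u = vscale V (of_int a) u" and "vir V 0 v = vscale V (of_int b) v"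
  shows "vir V 0 (vmode V u n v) = vscale V (of_int (a + b - n - 1)) (vmode V u n v)"
  using weak_voa_module.wvir_0_commutator[OF weak_voa_module_adjoint assms(1), of n v] assms(2)
  by (simp add: vmode_scale_right algebra_simps)

lemma conformal_homogeneous: "vir V 0 (conformal V) = vscale V (of_int 2) (conformal V)"
proof -
  obtain c where "virasoro_relations (vscale V) (vir V) c" using virasoro by blast
  \<comment> \<open>The conformal vector is L(-2) applied to the vacuum, and L(0) kills the vacuum.
    The bracket of L(0) and L(-2) has no central term, since the indices do not add up to 0.\<close>
  then have "vir V 0 (vir V (- 2) (vacuum V)) - vir V (- 2) (vir V 0 (vacuum V)) =
      vscale V 2 (vir V (- 2) (vacuum V))"
    unfolding virasoro_relations_def by (elim allE[of _ 0] allE[of _ "- 2"] allE[of _ "vacuum V"]) simp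
  moreover have "vir V (- 2) (vacuum V) = conformal V" "vir V 0 (vacuum V) = 0"
    by (simp_all add: vir_def creation)
  ultimately show ?thesis
    by (simp add: module_hom.zero[OF vir_linear[folded module_hom_iff_linear]])
qed

lemma vir_minus_1_homogeneous:
  assumes "vir V 0 u = vscale V (of_int a) u"
  shows "vir V 0 (vir V (- 1) u) = vscale V (of_int (a + 1)) (vir V (- 1) u)"
  using vmode_homogeneous[OF conformal_homogeneous assms, of 0] by (simp add: vir_def add.commute)

end

lemma twisted_op_linear:
  assumes "Vector_Spaces.linear s s A"
  shows "Vector_Spaces.linear s s (\<lambda>y. A y + s c y)"
proof -
  interpret Vector_Spaces.vector_space s
    using assms by (simp add: Vector_Spaces.linear_iff)
  show ?thesis
    using assms by (simp add: Vector_Spaces.linear_iff scale_right_distrib add_ac mult.commute)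
qed

section \<open>Residues weighted by (1 + x)^(L(0) + c)\<close>

context weak_voa_module
begin

text \<open>\<open>Res\<^sub>x x^p Y\<^sub>W((1 + x)^(L(0) + c) u,x)w\<close>\<close>

definition opres :: "int \<Rightarrow> int \<Rightarrow> 'v \<Rightarrow> 'w \<Rightarrow> 'w" where
  "opres c p u w = Sum_any (\<lambda>k.
     wmode W (op_choose (vscale V) (\<lambda>y. vir V 0 y + vscale V (of_int c) y) k u) (p + int k) w)"

lemmas op_linear = twisted_op_linear[OF vir_linear[of 0]]

lemma op_choose_homogeneous:
  assumes u: "vir V 0 u = vscale V (of_int a) u"
  shows "op_choose (vscale V) (\<lambda>y. vir V 0 y + vscale V (of_int c) y) k u =
    vscale V (of_int (a + c) gchoose k) u"
  by (rule op_choose_eigenvector[OF op_linear]) (simp add: u scale_left_distrib)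

lemma opres_homogeneous:
  assumes u: "vir V 0 u = vscale V (of_int a) u"
  shows "opres c p u w = res p (bin (a + c)) u w"
  by (simp add: opres_def res_def op_choose_homogeneous[OF u] wmode_scale_left)

text \<open>The vector in the mode changes with the index, so truncation does not apply directly.
  For homogeneous \<open>u\<close> it only changes by a scalar, and the conclusion passes to
  sums.\<close>

lemma op_eventually_zero:
  "\<forall>\<^sub>F T in sequentially. \<forall>i\<ge>T.
    wmode W (op_choose (vscale V) (\<lambda>y. vir V 0 y + vscale V (of_int c) y) i u) (p + int i) w = 0"
proof (induction u rule: homogeneous_induct)
  case (homogeneous a u)
  then show ?case
    using wmode_eventually_zero[of u p w]
    by (auto simp: op_choose_homogeneous[OF homogeneous] wmode_scale_left elim: eventually_mono)
next
  case (add u v)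
  then show ?case
    by eventually_elim (simp add: op_choose_add_scale[OF op_linear] wmode_add_left)
qed

lemma Sum_any_scale:
  fixes g :: "nat \<Rightarrow> 'w"
  assumes "finite {i. g i \<noteq> 0}"
  shows "Sum_any (\<lambda>i. wscale W c (g i)) = wscale W c (Sum_any g)"
proof -
  have "Sum_any (\<lambda>i. wscale W c (g i)) = (\<Sum>i | g i \<noteq> 0. wscale W c (g i))"
    by (rule Sum_any.expand_superset) (use assms in auto)
  then show ?thesis by (simp add: W.scale_sum_right Sum_any.expand_set)
qed

lemmas op_finite = finite_if_eventually_zero[OF op_eventually_zero]

lemma opres_add_left: "opres c p (u + v) w = opres c p u w + opres c p v w"
  by (simp add: opres_def op_choose_add_scale[OF op_linear] wmode_add_left Sum_any.distrib op_finite)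

lemma opres_add_right: "opres c p u (w + w') = opres c p u w + opres c p u w'"
  by (simp add: opres_def wmode_add_right Sum_any.distrib op_finite)

lemma opres_scale_left: "opres c p (vscale V r u) w = wscale W r (opres c p u w)"
  by (simp add: opres_def op_choose_add_scale[OF op_linear] wmode_scale_left Sum_any_scale op_finite)

lemma opres_scale_right: "opres c p u (wscale W r w) = wscale W r (opres c p u w)"
  by (simp add: opres_def wmode_scale_right Sum_any_scale op_finite)

lemma opres_linear_left: "Vector_Spaces.linear (vscale V) (wscale W) (\<lambda>u. opres c p u w)"
  and opres_linear_right: "Vector_Spaces.linear (wscale W) (wscale W) (opres c p u)"
  by (simp_all add: Vector_Spaces.linear_iff opres_add_left opres_add_right opres_scale_left
      opres_scale_right wscale_vector_space vector_space)

lemma Res_twisted_eq_opres: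
  "Res_xpow p (twisted (vscale V) (vir V 0) N (Yser (wmode W)) u w) = opres (int N) p u w"
  by (simp add: Res_xpow_def twisted_def opres_def Yser_def algebra_simps)

lemma star_left_eq: "star_left V W N u w =
    (\<Sum>m\<le>N. wscale W ((- 1) ^ m * of_nat ((m + N) choose N)) (opres (int N) (- int N - int m - 1) u w))"
  by (simp add: star_left_def star_residue_def Res_twisted_eq_opres)

lemma star_left_linear_left: "Vector_Spaces.linear (vscale V) (wscale W) (\<lambda>u. star_left V W N u w)"
  and star_left_linear_right: "Vector_Spaces.linear (wscale W) (wscale W) (star_left V W N u)"
  by (simp_all add: Vector_Spaces.linear_iff star_left_eq opres_add_left opres_add_right opres_scale_left
      opres_scale_right wscale_vector_space vector_space W.scale_right_distrib sum.distrib W.scale_sum_right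
      mult.commute)

end

text \<open>The commutator formula is the only link between \<open>dgrad\<close> and
  \<open>L(0)\<close>; both conditions survive a shift of \<open>dgrad\<close> by a constant. The
  weights in \<open>W\<close> are arbitrary complex numbers, those in \<open>V\<close>
  integers.\<close>

locale graded_voa_module = weak_voa_module V W
  for V :: "'v::ab_group_add voa" and W :: "('v, 'w::ab_group_add) voa_module" +
  fixes N :: nat
  assumes dgrad_linear: "Vector_Spaces.linear (wscale W) (wscale W) (dgrad W)"
    and dgrad_diagonalizable: "W.span (\<Union>m. eigenspace (wscale W) (dgrad W) m) = UNIV"
    and dgrad_wmode: "vir V 0 u = vscale V (of_int a) u \<Longrightarrow> dgrad W (wmode W u n w) =
      wmode W u n (dgrad W w) + wscale W (of_int (a - n - 1)) (wmode W u n w)"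
begin

lemma module_homogeneous_induct [case_names homogeneous add]:
  assumes "\<And>m w. dgrad W w = wscale W m w \<Longrightarrow> P w"
    and "\<And>w w'. P w \<Longrightarrow> P w' \<Longrightarrow> P (w + w')"
  shows "P w"
proof -
  have "w \<in> W.span (\<Union>m. eigenspace (wscale W) (dgrad W) m)"
    using dgrad_diagonalizable by simp
  then show ?thesis
  proof (induction rule: W.span_induct_alt)
    case base
    show ?case
      by (rule assms(1)[of _ 0])
        (simp add: module_hom.zero[OF dgrad_linear[folded module_hom_iff_linear]])
  next
    case (step c x y)
    then obtain m where "dgrad W x = wscale W m x"
      by (auto simp: eigenspace_def)
    then have "dgrad W (wscale W c x) = wscale W m (wscale W c x)"
      using dgrad_linear by (simp add: Vector_Spaces.linear_iff mult.commute)
    then show ?case using assms step.IH by blast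
  qed
qed

abbreviation O_W :: "'w set" where
  "O_W \<equiv> O_mod V W N"

lemma subspace_O: "W.subspace O_W"
  by (simp add: O_mod_def)

lemmas O_add = W.subspace_add[OF subspace_O]
  and O_diff = W.subspace_diff[OF subspace_O]
  and O_scale = W.subspace_scale[OF subspace_O]
  and O_neg = W.subspace_neg[OF subspace_O]
  and O_sum = W.subspace_sum[OF subspace_O]
  and O_0 = W.subspace_0[OF subspace_O]

lemma O_mod_eq: "O_W = W.span ({opres (int N) (- 2 * int N - 2) v w | v w. True}
    \<union> {dgrad W w + wvir V W (- 1) w | w. True})"
  by (simp add: O_mod_def Res_twisted_eq_opres)

lemma opres_mem_O: "opres (int N) (- 2 * int N - 2) v w \<in> O_W"
  unfolding O_mod_eq by (rule W.span_base) blast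

lemma dgrad_plus_wvir_mem_O: "dgrad W w + wvir V W (- 1) w \<in> O_W"
  unfolding O_mod_eq by (rule W.span_base) blast

text \<open>The derivative of x^p (1 + x)^(e + 1) is x^(p - 1) (1 + x)^e (p + (p + e + 1) x). The
  exponent e + 1 fits \<open>L(-1)u\<close>, whose weight is one higher than that of
  \<open>u\<close>.\<close>

lemma res_derivative_bin:
  "res p (bin (e + 1)) (vir V (- 1) u) w =
    - wscale W (of_int (p + e + 1)) (res p (bin e) u w) - wscale W (of_int p) (res (p - 1) (bin e) u w)"
proof -
  have "fps_const (of_int p) * bin (e + 1) + fps_X * fps_deriv (bin (e + 1)) =
      fps_const (of_int p) * bin e + fps_X * (fps_const (of_int (p + e + 1)) * bin e)"
  proof -
    have "fps_deriv (bin (e + 1)) = fps_const (of_int (e + 1)) * bin e"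
      by (simp add: fps_deriv_bin)
    then show ?thesis
      by (simp only: bin_plus_1) (simp add: algebra_simps flip: fps_const_add)
  qed
  then show ?thesis
    by (simp add: res_derivative res_add_fps res_scale_fps res_X)
qed

text \<open>Two inductions enlarge the stock of known elements. Replacing \<open>u\<close> by
  \<open>L(-1)u\<close> raises the pole order. Multiplying by 1 + x raises \<open>c\<close>, and its
  summand x lowers the pole order by one, whence the bound on \<open>p + c\<close>.\<close>

lemma res_mem_O:
  assumes u: "vir V 0 u = vscale V (of_int a) u" and c: "0 \<le> c" "p + c \<le> - 2 * int N - 2"
  shows "res p (bin (a + int N + c)) u w \<in> O_W"
proof -
  have base: "res (- 2 * int N - 2 - int n) (bin (a + int N)) u w \<in> O_W"
    if "vir V 0 u = vscale V (of_int a) u" for n u a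
    using that
  proof (induction n arbitrary: u a)
    case 0
    then show ?case using opres_mem_O[of u w] by (simp add: opres_homogeneous[OF 0])
  next
    case (Suc n)
    let ?q = "- 2 * int N - 2 - int n"
    have "res ?q (bin (a + 1 + int N)) (vir V (- 1) u) w \<in> O_W"
      using Suc.IH[OF vir_minus_1_homogeneous[OF Suc.prems]] .
    \<comment> \<open>In this relation every term but the last is already known to lie in
      \<open>O_W\<close>, and the coefficient \<open>?q\<close> of the last is negative, so it can
      be divided out.\<close>
    moreover have "res ?q (bin (a + 1 + int N)) (vir V (- 1) u) w =
        - wscale W (of_int (?q + (a + int N) + 1)) (res ?q (bin (a + int N)) u w)
        - wscale W (of_int ?q) (res (?q - 1) (bin (a + int N)) u w)"
      using res_derivative_bin[of ?q "a + int N" u w] by (simp add: add_ac)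
    ultimately have "wscale W (of_int ?q) (res (?q - 1) (bin (a + int N)) u w) \<in> O_W"
      using O_neg[OF O_add[OF _ O_scale[OF Suc.IH[OF Suc.prems], of "of_int (?q + (a + int N) + 1)"]]]
      by fastforce
    from O_scale[OF this, of "1 / of_int ?q"]
    have "wscale W (1 / of_int ?q * of_int ?q) (res (?q - 1) (bin (a + int N)) u w) \<in> O_W"
      by (simp only: W.scale_scale)
    moreover have "(of_int ?q :: complex) \<noteq> 0"
      by (simp only: of_int_eq_0_iff)
    ultimately show ?case by (simp add: algebra_simps)
  qed
  have "res (- 2 * int N - 2 - int n) (bin (a + int N + int m)) u w \<in> O_W" if "m \<le> n" for m n
    using that
  proof (induction m arbitrary: n)
    case 0
    show ?case using base[OF u, of n] by simp
  next
    case (Suc m)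
    then obtain n' where n: "n = Suc n'" "m \<le> n'" by (cases n) auto
    have "bin (a + int N + int (Suc m)) = bin (a + int N + int m) + fps_X * bin (a + int N + int m)"
      using bin_plus_1[of "a + int N + int m"] by (simp add: add_ac)
    moreover have "- 2 * int N - 2 - int n + 1 = - 2 * int N - 2 - int n'"
      using n by simp
    ultimately show ?case
      using O_add[OF Suc.IH[of n] Suc.IH[of n']] n Suc.prems
      by (simp only: res_add_fps res_X)
  qed
  from this[of "nat c" "nat (- 2 * int N - 2 - p)"] show ?thesis using c by simp
qed

text \<open>The Jacobi identity with l = 0 is a commutator. With \<open>v\<close> outermost the
  residue is in \<open>O_W\<close>. In the commutator, \<open>vmode V u k v\<close> has weight a + b
  - k - 1, which leaves the surplus exponent c + 1 + k - j of (1 + x) together with x^(p - 2N - 2 -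
  k + j). \<open>res_mem_O\<close> asks for surplus at least 0 and for surplus plus power of x at
  most -2N - 2; these are the two parts of assumption \<open>c\<close>.\<close>

lemma res_circ_mem_O:
  assumes u: "vir V 0 u = vscale V (of_int a) u" and v: "vir V 0 v = vscale V (of_int b) v"
    and c: "- 1 \<le> c" "p + c + 1 \<le> 0"
  shows "res p (bin (a + c)) u (res (- 2 * int N - 2) (bin (b + int N)) v w) \<in> O_W"
proof -
  let ?q = "- 2 * int N - 2"
  obtain K where K: "\<And>i. i \<ge> K \<Longrightarrow> vmode V u (0 + int i) v = 0"
    using eventually_happens'[OF sequentially_bot vmode_eventually_zero[of u 0 v]] by blast
  obtain M where M: "\<And>i. i \<ge> M \<Longrightarrow> wmode W v (?q + int i) w = 0"
      "\<And>i. i \<ge> M \<Longrightarrow> wmode W u (p + int i) w = 0" "M > 0"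
    using eventually_conj[OF eventually_conj[OF wmode_eventually_zero[of v ?q w] wmode_eventually_zero[of u p w]]
        eventually_gt_at_top[of 0]]
    unfolding eventually_sequentially by blast
  have "res (p + ?q - int k) (hasse k p (bin (a + c)) * bin (b + int N)) (vmode V u (int k) v) w \<in> O_W" for k
  proof -
    have "hasse k p (bin (a + c)) * bin (b + int N) = (\<Sum>j\<le>k.
        fps_const ((of_int p gchoose (k - j)) * (of_int (a + c) gchoose j)) *
          (fps_X ^ j * bin (a + b - int k - 1 + int N + (c + 1 + int (k - j)))))"
      unfolding hasse_bin sum_distrib_right
      by (intro sum.cong refl) (simp add: mult.assoc of_nat_diff algebra_simps flip: bin_add)
    moreover have "res (p + ?q - int k + int j) (bin (a + b - int k - 1 + int N + (c + 1 + int (k - j))))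
        (vmode V u (int k) v) w \<in> O_W" if "j \<le> k" for j
      using that c by (intro res_mem_O vmode_homogeneous[OF u v]) (auto simp: of_nat_diff)
    ultimately show ?thesis
      by (auto simp: res_sum_fps res_scale_fps res_X_power intro!: O_sum O_scale)
  qed
  then have "(\<Sum>k<K. res (p + ?q - int k) (hasse k p (bin (a + c)) * bin (b + int N))
      (vmode V u (0 + int k) v) w) \<in> O_W"
    by (auto intro!: O_sum)
  moreover have "(\<Sum>k<K. res (p + ?q - int k) (hasse k p (bin (a + c)) * bin (b + int N))
      (vmode V u (0 + int k) v) w) = res p (bin (a + c)) u (res ?q (bin (b + int N)) v w)
        - res ?q (bin (b + int N)) v (res p (bin (a + c)) u w)"
    by (subst res_jacobi[OF K M(1,2)]; (subst sum_lessThan_head[OF M(3)])?)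
      (simp_all add: gbinomial_0_left)
  moreover have "res ?q (bin (b + int N)) v (res p (bin (a + c)) u w) \<in> O_W"
    using res_mem_O[OF v, of 0] by simp
  ultimately show ?thesis using O_add by fastforce
qed

text \<open>The Jacobi identity with l = -2N - 2, with (1 + x)^(a + N) on the side of
  \<open>u\<close> and (1 + x)^(b + N + c + 1) on the side of \<open>v\<close>. Since no power of x
  accompanies \<open>u\<close>, \<open>hasse_0_bin\<close> reduces the left side to the wanted
  residue. On the right the pole of (x - y)^l falls on the outermost operator, and
  \<open>res_mem_O\<close> applies to each term.\<close>

lemma circ_res_mem_O:
  assumes u: "vir V 0 u = vscale V (of_int a) u" and v: "vir V 0 v = vscale V (of_int b) v"
    and c: "- 1 \<le> c" "p + c + 1 \<le> 0"
  shows "opres c p (weak_voa_module.opres V (adjoint V) (int N) (- 2 * int N - 2) u v) w \<in> O_W"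
proof -
  let ?l = "- 2 * int N - 2"
  interpret adj: weak_voa_module V "adjoint V" by (rule weak_voa_module_adjoint)
  obtain K where K: "\<And>i. i \<ge> K \<Longrightarrow> vmode V u (?l + int i) v = 0"
    using eventually_happens'[OF sequentially_bot vmode_eventually_zero[of u ?l v]] by blast
  obtain M where M: "\<And>i. i \<ge> M \<Longrightarrow> wmode W v (p + int i) w = 0"
      "\<And>i. i \<ge> M \<Longrightarrow> wmode W u (0 + int i) w = 0"
    using eventually_conj[OF wmode_eventually_zero[of v p w] wmode_eventually_zero[of u 0 w]]
    unfolding eventually_sequentially by blast
  have "opres c p (adj.opres (int N) ?l u v) w =
      opres c p (\<Sum>k<K. vscale V (of_int (a + int N) gchoose k) (vmode V u (?l + int k) v)) w"
    using adj.res_eq_sum[of K u ?l v] K by (simp add: adj.opres_homogeneous[OF u])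
  also have "\<dots> = (\<Sum>k<K. wscale W (of_int (a + int N) gchoose k) (opres c p (vmode V u (?l + int k) v) w))"
    by (simp add: module_hom.sum[OF opres_linear_left[folded module_hom_iff_linear]] opres_scale_left)
  also have "\<dots> = (\<Sum>k<K. res (0 + p - int k) (hasse k 0 (bin (a + int N)) * bin (b + int N + (c + 1)))
      (vmode V u (?l + int k) v) w)"
  proof (intro sum.cong refl)
    fix k
    have "hasse k 0 (bin (a + int N)) * bin (b + int N + (c + 1)) = fps_const (of_int (a + int N) gchoose k) *
        (fps_X ^ k * bin (a + b - (?l + int k) - 1 + c))"
      by (simp add: hasse_0_bin mult.assoc algebra_simps flip: bin_add)
    then show "wscale W (of_int (a + int N) gchoose k) (opres c p (vmode V u (?l + int k) v) w) =
        res (0 + p - int k) (hasse k 0 (bin (a + int N)) * bin (b + int N + (c + 1)))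
          (vmode V u (?l + int k) v) w"
      by (simp add: opres_homogeneous[OF vmode_homogeneous[OF u v]] res_scale_fps res_X_power)
  qed
  also have "\<dots> = (\<Sum>i<M. wscale W ((- 1) ^ i * (of_int ?l gchoose i))
      (res (0 + ?l - int i) (bin (a + int N)) u (res (p + int i) (bin (b + int N + (c + 1))) v w)
       - wscale W ((- 1) powi ?l) (res (p + ?l - int i) (bin (b + int N + (c + 1))) v
           (res (0 + int i) (bin (a + int N)) u w))))"
    by (rule res_jacobi[OF K M])
  also have "\<dots> \<in> O_W"
  proof (intro O_sum O_scale O_diff)
    show "res (0 + ?l - int i) (bin (a + int N)) u z \<in> O_W" for i z
      using res_mem_O[OF u, of 0 "?l - int i"] by simp
    show "res (p + ?l - int i) (bin (b + int N + (c + 1))) v z \<in> O_W" for i z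
      using c by (intro res_mem_O[OF v]) auto
  qed
  finally show ?thesis .
qed

end

text \<open>Multiplied by y^(N + 1), both sides enumerate the words of length m + N + 1 in x and y
  with at least N + 1 letters y: on the left by the number \<open>k\<close> of letters x before the
  y numbered N + 1, on the right by the total number of x. The induction uses Pascal's rule.\<close>

lemma sum_binomial_power:
  fixes x y :: "'a::comm_ring_1"
  shows "(\<Sum>k\<le>m. of_nat ((N + k) choose k) * x ^ k * (x + y) ^ (m - k)) =
    (\<Sum>k\<le>m. of_nat ((m + N + 1) choose k) * x ^ k * y ^ (m - k))"
proof (induction m)
  case (Suc m)
  let ?n = "m + N + 1"
  let ?R = "\<Sum>k\<le>m. of_nat (?n choose k) * x ^ k * y ^ (m - k)"
  have "(\<Sum>k\<le>Suc m. of_nat ((N + k) choose k) * x ^ k * (x + y) ^ (Suc m - k)) =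
      (\<Sum>k\<le>m. of_nat ((N + k) choose k) * x ^ k * (x + y) ^ (m - k)) * (x + y)
      + of_nat (?n choose Suc m) * x ^ Suc m"
    by (simp add: sum_distrib_left sum_distrib_right Suc_diff_le mult_ac add_ac)
  also have "\<dots> = ?R * (x + y) + of_nat (?n choose Suc m) * x ^ Suc m"
    by (simp only: Suc.IH)
  also have "\<dots> = (\<Sum>k\<le>Suc m. of_nat (?n choose k) * x ^ k * y ^ (Suc m - k)) +
      (\<Sum>k\<le>m. of_nat (?n choose k) * x ^ Suc k * y ^ (m - k))"
    by (simp add: sum_distrib_left sum_distrib_right distrib_left distrib_right Suc_diff_le mult_ac sum.distrib)
  also have "\<dots> = y ^ Suc m + (\<Sum>k\<le>m. of_nat ((?n choose Suc k) + (?n choose k)) * x ^ Suc k * y ^ (m - k))"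
    by (subst sum.atMost_Suc_shift) (simp add: sum.distrib algebra_simps)
  also have "\<dots> = (\<Sum>k\<le>Suc m. of_nat ((Suc m + N + 1) choose k) * x ^ k * y ^ (Suc m - k))"
    by (subst sum.atMost_Suc_shift) (simp add: add_ac)
  finally show ?case .
qed simp

text \<open>
  The two families of terms on the left add up to the lower and the upper half of the binomial
  expansion of \<open>(x + y)^(2N+1)\<close>.
\<close>

lemma sum_binomial_power_symmetric:
  fixes x y :: "'a::comm_ring_1"
  shows "(\<Sum>k\<le>N. of_nat ((k + N) choose N) * (x ^ k * y ^ (N + 1) + x ^ (N + 1) * y ^ k) * (x + y) ^ (N - k))
    = (x + y) ^ (2 * N + 1)"
proof -
  have half: "(\<Sum>k\<le>N. of_nat ((k + N) choose N) * (x ^ k * y ^ (N + 1)) * (x + y) ^ (N - k)) =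
      (\<Sum>k\<le>N. of_nat ((2 * N + 1) choose k) * x ^ k * y ^ (2 * N + 1 - k))" for x y :: 'a
  proof -
    have "(\<Sum>k\<le>N. of_nat ((k + N) choose N) * (x ^ k * y ^ (N + 1)) * (x + y) ^ (N - k)) =
        (\<Sum>k\<le>N. of_nat ((N + k) choose k) * x ^ k * (x + y) ^ (N - k)) * y ^ (N + 1)"
      by (simp add: sum_distrib_left sum_distrib_right mult_ac add.commute binomial_symmetric[of N])
    also have "\<dots> = (\<Sum>k\<le>N. of_nat ((N + N + 1) choose k) * x ^ k * (y ^ (N - k) * y ^ (N + 1)))"
      by (simp only: sum_binomial_power) (simp add: sum_distrib_left sum_distrib_right mult_ac)
    also have "\<dots> = (\<Sum>k\<le>N. of_nat ((2 * N + 1) choose k) * x ^ k * y ^ (2 * N + 1 - k))"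
    proof (intro sum.cong refl)
      fix k assume "k \<in> {..N}"
      then have "N - k + (N + 1) = 2 * N + 1 - k" by simp
      then show "of_nat ((N + N + 1) choose k) * x ^ k * (y ^ (N - k) * y ^ (N + 1)) =
          of_nat ((2 * N + 1) choose k) * x ^ k * y ^ (2 * N + 1 - k)"
        by (simp only: power_add[symmetric] mult_2)
    qed
    finally show ?thesis .
  qed
  have "(x + y) ^ (2 * N + 1) = (\<Sum>k\<le>2 * N + 1. of_nat ((2 * N + 1) choose k) * x ^ k * y ^ (2 * N + 1 - k))"
    by (rule binomial_ring)
  \<comment> \<open>The degree is odd, so reflection exchanges the two halves without a middle
    term.\<close>
  also have "{..2 * N + 1} = {..N} \<union> (\<lambda>k. 2 * N + 1 - k) ` {..N}"
  proof -
    have "k \<in> (\<lambda>k. 2 * N + 1 - k) ` {..N}" if "k \<le> 2 * N + 1" "\<not> k \<le> N" for k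
      using that by (intro image_eqI[of _ _ "2 * N + 1 - k"]) auto
    then show ?thesis by auto
  qed
  also have "(\<Sum>k\<in>\<dots>. of_nat ((2 * N + 1) choose k) * x ^ k * y ^ (2 * N + 1 - k)) =
      (\<Sum>k\<le>N. of_nat ((2 * N + 1) choose k) * x ^ k * y ^ (2 * N + 1 - k)) +
      (\<Sum>k\<in>(\<lambda>k. 2 * N + 1 - k) ` {..N}. of_nat ((2 * N + 1) choose k) * x ^ k * y ^ (2 * N + 1 - k))"
    by (rule sum.union_disjoint) auto
  also have "(\<Sum>k\<in>(\<lambda>k. 2 * N + 1 - k) ` {..N}. of_nat ((2 * N + 1) choose k) * x ^ k * y ^ (2 * N + 1 - k)) =
      (\<Sum>k\<le>N. of_nat ((2 * N + 1) choose k) * y ^ k * x ^ (2 * N + 1 - k))"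
  proof (subst sum.reindex)
    show "inj_on (\<lambda>k. 2 * N + 1 - k) {..N}"
      by (auto simp: inj_on_def)
    show "sum ((\<lambda>k. of_nat ((2 * N + 1) choose k) * x ^ k * y ^ (2 * N + 1 - k)) \<circ> (\<lambda>k. 2 * N + 1 - k)) {..N} =
        (\<Sum>k\<le>N. of_nat ((2 * N + 1) choose k) * y ^ k * x ^ (2 * N + 1 - k))"
    proof (intro sum.cong refl)
      fix k assume "k \<in> {..N}"
      then have k: "k \<le> 2 * N + 1" by simp
      show "((\<lambda>k. of_nat ((2 * N + 1) choose k) * x ^ k * y ^ (2 * N + 1 - k)) \<circ> (\<lambda>k. 2 * N + 1 - k)) k =
          of_nat ((2 * N + 1) choose k) * y ^ k * x ^ (2 * N + 1 - k)"
        using binomial_symmetric[OF k] k by (simp add: mult_ac)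
    qed
  qed
  finally show ?thesis
    using half[of x y] half[of y x]
    by (simp add: distrib_left distrib_right sum.distrib mult_ac add.commute)
qed

section \<open>Error terms of L(0) + L(-1), and stability of \<open>O_W\<close> under the left
  action\<close>

context graded_voa_module
begin

lemma dgrad_add: "dgrad W (w + w') = dgrad W w + dgrad W w'"
  and dgrad_scale: "dgrad W (wscale W c w) = wscale W c (dgrad W w)"
  and dgrad_sum: "dgrad W (sum g A) = (\<Sum>i\<in>A. dgrad W (g i))"
  using dgrad_linear module_hom.sum[OF dgrad_linear[folded module_hom_iff_linear]]
  by (auto simp: Vector_Spaces.linear_iff)

lemma wvir_add: "wvir V W n (w + w') = wvir V W n w + wvir V W n w'"
  and wvir_scale: "wvir V W n (wscale W c w) = wscale W c (wvir V W n w)"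
  and wvir_zero [simp]: "wvir V W n 0 = 0"
  and wvir_sum: "wvir V W n (sum g A) = (\<Sum>i\<in>A. wvir V W n (g i))"
  by (simp_all add: wvir_def wmode_add_right wmode_scale_right wmode_sum_right)

lemma dgrad_res:
  assumes u: "vir V 0 u = vscale V (of_int a) u"
  shows "dgrad W (res p f u w) =
    res p f u (dgrad W w) + res p (fps_const (of_int (a - p - 1)) * f + fps_const (- 1) * (fps_X * fps_deriv f)) u w"
proof -
  let ?g = "fps_const (of_int (a - p - 1)) * f + fps_const (- 1) * (fps_X * fps_deriv f)"
  from eventually_conj[OF eventually_res_eq_sum[of p f u w]
      eventually_conj[OF eventually_res_eq_sum[of p f u "dgrad W w"] eventually_res_eq_sum[of p ?g u w]]]
  obtain K where K: "res p f u w = (\<Sum>i<K. wscale W (fps_nth f i) (wmode W u (p + int i) w))"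
    "res p f u (dgrad W w) = (\<Sum>i<K. wscale W (fps_nth f i) (wmode W u (p + int i) (dgrad W w)))"
    "res p ?g u w = (\<Sum>i<K. wscale W (fps_nth ?g i) (wmode W u (p + int i) w))"
    using eventually_happens'[OF sequentially_bot] by blast
  have g: "fps_nth ?g i = fps_nth f i * of_int (a - (p + int i) - 1)" for i
    by (cases i) (simp_all add: algebra_simps)
  show ?thesis
    unfolding K g
    by (simp add: dgrad_sum dgrad_scale dgrad_wmode[OF u] W.scale_right_distrib sum.distrib)
qed

text \<open>
  The same expression arises from replacing \<open>u\<close> by \<open>(L(0) + L(-1))u\<close> in
  \<open>Res\<^sub>x x^p Y\<^sub>W((1 + x)^(L(0) + c) u,x)\<close> and from commuting this residue with \<open>d\<^sub>W + L(-1)\<close>.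
\<close>

definition defect :: "int \<Rightarrow> int \<Rightarrow> int \<Rightarrow> 'v \<Rightarrow> 'w \<Rightarrow> 'w" where
  "defect a c p u w = - wscale W (of_int (p + c + 1)) (res p (bin (a + c)) u w)
     - wscale W (of_int p) (res (p - 1) (bin (a + c)) u w)"

lemma res_translate:
  assumes u: "vir V 0 u = vscale V (of_int a) u"
  shows "opres c p (vir V 0 u + vir V (- 1) u) w = defect a c p u w"
proof -
  have "opres c p (vir V 0 u + vir V (- 1) u) w =
      wscale W (of_int a) (res p (bin (a + c)) u w) + res p (bin (a + c + 1)) (vir V (- 1) u) w"
    using opres_homogeneous[OF vir_minus_1_homogeneous[OF u], of c p w]
    by (simp add: opres_add_left u opres_scale_left opres_homogeneous[OF u] add_ac)
  then show ?thesis
    unfolding res_derivative_bin defect_def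
    by (simp add: W.scale_left_distrib algebra_simps)
qed

lemma res_commutator_translate:
  assumes u: "vir V 0 u = vscale V (of_int a) u"
  shows "dgrad W (res p (bin (a + c)) u w) + wvir V W (- 1) (res p (bin (a + c)) u w) =
    res p (bin (a + c)) u (dgrad W w + wvir V W (- 1) w) + defect a c p u w"
proof -
  let ?f = "bin (a + c)"
  \<comment> \<open>This is x times the differential equation (1 + x) f' = (a + c) f of the binomial
    series. It removes all derivatives from the two contributions.\<close>
  have X: "fps_X * fps_deriv ?f + fps_X * (fps_X * fps_deriv ?f) = fps_X * (fps_const (of_int (a + c)) * ?f)"
  proof -
    have "fps_const (of_int (a + c)) * ?f = fps_deriv ?f + fps_X * fps_deriv ?f"
    proof -
      have f: "?f = bin (a + c - 1) + fps_X * bin (a + c - 1)"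
        using bin_plus_1[of "a + c - 1"] by simp
      show ?thesis
        unfolding fps_deriv_bin by (simp only: f) (simp add: algebra_simps)
    qed
    then show ?thesis by (simp add: algebra_simps)
  qed
  have "res p (fps_const (of_int (a - p - 1)) * ?f + fps_const (- 1) * (fps_X * fps_deriv ?f)) u w
      - res (p - 1) (fps_const (of_int p) * ?f + fps_X * fps_deriv ?f) u w =
    res (p - 1) (fps_X * (fps_const (of_int (a - p - 1)) * ?f + fps_const (- 1) * (fps_X * fps_deriv ?f))
      + fps_const (- 1) * (fps_const (of_int p) * ?f + fps_X * fps_deriv ?f)) u w"
    by (simp only: res_add_fps res_scale_fps res_X) simp
  also have "fps_X * (fps_const (of_int (a - p - 1)) * ?f + fps_const (- 1) * (fps_X * fps_deriv ?f))
      + fps_const (- 1) * (fps_const (of_int p) * ?f + fps_X * fps_deriv ?f) =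
    fps_X * (fps_const (of_int (a - p - 1)) * ?f) + fps_const (- 1) * (fps_const (of_int p) * ?f)
      + fps_const (- 1) * (fps_X * fps_deriv ?f + fps_X * (fps_X * fps_deriv ?f))"
    by (simp add: algebra_simps)
  also have "\<dots> = fps_const (of_int (- (p + c + 1))) * (fps_X * ?f) + fps_const (- of_int p) * ?f"
    unfolding X by (rule fps_ext) (simp add: algebra_simps)
  also have "res (p - 1) \<dots> u w = defect a c p u w"
    by (simp only: res_add_fps res_scale_fps res_X defect_def) (simp add: algebra_simps)
  finally show ?thesis
    by (simp add: dgrad_res[OF u] res_commutes_wvir res_derivative res_add_right algebra_simps)
qed

definition star_coeff :: "nat \<Rightarrow> complex" where
  "star_coeff m = (- 1) ^ m * of_nat ((m + N) choose N)"

text \<open>The recursion \<open>coeff\<close> for the product coefficients makes the sum telescope.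
  The first term carries the factor m = 0, and the last has pole order 2N + 2, so it lies in
  \<open>O_W\<close>.\<close>

lemma sum_defect_mem_O:
  assumes u: "vir V 0 u = vscale V (of_int a) u"
  shows "(\<Sum>m\<le>N. wscale W (star_coeff m) (defect a (int N) (- int N - int m - 1) u w)) \<in> O_W"
proof -
  define G where "G m = wscale W (star_coeff m * of_nat m) (res (- int N - int m - 1) (bin (a + int N)) u w)" for m
  have coeff: "star_coeff m * of_nat (N + m + 1) = - (star_coeff (Suc m) * of_nat (Suc m))" for m
  proof -
    have "Suc m * ((Suc m + N) choose N) = (N + m + 1) * ((m + N) choose N)"
      using Suc_times_binomial[of m "m + N"] binomial_symmetric[of N "m + N"] binomial_symmetric[of N "Suc m + N"]
      by (simp add: add_ac)
    then have "(of_nat (Suc m) * of_nat ((Suc m + N) choose N) :: complex) = of_nat (N + m + 1) * of_nat ((m + N) choose N)"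
      by (metis of_nat_mult)
    then show ?thesis by (simp add: star_coeff_def mult_ac)
  qed
  have "wscale W (star_coeff m) (defect a (int N) (- int N - int m - 1) u w) = G m - G (Suc m)" for m
  proof -
    have "wscale W (star_coeff m) (defect a (int N) (- int N - int m - 1) u w) =
        wscale W (star_coeff m * of_nat m) (res (- int N - int m - 1) (bin (a + int N)) u w)
        + wscale W (star_coeff m * of_nat (N + m + 1)) (res (- int N - int m - 1 - 1) (bin (a + int N)) u w)"
    proof -
      have "defect a (int N) (- int N - int m - 1) u w =
          wscale W (of_nat m) (res (- int N - int m - 1) (bin (a + int N)) u w)
          + wscale W (of_nat (N + m + 1)) (res (- int N - int m - 1 - 1) (bin (a + int N)) u w)"
      proof -
        have "(of_int (- int N - int m - 1 + int N + 1) :: complex) = - of_nat m"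
          "(of_int (- int N - int m - 1) :: complex) = - of_nat (N + m + 1)"
          by simp_all
        then show ?thesis
          unfolding defect_def by (simp only: W.scale_minus_left) simp
      qed
      then show ?thesis by (simp add: W.scale_right_distrib)
    qed
    then show ?thesis
      unfolding coeff G_def by (simp add: algebra_simps)
  qed
  then have "(\<Sum>m\<le>N. wscale W (star_coeff m) (defect a (int N) (- int N - int m - 1) u w)) = G 0 - G (Suc N)"
    by (simp only: sum_telescope)
  also have "res (- int N - int (Suc N) - 1) (bin (a + int N)) u w \<in> O_W"
    using res_mem_O[OF u, of 0 "- int N - int (Suc N) - 1"] by simp
  then have "G 0 - G (Suc N) \<in> O_W"
    unfolding G_def by (auto intro!: O_neg O_scale)
  finally show ?thesis .
qed

end

lemma (in vertex_operator_algebra) graded_voa_module_adjoint: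
  "graded_voa_module V (adjoint V)"
proof (intro graded_voa_module.intro graded_voa_module_axioms.intro weak_voa_module_adjoint;
    unfold adjoint_simps)
  show "Vector_Spaces.linear (vscale V) (vscale V) (vir V 0)"
    by (rule vir_linear)
  have "span (\<Union>n::int. eigenspace (vscale V) (vir V 0) (of_int n))
      \<subseteq> span (\<Union>m. eigenspace (vscale V) (vir V 0) m)"
    by (intro span_mono) auto
  then show "span (\<Union>m. eigenspace (vscale V) (vir V 0) m) = UNIV"
    using grading by auto
  show "vir V 0 (vmode V u n w) =
      vmode V u n (vir V 0 w) + vscale V (of_int (a - n - 1)) (vmode V u n w)"
    if "vir V 0 u = vscale V (of_int a) u" for u a n w
    using weak_voa_module.wvir_0_commutator[OF weak_voa_module_adjoint that, of n w] by simp
qed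

context graded_voa_module
begin

text \<open>Stated for an arbitrary linear \<open>f\<close> because it is used for the left product
  and for \<open>opres (- 1) 0\<close>.\<close>

lemma linear_image_O:
  assumes f: "Vector_Spaces.linear (wscale W) (wscale W) f"
    and circ: "\<And>b v w. vir V 0 v = vscale V (of_int b) v \<Longrightarrow>
      f (res (- 2 * int N - 2) (bin (b + int N)) v w) \<in> O_W"
    and translate: "\<And>w. f (dgrad W w + wvir V W (- 1) w) \<in> O_W"
    and w: "w \<in> O_W"
  shows "f w \<in> O_W"
proof -
  have f_add: "f (x + y) = f x + f y" and f_scale: "f (wscale W c x) = wscale W c (f x)" for x y c
    using f by (auto simp: Vector_Spaces.linear_iff)
  have circ': "f (opres (int N) (- 2 * int N - 2) v w) \<in> O_W" for v w
  proof (induction v rule: homogeneous_induct)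
    case (homogeneous b v)
    then show ?case using circ by (simp add: opres_homogeneous[OF homogeneous])
  next
    case (add u v)
    then show ?case by (simp add: opres_add_left f_add O_add)
  qed
  show ?thesis
    using w unfolding O_mod_eq
  proof (induction rule: W.span_induct_alt)
    case base
    then show ?case
      by (simp add: module_hom.zero[OF f[folded module_hom_iff_linear]] W.span_zero)
  next
    case (step c x y)
    then have "f x \<in> O_W" using circ' translate by auto
    then show ?case
      using step.IH unfolding O_mod_eq by (simp add: f_add f_scale W.span_add W.span_scale)
  qed
qed

lemma star_left_eq_coeff:
  "star_left V W N u w = (\<Sum>m\<le>N. wscale W (star_coeff m) (opres (int N) (- int N - int m - 1) u w))"
  by (simp add: star_left_eq star_coeff_def)

lemma star_left_homogeneous:
  assumes "vir V 0 u = vscale V (of_int a) u"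
  shows "star_left V W N u w =
    (\<Sum>m\<le>N. wscale W (star_coeff m) (res (- int N - int m - 1) (bin (a + int N)) u w))"
  by (simp add: star_left_eq_coeff opres_homogeneous[OF assms])

lemma star_left_add_left: "star_left V W N (u + u') w = star_left V W N u w + star_left V W N u' w"
  and star_left_add_right: "star_left V W N u (w + w') = star_left V W N u w + star_left V W N u w'"
  and star_left_scale_right: "star_left V W N u (wscale W c w) = wscale W c (star_left V W N u w)"
  using star_left_linear_left[of N w] star_left_linear_right[of N u]
  by (auto simp: Vector_Spaces.linear_iff)

lemma star_left_mem_O:
  assumes "w \<in> O_W"
  shows "star_left V W N u w \<in> O_W"
proof (induction u rule: homogeneous_induct)
  case (homogeneous a u)
  show ?case
  proof (rule linear_image_O[OF star_left_linear_right _ _ assms])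
    fix b v w
    assume v: "vir V 0 v = vscale V (of_int b) v"
    \<comment> \<open>Here c = N and p = -N - m - 1, hence p + c + 1 = -m.\<close>
    show "star_left V W N u (res (- 2 * int N - 2) (bin (b + int N)) v w) \<in> O_W"
      unfolding star_left_homogeneous[OF homogeneous]
      by (intro O_sum O_scale res_circ_mem_O[OF homogeneous v]) auto
  next
    fix w
    let ?r = "\<lambda>m w. res (- int N - int m - 1) (bin (a + int N)) u w"
    have "star_left V W N u (dgrad W w + wvir V W (- 1) w) =
        (\<Sum>m\<le>N. wscale W (star_coeff m) (dgrad W (?r m w) + wvir V W (- 1) (?r m w)
          - defect a (int N) (- int N - int m - 1) u w))"
      unfolding star_left_homogeneous[OF homogeneous] res_commutator_translate[OF homogeneous]
      by simp
    also have "\<dots> = (\<Sum>m\<le>N. wscale W (star_coeff m) (dgrad W (?r m w) + wvir V W (- 1) (?r m w)))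
        - (\<Sum>m\<le>N. wscale W (star_coeff m) (defect a (int N) (- int N - int m - 1) u w))"
      by (simp only: W.scale_right_diff_distrib sum_subtractf)
    also have "\<dots> \<in> O_W"
      using sum_defect_mem_O[OF homogeneous]
      by (rule O_diff[rotated]) (auto intro!: O_sum O_scale dgrad_plus_wvir_mem_O)
    finally show "star_left V W N u (dgrad W w + wvir V W (- 1) w) \<in> O_W" .
  qed
next
  case (add u v)
  then show ?case by (simp add: star_left_add_left O_add)
qed

text \<open>The boundary case p + c + 1 = 0 with p = 0: both coefficients of \<open>defect\<close>
  vanish, so nothing has to telescope.\<close>

lemma opres_minus_1_mem_O:
  assumes "w \<in> O_W"
  shows "opres (- 1) 0 u w \<in> O_W"
proof (induction u rule: homogeneous_induct)
  case (homogeneous a u)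
  show ?case
  proof (rule linear_image_O[OF opres_linear_right _ _ assms])
    fix b v w
    assume v: "vir V 0 v = vscale V (of_int b) v"
    show "opres (- 1) 0 u (res (- 2 * int N - 2) (bin (b + int N)) v w) \<in> O_W"
      unfolding opres_homogeneous[OF homogeneous]
      by (intro res_circ_mem_O[OF homogeneous v]) auto
  next
    fix w
    show "opres (- 1) 0 u (dgrad W w + wvir V W (- 1) w) \<in> O_W"
      using res_commutator_translate[OF homogeneous, of 0 "- 1" w]
        dgrad_plus_wvir_mem_O[of "res 0 (bin (a + - 1)) u w"]
      by (simp add: opres_homogeneous[OF homogeneous] defect_def)
  qed
next
  case (add u v)
  then show ?case by (simp add: opres_add_left O_add)
qed

text \<open>The generators with n > 0 are the higher poles supplied by
  \<open>res_mem_O\<close>.\<close>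

lemma O_alg_subset: "O_alg V N \<subseteq> O_mod V (adjoint V) N"
proof -
  interpret adj: graded_voa_module V "adjoint V" N by (rule graded_voa_module_adjoint)
  show ?thesis
    unfolding O_alg_def
  proof (rule span_minimal)
    show "subspace (O_mod V (adjoint V) N)" using adj.subspace_O by simp
    have "adj.opres (int N) (- 2 * int N - 2 - int n) u v \<in> O_mod V (adjoint V) N" for u v n
    proof (induction u rule: homogeneous_induct)
      case (homogeneous a u)
      then show ?case
        using adj.res_mem_O[OF homogeneous, of 0 "- 2 * int N - 2 - int n" v]
        by (simp add: adj.opres_homogeneous[OF homogeneous])
    next
      case (add u u')
      then show ?case by (simp add: adj.opres_add_left adj.O_add)
    qed
    then have "Res_xpow (- 2 * int N - 2 - int n) (twisted (vscale V) (vir V 0) N (Yser (vmode V)) u v)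
        \<in> O_mod V (adjoint V) N" for u v n
      using adj.Res_twisted_eq_opres[of _ N u v] by simp
    moreover have "vir V 0 v + vir V (- 1) v \<in> O_mod V (adjoint V) N" for v
      using adj.dgrad_plus_wvir_mem_O[of v] by simp
    ultimately show "{Res_xpow (- 2 * int N - 2 - int n) (twisted (vscale V) (vir V 0) N (Yser (vmode V)) u v)
         | u v (n::nat). True} \<union> {vir V 0 v + vir V (- 1) v | v. True} \<subseteq> O_mod V (adjoint V) N"
      by auto
  qed
qed

lemma linear_image_O_alg:
  assumes f: "Vector_Spaces.linear (vscale V) (wscale W) f"
    and circ: "\<And>a b u v. vir V 0 u = vscale V (of_int a) u \<Longrightarrow> vir V 0 v = vscale V (of_int b) v \<Longrightarrow>
      f (weak_voa_module.opres V (adjoint V) (int N) (- 2 * int N - 2) u v) \<in> O_W"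
    and translate: "\<And>a v. vir V 0 v = vscale V (of_int a) v \<Longrightarrow> f (vir V 0 v + vir V (- 1) v) \<in> O_W"
    and v: "v \<in> O_alg V N"
  shows "f v \<in> O_W"
proof -
  interpret adj: graded_voa_module V "adjoint V" N by (rule graded_voa_module_adjoint)
  have f_add: "f (x + y) = f x + f y" and f_scale: "f (vscale V c x) = wscale W c (f x)" for x y c
    using f by (auto simp: Vector_Spaces.linear_iff)
  have "f (adj.opres (int N) (- 2 * int N - 2) u v) \<in> O_W"
    if u: "vir V 0 u = vscale V (of_int a) u" for a u v
  proof (induction v rule: homogeneous_induct)
    case (homogeneous b v)
    then show ?case by (rule circ[OF u])
  qed (simp only: adj.opres_add_right f_add O_add)
  then have circ': "f (adj.opres (int N) (- 2 * int N - 2) u v) \<in> O_W" for u v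
    by (induction u rule: homogeneous_induct) (simp_all only: adj.opres_add_left f_add O_add)
  have translate': "f (vir V 0 v + vir V (- 1) v) \<in> O_W" for v
  proof (induction v rule: homogeneous_induct)
    case (homogeneous a v)
    then show ?case by (rule translate)
  next
    case (add u v)
    have "f (vir V 0 (u + v) + vir V (- 1) (u + v)) =
        f (vir V 0 u + vir V (- 1) u) + f (vir V 0 v + vir V (- 1) v)"
      by (simp add: vir_def vmode_add_right f_add)
    then show ?case using add O_add by simp
  qed
  from v O_alg_subset have "v \<in> span ({adj.opres (int N) (- 2 * int N - 2) u w | u w. True}
      \<union> {vir V 0 w + vir V (- 1) w | w. True})"
    using adj.O_mod_eq by auto
  then show ?thesis
  proof (induction rule: span_induct_alt)
    case base
    then show ?case
      by (simp add: module_hom.zero[OF f[folded module_hom_iff_linear]] O_0)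
  next
    case (step c x y)
    then have "f x \<in> O_W" using circ' translate' by auto
    then show ?case
      using step.IH by (simp add: f_add f_scale O_add O_scale)
  qed
qed

lemma star_left_O_alg_mem_O:
  assumes "u \<in> O_alg V N"
  shows "star_left V W N u w \<in> O_W"
proof (rule linear_image_O_alg[OF star_left_linear_left _ _ assms])
  fix a b u v
  assume "vir V 0 u = vscale V (of_int a) u" "vir V 0 v = vscale V (of_int b) v"
  then show "star_left V W N (weak_voa_module.opres V (adjoint V) (int N) (- 2 * int N - 2) u v) w \<in> O_W"
    unfolding star_left_eq_coeff by (intro O_sum O_scale circ_res_mem_O) auto
next
  fix a v
  assume v: "vir V 0 v = vscale V (of_int a) v"
  show "star_left V W N (vir V 0 v + vir V (- 1) v) w \<in> O_W"
    unfolding star_left_eq_coeff res_translate[OF v] by (rule sum_defect_mem_O[OF v])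
qed

lemma opres_minus_1_O_alg_mem_O:
  assumes "u \<in> O_alg V N"
  shows "opres (- 1) 0 u w \<in> O_W"
proof (rule linear_image_O_alg[OF opres_linear_left _ _ assms])
  fix a b u v
  assume "vir V 0 u = vscale V (of_int a) u" "vir V 0 v = vscale V (of_int b) v"
  then show "opres (- 1) 0 (weak_voa_module.opres V (adjoint V) (int N) (- 2 * int N - 2) u v) w \<in> O_W"
    by (intro circ_res_mem_O) auto
next
  fix a v
  assume v: "vir V 0 v = vscale V (of_int a) v"
  show "opres (- 1) 0 (vir V 0 v + vir V (- 1) v) w \<in> O_W"
    unfolding res_translate[OF v] by (simp add: defect_def O_0)
qed

end

section \<open>The right action\<close>

context weak_voa_module
begin

lemma wvir_funpow_add: "(wvir V W n ^^ l) (w + w') = (wvir V W n ^^ l) w + (wvir V W n ^^ l) w'"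
  by (induction l) (simp_all add: wvir_def wmode_add_right)

lemma wvir_funpow_scale: "(wvir V W n ^^ l) (wscale W c w) = wscale W c ((wvir V W n ^^ l) w)"
  by (induction l) (simp_all add: wvir_def wmode_scale_right)

lemma wvir_funpow_zero [simp]: "(wvir V W n ^^ l) 0 = 0"
  using wvir_funpow_scale[where n = n and l = l and c = 0 and w = 0] by simp

lemma Yskew_eq: "Yskew V W w v (- 1 - p) = Sum_any (\<lambda>l.
    wscale W ((- 1) powi (p + int l + 1) / fact l) ((wvir V W (- 1) ^^ l) (wmode W v (p + int l) w)))"
proof -
  have "(- 1 :: complex) powi (- 1 - p - int l) = (- 1) powi (p + int l + 1)" for l
    using power_int_minus_one_minus[where 'a = complex, of "p + int l + 1"] by (simp add: algebra_simps)
  then show ?thesis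
    by (simp add: Yskew_def Yser_def wvir_funpow_scale algebra_simps)
qed

text \<open>\<open>Sum_any\<close> is additive only for finite supports; this discharges that
  condition.\<close>

lemma Yskew_finite:
  "finite {l. wscale W ((- 1) powi (p + int l + 1) / fact l)
    ((wvir V W (- 1) ^^ l) (wmode W v (p + int l) w)) \<noteq> 0}"
  using wmode_eventually_zero[of v p w]
  by (intro finite_if_eventually_zero) (auto elim!: eventually_mono)

lemma Yskew_eq_sum:
  assumes "\<And>l. l \<ge> M \<Longrightarrow> wmode W v (p + int l) w = 0"
  shows "Yskew V W w v (- 1 - p) = (\<Sum>l<M.
    wscale W ((- 1) powi (p + int l + 1) / fact l) ((wvir V W (- 1) ^^ l) (wmode W v (p + int l) w)))"
  unfolding Yskew_eq by (rule Sum_any_eq_sum_lessThan) (simp add: assms)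

lemma Yskew_add_left: "Yskew V W (w + w') v j = Yskew V W w v j + Yskew V W w' v j"
  and Yskew_add_right: "Yskew V W w (v + v') j = Yskew V W w v j + Yskew V W w v' j"
  and Yskew_scale_left: "Yskew V W (wscale W c w) v j = wscale W c (Yskew V W w v j)"
proof -
  have "Yskew V W (w + w') v (- 1 - p) = Yskew V W w v (- 1 - p) + Yskew V W w' v (- 1 - p)" for p
    unfolding Yskew_eq
    by (subst Sum_any.distrib[symmetric])
      (simp_all only: Yskew_finite wmode_add_right W.scale_right_distrib wvir_funpow_add)
  from this[of "- 1 - j"] show "Yskew V W (w + w') v j = Yskew V W w v j + Yskew V W w' v j" by simp
  have "Yskew V W w (v + v') (- 1 - p) = Yskew V W w v (- 1 - p) + Yskew V W w v' (- 1 - p)" for p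
    unfolding Yskew_eq
    by (subst Sum_any.distrib[symmetric])
      (simp_all only: Yskew_finite wmode_add_left W.scale_right_distrib wvir_funpow_add)
  from this[of "- 1 - j"] show "Yskew V W w (v + v') j = Yskew V W w v j + Yskew V W w v' j" by simp
  have "Yskew V W (wscale W c w) v (- 1 - p) = wscale W c (Yskew V W w v (- 1 - p))" for p
    unfolding Yskew_eq Sum_any_scale[OF Yskew_finite, symmetric]
    by (simp only: wmode_scale_right wvir_funpow_scale W.scale_left_commute)
  from this[of "- 1 - j"] show "Yskew V W (wscale W c w) v j = wscale W c (Yskew V W w v j)" by simp
qed

end

context graded_voa_module
begin

text \<open>\<open>Res\<^sub>x x^p Y\<^bsub>WV\<^esub>\<^sup>W((1 + x)^(d\<^sub>W + N) w,x)v\<close>\<close>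

definition skew_res :: "int \<Rightarrow> 'w \<Rightarrow> 'v \<Rightarrow> 'w" where
  "skew_res p w v = Sum_any (\<lambda>k. Yskew V W
     (op_choose (wscale W) (\<lambda>y. dgrad W y + wscale W (of_nat N) y) k w) v (- 1 - (p + int k)))"

lemma Res_twisted_eq_skew_res:
  "Res_xpow p (twisted (wscale W) (dgrad W) N (Yskew V W) w v) = skew_res p w v"
  by (simp add: Res_xpow_def twisted_def skew_res_def algebra_simps)

lemma star_right_eq_coeff:
  "star_right V W N w v = (\<Sum>m\<le>N. wscale W (star_coeff m) (skew_res (- int N - int m - 1) w v))"
  by (simp add: star_right_def star_residue_def Res_twisted_eq_skew_res star_coeff_def)

lemmas dgrad_op_linear = twisted_op_linear[OF dgrad_linear]

lemma dgrad_op_choose_homogeneous: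
  assumes w: "dgrad W w = wscale W m w"
  shows "op_choose (wscale W) (\<lambda>y. dgrad W y + wscale W (of_nat N) y) k w =
    wscale W (m + of_nat N gchoose k) w"
  by (rule op_choose_eigenvector[OF dgrad_op_linear]) (simp add: w W.scale_left_distrib)

lemma skew_eventually_zero:
  "\<forall>\<^sub>F T in sequentially. \<forall>i\<ge>T. Yskew V W
     (op_choose (wscale W) (\<lambda>y. dgrad W y + wscale W (of_nat N) y) i w) v (- 1 - (p + int i)) = 0"
proof (induction w rule: module_homogeneous_induct)
  case (homogeneous m w)
  from wmode_eventually_zero[of v p w] show ?case
  proof eventually_elim
    case (elim T)
    have "Yskew V W w v (- 1 - (p + int i)) = 0" if "i \<ge> T" for i
    proof -
      have "wmode W v (p + int i + int l) w = 0" for l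
        using elim[rule_format, of "i + l"] that by (simp add: add.assoc)
      then show ?thesis by (simp only: Yskew_eq wvir_funpow_zero W.scale_zero_right Sum_any.neutral)
    qed
    then show ?case
      by (simp add: dgrad_op_choose_homogeneous[OF homogeneous] Yskew_scale_left)
  qed
next
  case (add w w')
  then show ?case
    by eventually_elim (simp add: op_choose_add_scale[OF dgrad_op_linear] Yskew_add_left)
qed

lemmas skew_finite = finite_if_eventually_zero[OF skew_eventually_zero]

lemma skew_res_add_left: "skew_res p (w + w') v = skew_res p w v + skew_res p w' v"
  by (simp add: skew_res_def op_choose_add_scale[OF dgrad_op_linear] Yskew_add_left
      Sum_any.distrib skew_finite)

lemma skew_res_add_right: "skew_res p w (v + v') = skew_res p w v + skew_res p w v'"
  by (simp add: skew_res_def Yskew_add_right Sum_any.distrib skew_finite)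

lemma skew_res_scale_left: "skew_res p (wscale W c w) v = wscale W c (skew_res p w v)"
  by (simp add: skew_res_def op_choose_add_scale[OF dgrad_op_linear] Yskew_scale_left
      Sum_any_scale skew_finite)

lemma star_right_add_left: "star_right V W N (w + w') v = star_right V W N w v + star_right V W N w' v"
  and star_right_add_right: "star_right V W N w (v + v') = star_right V W N w v + star_right V W N w v'"
  and star_right_scale_left: "star_right V W N (wscale W c w) v = wscale W c (star_right V W N w v)"
  by (simp_all add: star_right_eq_coeff skew_res_add_left skew_res_add_right skew_res_scale_left
      W.scale_right_distrib sum.distrib W.scale_sum_right mult.commute)

lemma dgrad_wvir_funpow:
  assumes "dgrad W z = wscale W h z"
  shows "dgrad W ((wvir V W (- 1) ^^ l) z) = wscale W (h + of_nat l) ((wvir V W (- 1) ^^ l) z)"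
proof (induction l)
  case (Suc l)
  have "dgrad W (wvir V W (- 1) y) = wvir V W (- 1) (dgrad W y) + wvir V W (- 1) y" for y
    using dgrad_wmode[OF conformal_homogeneous, of 0 y] by (simp add: wvir_def)
  then show ?case
    by (simp add: Suc.IH wvir_scale wvir_add W.scale_left_distrib)
qed (use assms in simp)

text \<open>
  Since \<open>L(-1) \<equiv> - d\<^sub>W\<close> modulo \<open>O\<^sub>N(W)\<close>, the operator \<open>e^(xL(-1))\<close> acts on a vector of
  weight \<open>h\<close> as \<open>(1 + x)^(-h)\<close>.
\<close>

lemma wvir_funpow_cong_O:
  assumes z: "dgrad W z = wscale W h z"
  shows "wscale W (1 / fact l) ((wvir V W (- 1) ^^ l) z) - wscale W (- h gchoose l) z \<in> O_W"
proof (induction l)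
  case 0
  then show ?case by (simp add: O_0)
next
  case (Suc l)
  let ?y = "(wvir V W (- 1) ^^ l) z"
  have c: "- h gchoose Suc l = - (h + of_nat l) / of_nat (Suc l) * (- h gchoose l)"
  proof -
    have "of_nat (Suc l) * (- h gchoose Suc l) = - (h + of_nat l) * (- h gchoose l)"
      using gbinomial_mult_1[of "- h" l] by (simp add: algebra_simps)
    then show ?thesis by (simp add: field_simps del: of_nat_Suc)
  qed
  \<comment> \<open>\<open>?y\<close> has weight h + l, so the first summand exchanges one L(-1) for
    -(h + l). The second is the induction hypothesis scaled by the ratio of consecutive binomials in
    \<open>c\<close>; the multiples of \<open>?y\<close> then cancel.\<close>
  have "wscale W (1 / fact (Suc l)) (dgrad W ?y + wvir V W (- 1) ?y)
      + wscale W (- (h + of_nat l) / of_nat (Suc l))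
        (wscale W (1 / fact l) ?y - wscale W (- h gchoose l) z) \<in> O_W"
    by (intro O_add O_scale Suc.IH dgrad_plus_wvir_mem_O)
  also have "wscale W (1 / fact (Suc l)) (dgrad W ?y + wvir V W (- 1) ?y)
      + wscale W (- (h + of_nat l) / of_nat (Suc l))
        (wscale W (1 / fact l) ?y - wscale W (- h gchoose l) z) =
    wscale W (1 / fact (Suc l)) ((wvir V W (- 1) ^^ Suc l) z) - wscale W (- h gchoose Suc l) z
      + (wscale W (1 / fact (Suc l) * (h + of_nat l)) ?y
      + wscale W (- (h + of_nat l) / of_nat (Suc l) * (1 / fact l)) ?y)"
    unfolding c by (simp add: dgrad_wvir_funpow[OF z] W.scale_right_distrib W.scale_right_diff_distrib
        W.scale_left_distrib add_divide_distrib algebra_simps del: of_nat_Suc fact_Suc)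
  also have "wscale W (1 / fact (Suc l) * (h + of_nat l)) ?y
      + wscale W (- (h + of_nat l) / of_nat (Suc l) * (1 / fact l)) ?y = 0"
    unfolding W.scale_left_distrib[symmetric] by (simp add: field_simps del: of_nat_Suc)
  finally show ?case by simp
qed

text \<open>
  The substitution \<open>y = -x/(1 + x)\<close>, which turns \<open>e^(xL(-1)) Y\<^sub>W(v,-x) (1 + x)^(d\<^sub>W + N) w\<close> into
  \<open>Y\<^sub>W((1 + y)^(L(0) - N) v,y)w\<close> modulo \<open>O\<^sub>N(W)\<close>; on coefficients it is Vandermonde's identity.
\<close>

lemma skew_res_cong_O:
  assumes w: "dgrad W w = wscale W m w" and v: "vir V 0 v = vscale V (of_int b) v"
  shows "skew_res p w v - wscale W ((- 1) powi (p + 1)) (res p (bin (b - int N - p - 2)) v w) \<in> O_W"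
proof -
  obtain M where M: "\<forall>i\<ge>M. wmode W v (p + int i) w = 0"
    using eventually_happens'[OF sequentially_bot wmode_eventually_zero[of v p w]] by blast
  define z where "z i = wmode W v (p + int i) w" for i
  define h where "h i = m + of_int (b - (p + int i) - 1)" for i
  define e where "e i = (- 1 :: complex) powi (p + int i + 1)" for i
  have z0: "z i = 0" if "i \<ge> M" for i using M that by (simp add: z_def)
  have hz: "dgrad W (z i) = wscale W (h i) (z i)" for i
    unfolding z_def h_def dgrad_wmode[OF v] w wmode_scale_right by (simp add: W.scale_left_distrib)
  let ?L = "\<lambda>k l. wscale W (1 / fact l) ((wvir V W (- 1) ^^ l) (z (k + l)))"
  have Y: "Yskew V W w v (- 1 - (p + int k)) = (\<Sum>l<M. wscale W (e (k + l)) (?L k l))" for k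
  proof -
    have "Yskew V W w v (- 1 - (p + int k)) = (\<Sum>l<M. wscale W ((- 1) powi (p + int k + int l + 1) / fact l)
        ((wvir V W (- 1) ^^ l) (wmode W v (p + int k + int l) w)))"
      by (rule Yskew_eq_sum) (use M in \<open>simp add: add.assoc flip: of_nat_add\<close>)
    then show ?thesis by (simp add: e_def z_def add.assoc)
  qed
  have "skew_res p w v = (\<Sum>k<M. wscale W (m + of_nat N gchoose k) (\<Sum>l<M. wscale W (e (k + l)) (?L k l)))"
    unfolding skew_res_def dgrad_op_choose_homogeneous[OF w] Yskew_scale_left Y
    by (rule Sum_any_eq_sum_lessThan) (simp add: z0)
  also have "\<dots> = (\<Sum>k<M. \<Sum>l<M. wscale W ((m + of_nat N gchoose k) * e (k + l)) (?L k l))"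
    by (simp only: W.scale_sum_right W.scale_scale mult.assoc)
  finally have 1: "skew_res p w v = (\<Sum>k<M. \<Sum>l<M. wscale W ((m + of_nat N gchoose k) * e (k + l)) (?L k l))" .
  let ?g = "\<lambda>k l. wscale W ((m + of_nat N gchoose k) * e (k + l)) (wscale W (- h (k + l) gchoose l) (z (k + l)))"
  have g: "?g k l = 0" if "k + l \<ge> M" for k l using z0[OF that] by simp
  have "(\<Sum>k<M. \<Sum>l<M. ?g k l) = (\<Sum>(k, l)\<in>{..<M} \<times> {..<M}. ?g k l)"
    by (simp add: sum.cartesian_product)
  also have "\<dots> = (\<Sum>(k, l)\<in>{(k, l). k + l < M}. ?g k l)"
  proof (intro sum.mono_neutral_right ballI)
    show "(case x of (k, l) \<Rightarrow> ?g k l) = 0" if "x \<in> {..<M} \<times> {..<M} - {(k, l). k + l < M}" for x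
      using g[of "fst x" "snd x"] that by (cases x) simp
  qed auto
  also have "\<dots> = (\<Sum>t<M. \<Sum>k\<le>t. ?g k (t - k))"
    by (rule sum.triangle_reindex)
  also have "\<dots> = (\<Sum>t<M. wscale W ((- 1) powi (p + 1)) (wscale W (of_int (b - int N - p - 2) gchoose t) (z t)))"
  proof (intro sum.cong refl)
    fix t
    have "(\<Sum>k\<le>t. ?g k (t - k)) = (\<Sum>k\<le>t. wscale W ((m + of_nat N gchoose k) * (- h t gchoose (t - k)) * e t) (z t))"
      by (intro sum.cong refl) (simp add: mult_ac)
    also have "\<dots> = wscale W ((\<Sum>k\<le>t. (m + of_nat N gchoose k) * (- h t gchoose (t - k))) * e t) (z t)"
      by (simp only: W.scale_sum_left sum_distrib_right)
    also have "(\<Sum>k\<le>t. (m + of_nat N gchoose k) * (- h t gchoose (t - k))) = m + of_nat N - h t gchoose t"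
      using gbinomial_Vandermonde[of "m + of_nat N" "- h t" t] by (simp add: atLeast0AtMost)
    \<comment> \<open>Since \<open>h t = m + b - p - t - 1\<close>, the weight \<open>m\<close> of
      \<open>w\<close> cancels. Negating the upper index then removes \<open>t\<close> from it, so
      one binomial series serves all \<open>t\<close>.\<close>
    also have "\<dots> = (- 1) ^ t * (of_int (b - int N - p - 2) gchoose t)"
      by (subst gbinomial_negated_upper) (simp add: h_def algebra_simps)
    also have "(- 1) ^ t * (of_int (b - int N - p - 2) gchoose t) * e t =
        (- 1) powi (p + 1) * (of_int (b - int N - p - 2) gchoose t)"
    proof -
      have "e t = (- 1) powi (p + 1) * (- 1) ^ t"
        using power_int_add[where 'a = complex, of "- 1" "p + 1" "int t"] by (simp add: e_def add_ac)
      moreover have "(- 1 :: complex) ^ t * (- 1) ^ t = 1"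
        by (simp flip: power_mult_distrib)
      ultimately show ?thesis by (simp add: mult_ac)
    qed
    finally show "(\<Sum>k\<le>t. ?g k (t - k)) =
        wscale W ((- 1) powi (p + 1)) (wscale W (of_int (b - int N - p - 2) gchoose t) (z t))"
      by simp
  qed
  also have "\<dots> = wscale W ((- 1) powi (p + 1)) (res p (bin (b - int N - p - 2)) v w)"
    using res_eq_sum[of M v p w "bin (b - int N - p - 2)"] M
    by (simp add: W.scale_sum_right z_def)
  finally have 2: "wscale W ((- 1) powi (p + 1)) (res p (bin (b - int N - p - 2)) v w) = (\<Sum>k<M. \<Sum>l<M. ?g k l)"
    by (rule sym)
  show ?thesis
    unfolding 1 2 sum_subtractf[symmetric] W.scale_right_diff_distrib[symmetric]
    by (intro O_sum O_scale wvir_funpow_cong_O hz)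
qed

text \<open>The first sum is the weight of the left product, the second that of the right product
  after the substitution, both multiplied by x^(2N + 1) and divided by (1 + x)^(b - 1). Their
  difference cancels the pole completely, which leaves the residue with p = 0 and c = -1.\<close>

lemma star_difference_identity:
  "(\<Sum>m\<le>N. fps_const (star_coeff m) * (fps_X ^ (N - m) * (1 + fps_X) ^ (N + 1)))
    - (\<Sum>m\<le>N. fps_const ((- 1) ^ N * of_nat ((m + N) choose N)) * (fps_X ^ (N - m) * (1 + fps_X) ^ m))
    = (fps_X :: complex fps) ^ (2 * N + 1)"
proof -
  let ?C = "\<lambda>m. of_nat ((m + N) choose N) :: complex fps"
  \<comment> \<open>The symmetric binomial identity is used for -1 and 1 + x, whose sum is
    x.\<close>
  have "(fps_X :: complex fps) ^ (2 * N + 1) = (- 1 + (1 + fps_X)) ^ (2 * N + 1)"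
    by simp
  also have "\<dots> = (\<Sum>m\<le>N. ?C m * ((- 1) ^ m * (1 + fps_X) ^ (N + 1) + (- 1) ^ (N + 1) * (1 + fps_X) ^ m)
      * (- 1 + (1 + fps_X)) ^ (N - m))"
    by (rule sum_binomial_power_symmetric[symmetric])
  also have "\<dots> = (\<Sum>m\<le>N. fps_const (star_coeff m) * (fps_X ^ (N - m) * (1 + fps_X) ^ (N + 1))
      - fps_const ((- 1) ^ N * of_nat ((m + N) choose N)) * (fps_X ^ (N - m) * (1 + fps_X) ^ m))"
  proof (intro sum.cong refl)
    fix m
    have c: "fps_const (star_coeff m) = (- 1) ^ m * ?C m"
      "fps_const ((- 1) ^ N * of_nat ((m + N) choose N)) = (- 1) ^ N * ?C m"
      by (simp_all add: star_coeff_def fps_of_nat flip: fps_const_mult fps_const_power fps_const_neg)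
    show "?C m * ((- 1) ^ m * (1 + fps_X) ^ (N + 1) + (- 1) ^ (N + 1) * (1 + fps_X) ^ m) * (- 1 + (1 + fps_X)) ^ (N - m) =
      fps_const (star_coeff m) * (fps_X ^ (N - m) * (1 + fps_X) ^ (N + 1))
      - fps_const ((- 1) ^ N * of_nat ((m + N) choose N)) * (fps_X ^ (N - m) * (1 + fps_X) ^ m)"
      unfolding c by (simp add: algebra_simps)
  qed
  finally show ?thesis by (simp add: sum_subtractf)
qed

lemma star_right_cong_O:
  "star_left V W N v w - star_right V W N w v - opres (- 1) 0 v w \<in> O_W"
proof (induction v rule: homogeneous_induct)
  case (homogeneous b v)
  show ?case
  proof (induction w rule: module_homogeneous_induct)
    case (homogeneous m w)
    note v = \<open>vir V 0 v = vscale V (of_int b) v\<close> and w = homogeneous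
    let ?p = "\<lambda>m. - int N - int m - 1"
    let ?d = "\<lambda>m. (- 1 :: complex) ^ N * of_nat ((m + N) choose N)"
    let ?R = "\<lambda>m. res (?p m) (bin (b + int m - 1)) v w"
    \<comment> \<open>All terms are brought to the deepest pole that occurs, the one for m = N, so
      that their weights can be added as power series.\<close>
    have shift: "res (?p m) f v w = res (- 2 * int N - 1) (fps_X ^ (N - m) * f) v w" if "m \<le> N" for m f
    proof -
      have "?p m = - 2 * int N - 1 + int (N - m)" using that by simp
      then show ?thesis by (simp only: res_X_power)
    qed
    have b1: "bin (b + int N) = (1 + fps_X) ^ (N + 1) * bin (b - 1)"
      using bin_add[of "int (N + 1)" "b - 1"] unfolding bin_of_nat by (simp add: add_ac)
    have b2: "bin (b + int m - 1) = (1 + fps_X) ^ m * bin (b - 1)" for m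
      using bin_add[of "int m" "b - 1"] unfolding bin_of_nat by (simp add: algebra_simps)
    have "(\<Sum>m\<le>N. wscale W (star_coeff m) (res (?p m) (bin (b + int N)) v w)) - (\<Sum>m\<le>N. wscale W (?d m) (?R m)) =
        res (- 2 * int N - 1) (((\<Sum>m\<le>N. fps_const (star_coeff m) * (fps_X ^ (N - m) * (1 + fps_X) ^ (N + 1)))
          - (\<Sum>m\<le>N. fps_const (?d m) * (fps_X ^ (N - m) * (1 + fps_X) ^ m))) * bin (b - 1)) v w"
    proof -
      have 1: "(\<Sum>m\<le>N. wscale W (star_coeff m) (res (?p m) (bin (b + int N)) v w)) =
          res (- 2 * int N - 1) ((\<Sum>m\<le>N. fps_const (star_coeff m) * (fps_X ^ (N - m) * (1 + fps_X) ^ (N + 1))) * bin (b - 1)) v w"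
        unfolding sum_distrib_right res_sum_fps mult.assoc res_scale_fps b1
        by (intro sum.cong refl arg_cong[where f = "wscale W _"] shift) simp
      have 2: "(\<Sum>m\<le>N. wscale W (?d m) (?R m)) =
          res (- 2 * int N - 1) ((\<Sum>m\<le>N. fps_const (?d m) * (fps_X ^ (N - m) * (1 + fps_X) ^ m)) * bin (b - 1)) v w"
        unfolding sum_distrib_right res_sum_fps mult.assoc res_scale_fps b2
        by (intro sum.cong refl arg_cong[where f = "wscale W _"] shift) simp
      have 3: "res p (f - g) v w = res p f v w - res p g v w" for p f g
        using res_add_fps[of p "f - g" g v w] by simp
      show ?thesis
        unfolding 1 2 left_diff_distrib 3 ..
    qed
    also have "\<dots> = opres (- 1) 0 v w"
      unfolding star_difference_identity res_X_power opres_homogeneous[OF v] by simp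
    finally have diff: "star_left V W N v w = opres (- 1) 0 v w + (\<Sum>m\<le>N. wscale W (?d m) (?R m))"
      unfolding star_left_homogeneous[OF v] by (simp add: algebra_simps)
    \<comment> \<open>The substitution contributes (-1)^(N + m). Its part depending on
      \<open>m\<close> cancels the alternating sign of \<open>star_coeff\<close>, which leaves the
      constant sign (-1)^N.\<close>
    have d: "?d m = star_coeff m * (- 1) powi (?p m + 1)" for m
    proof -
      have "(- 1 :: complex) powi (?p m + 1) = (- 1) ^ N * (- 1) ^ m"
        using power_int_minus_one_minus[where 'a = complex, of "int (N + m)"]
        unfolding power_int_of_nat by (simp add: power_add algebra_simps)
      moreover have "(- 1 :: complex) ^ m * (- 1) ^ m = 1"
        by (simp flip: power_mult_distrib)
      ultimately show ?thesis by (simp add: star_coeff_def mult_ac)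
    qed
    have "star_right V W N w v - (\<Sum>m\<le>N. wscale W (?d m) (?R m)) =
        (\<Sum>m\<le>N. wscale W (star_coeff m) (skew_res (?p m) w v
          - wscale W ((- 1) powi (?p m + 1)) (res (?p m) (bin (b - int N - ?p m - 2)) v w)))"
    proof -
      have "b - int N - ?p m - 2 = b + int m - 1" for m by simp
      then show ?thesis
        unfolding star_right_eq_coeff sum_subtractf[symmetric] d W.scale_right_diff_distrib W.scale_scale
        by (simp only:)
    qed
    also have "\<dots> \<in> O_W"
      by (intro O_sum O_scale skew_res_cong_O[OF w v])
    finally have "- (star_right V W N w v - (\<Sum>m\<le>N. wscale W (?d m) (?R m))) \<in> O_W"
      by (rule O_neg)
    then show ?case by (simp add: diff algebra_simps)
  next
    case (add w w')
    have "star_left V W N v (w + w') - star_right V W N (w + w') v - opres (- 1) 0 v (w + w') =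
        (star_left V W N v w - star_right V W N w v - opres (- 1) 0 v w)
        + (star_left V W N v w' - star_right V W N w' v - opres (- 1) 0 v w')"
      by (simp add: star_left_add_right star_right_add_left opres_add_right)
    then show ?case using O_add[OF add] by simp
  qed
next
  case (add u v)
  have "star_left V W N (u + v) w - star_right V W N w (u + v) - opres (- 1) 0 (u + v) w =
      (star_left V W N u w - star_right V W N w u - opres (- 1) 0 u w)
      + (star_left V W N v w - star_right V W N w v - opres (- 1) 0 v w)"
    by (simp add: star_left_add_left star_right_add_right opres_add_left)
  then show ?case using O_add[OF add] by simp
qed

lemma star_right_mem_O_aux:
  assumes "star_left V W N v w \<in> O_W" and "opres (- 1) 0 v w \<in> O_W"
  shows "star_right V W N w v \<in> O_W"
  using O_diff[OF O_diff[OF assms] star_right_cong_O[of v w]] by simp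

lemma star_right_mem_O: "w \<in> O_W \<Longrightarrow> star_right V W N w v \<in> O_W"
  by (intro star_right_mem_O_aux star_left_mem_O opres_minus_1_mem_O)

lemma star_right_O_alg_mem_O: "v \<in> O_alg V N \<Longrightarrow> star_right V W N w v \<in> O_W"
  by (intro star_right_mem_O_aux star_left_O_alg_mem_O opres_minus_1_O_alg_mem_O)

text \<open>For p = -2N - 2 the exponent b - N - p - 2 of the substituted series equals b + N, so up
  to sign the residue becomes a defining element of \<open>O_W\<close>.\<close>

lemma skew_res_mem_O: "skew_res (- 2 * int N - 2) w v \<in> O_W"
proof (induction v rule: homogeneous_induct)
  case (homogeneous b v)
  show ?case
  proof (induction w rule: module_homogeneous_induct)
    case (homogeneous m w)
    note v = \<open>vir V 0 v = vscale V (of_int b) v\<close> and w = homogeneous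
    have "res (- 2 * int N - 2) (bin (b + int N)) v w \<in> O_W"
      using res_mem_O[OF v, of 0] by simp
    then show ?case
      using O_add[OF skew_res_cong_O[OF w v, of "- 2 * int N - 2"] O_scale[of "res (- 2 * int N - 2) (bin (b + int N)) v w"
          "(- 1) powi (- 2 * int N - 2 + 1)"]]
      by (simp add: add.commute)
  next
    case (add w w')
    then show ?case by (simp only: skew_res_add_left O_add)
  qed
next
  case (add u v)
  then show ?case by (simp only: skew_res_add_right O_add)
qed

section \<open>Derivations of the vertex operator algebra applied to residues\<close>

lemma derivation_opres:
  assumes F: "voa_derivation V W F"
  shows "F (weak_voa_module.opres V (adjoint V) (int N) p u v) = opres (int N) p u (F v) + skew_res p (F u) v"
proof -
  interpret adj: graded_voa_module V "adjoint V" N by (rule graded_voa_module_adjoint)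
  from F have lin: "Vector_Spaces.linear (vscale V) (wscale W) F"
    and grad: "F (vir V 0 v) = dgrad W (F v)"
    and der: "F (Yser (vmode V) u v j) = Yser (wmode W) u (F v) j + Yskew V W (F u) v j" for u v j
    by (auto simp: voa_derivation_def)
  note F0 = module_hom.zero[OF lin[folded module_hom_iff_linear]]
  have der': "F (vmode V u n v) = wmode W u n (F v) + Yskew V W (F u) v (- 1 - n)" for u v n
    using der[of u v "- 1 - n"] by (simp add: Yser_def)
  let ?A = "\<lambda>y. vir V 0 y + vscale V (of_nat N) y" and ?B = "\<lambda>y. dgrad W y + wscale W (of_nat N) y"
  let ?g = "\<lambda>k. vmode V (op_choose (vscale V) ?A k u) (p + int k) v"
  have op: "F (op_choose (vscale V) ?A k u) = op_choose (wscale W) ?B k (F u)" for k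
    using lin by (intro op_choose_intertwine) (auto simp: Vector_Spaces.linear_iff grad)
  have fin: "finite {k. ?g k \<noteq> 0}"
    using adj.op_finite[of "int N" u p v] by simp
  have "F (Sum_any ?g) = Sum_any (\<lambda>k. F (?g k))"
  proof -
    have "Sum_any (\<lambda>k. F (?g k)) = (\<Sum>k | ?g k \<noteq> 0. F (?g k))"
      by (rule Sum_any.expand_superset[OF fin]) (auto simp: F0)
    then show ?thesis
      by (simp add: Sum_any.expand_set module_hom.sum[OF lin[folded module_hom_iff_linear]])
  qed
  also have "\<dots> = opres (int N) p u (F v) + skew_res p (F u) v"
    unfolding der' op opres_def skew_res_def of_int_of_nat_eq
    using op_finite[of "int N" u p "F v"] skew_finite[of "F u" v p]
    by (intro Sum_any.distrib) (simp_all add: fun_eq_iff)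
  finally show ?thesis by (simp add: adj.opres_def)
qed

lemma derivation_star:
  assumes F: "voa_derivation V W F"
  shows "F (star_alg V N u v) = star_left V W N u (F v) + star_right V W N (F u) v"
proof -
  interpret adj: graded_voa_module V "adjoint V" N by (rule graded_voa_module_adjoint)
  from F have lin: "Vector_Spaces.linear (vscale V) (wscale W) F"
    by (simp add: voa_derivation_def)
  have "star_alg V N u v = star_left V (adjoint V) N u v"
    by (simp add: star_alg_def star_left_def)
  also have "\<dots> = (\<Sum>m\<le>N. vscale V (star_coeff m) (adj.opres (int N) (- int N - int m - 1) u v))"
    unfolding adj.star_left_eq by (simp add: star_coeff_def)
  finally show ?thesis
    using lin
    by (simp add: module_hom.sum[OF lin[folded module_hom_iff_linear]] Vector_Spaces.linear_iff
        derivation_opres[OF F] star_left_eq_coeff star_right_eq_coeff W.scale_right_distrib sum.distrib)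
qed

lemma derivation_vir_minus_1:
  assumes F: "voa_derivation V W F"
  shows "F (vir V (- 1) v) = wvir V W (- 1) (F v)"
proof -
  have der: "F (vmode V u n v) = wmode W u n (F v) + Yskew V W (F u) v (- 1 - n)" for u v n
    using F[unfolded voa_derivation_def, THEN conjunct2, THEN conjunct2, rule_format, of u v "- 1 - n"]
    by (simp add: Yser_def)
  \<comment> \<open>The vacuum acts as the identity, so only e^(xL(-1)) w is left.\<close>
  have Yskew_vacuum: "Yskew V W w (vacuum V) (int j) = wscale W (1 / fact j) ((wvir V W (- 1) ^^ j) w)" for w j
  proof -
    have "Yskew V W w (vacuum V) (- 1 - (- 1 - int j)) = Sum_any (\<lambda>l. if l = j then
        wscale W (1 / fact j) ((wvir V W (- 1) ^^ j) w) else 0)"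
      unfolding Yskew_eq by (rule Sum_any.cong) (auto simp: wmode_vacuum)
    then show ?thesis by simp
  qed
  \<comment> \<open>The derivation rule for the mode of index -1 of the vacuum applied to the
    vacuum.\<close>
  have "F (vacuum V) = F (vacuum V) + F (vacuum V)"
    using der[of "vacuum V" "- 1" "vacuum V"] Yskew_vacuum[of "F (vacuum V)" 0]
    by (simp add: vacuum wmode_vacuum)
  then have F0: "F (vacuum V) = 0" by simp
  \<comment> \<open>\<open>L(-1)v\<close> is written as a mode of \<open>v\<close> on the vacuum.
    The derivation rule then gives the coefficient of x in e^(xL(-1)) F(v), because the other term
    contains \<open>F\<close> of the vacuum.\<close>
  have "vir V (- 1) v = vmode V v (- 2) (vacuum V)"
    using derivative[of v "- 1" "vacuum V"] creation(1)[of "vir V (- 1) v"] by simp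
  then show ?thesis
    using der[of v "- 2" "vacuum V"] F0 Yskew_vacuum[of "F v" 1] by simp
qed

lemma derivation_mem_O:
  assumes F: "voa_derivation V W F" and v: "v \<in> O_alg V N"
  shows "F v \<in> O_W"
proof (rule linear_image_O_alg[OF _ _ _ v])
  show "Vector_Spaces.linear (vscale V) (wscale W) F"
    using F by (simp add: voa_derivation_def)
  show "F (weak_voa_module.opres V (adjoint V) (int N) (- 2 * int N - 2) u v) \<in> O_W" for u v
    unfolding derivation_opres[OF F] by (intro O_add opres_mem_O skew_res_mem_O)
  show "F (vir V 0 v + vir V (- 1) v) \<in> O_W" for v
    using F dgrad_plus_wvir_mem_O[of "F v"]
    by (simp add: voa_derivation_def Vector_Spaces.linear_iff derivation_vir_minus_1[OF F])
qed

end

text \<open>Each component \<open>U\<close> is stable under L(0), hence spanned by its intersections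
  with the generalized eigenspaces, and on those \<open>dgrad\<close> is the scalar
  \<open>m + \<alpha> U\<close>. A mode of a homogeneous vector stays in \<open>U\<close> and shifts
  the generalized eigenvalue by a - n - 1; the constant \<open>\<alpha> U\<close> is the same before
  and after and drops out of the commutator.\<close>

lemma graded_voa_moduleI:
  assumes V: "vertex_operator_algebra V" and W: "generalized_module V W" and d: "grading_operator V W"
  shows "graded_voa_module V W"
proof -
  interpret vertex_operator_algebra V by (rule V)
  interpret gm: generalized_module V W by (rule W)
  interpret weak_voa_module V W
    by (intro weak_voa_module.intro weak_voa_module_axioms.intro V)
      (fact gm.vector_space gm.linear_left gm.linear_right gm.truncation gm.vacuum gm.jacobi gm.derivative)+
  let ?T = "wvir V W 0" and ?s = "wscale W"
  have T: "Vector_Spaces.linear ?s ?s ?T"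
    unfolding wvir_def by (rule wmode_linear_right)
  define S where "S = semisimple_part ?s ?T"
  have S: "Vector_Spaces.linear ?s ?s S" "\<And>m w. w \<in> gen_eigenspace ?s ?T m \<Longrightarrow> S w = ?s m w"
    using W.semisimple_part_linear_and_eigen[OF T gm.grading] by (auto simp: S_def)
  from d obtain C \<alpha> where lin: "Vector_Spaces.linear ?s ?s (dgrad W)"
    and sub: "\<And>U. U \<in> C \<Longrightarrow> submodule_of W U"
    and sum: "internal_direct_sum ?s C"
    and dU: "\<And>U w. U \<in> C \<Longrightarrow> w \<in> U \<Longrightarrow> dgrad W w = S w + ?s (\<alpha> U) w"
    unfolding grading_operator_def S_def by blast
  have lin': "dgrad W (x + y) = dgrad W x + dgrad W y" "dgrad W (?s c x) = ?s c (dgrad W x)" for x y c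
    using lin by (auto simp: Vector_Spaces.linear_iff)
  let ?E = "\<Union>U\<in>C. \<Union>m. U \<inter> gen_eigenspace ?s ?T m"
  have C_span: "U \<subseteq> W.span ?E" if U: "U \<in> C" for U
  proof
    fix w assume w: "w \<in> U"
    obtain c where c: "finite {m. c m \<noteq> 0}" "\<And>m. c m \<in> gen_eigenspace ?s ?T m" "Sum_any c = w"
      using W.gen_eigenspace_decomposition[OF T, of w] gm.grading by auto
    have U': "W.subspace U" "?T ` U \<subseteq> U"
      using sub[OF U] by (auto simp: submodule_of_def wvir_def)
    have "sum c {m. c m \<noteq> 0} \<in> U"
      using c(3) w by (simp add: Sum_any.expand_set)
    then have "c m \<in> U" if "c m \<noteq> 0" for m
      using W.gen_eigenspace_component_mem[OF T U' c(1), of c m] c(2) that by auto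
    then have "sum c {m. c m \<noteq> 0} \<in> W.span ?E"
      using c(2) U by (intro W.span_sum W.span_base) auto
    then show "w \<in> W.span ?E"
      using c(3) by (simp add: Sum_any.expand_set)
  qed
  have E_span: "W.span ?E = UNIV"
  proof -
    have "W.span (\<Union>C) \<subseteq> W.span ?E"
      using C_span by (intro W.span_minimal) auto
    then show ?thesis
      using sum by (auto simp: internal_direct_sum_def)
  qed
  have dE: "dgrad W w = ?s (m + \<alpha> U) w" if "U \<in> C" "w \<in> U" "w \<in> gen_eigenspace ?s ?T m" for U m w
    using dU[OF that(1,2)] S(2)[OF that(3)] by (simp add: W.scale_left_distrib)
  have raise: "wmode W u n w \<in> gen_eigenspace ?s ?T (m + of_int (a - n - 1))"
    if u: "vir V 0 u = vscale V (of_int a) u" and w: "w \<in> gen_eigenspace ?s ?T m" for a u n w m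
  proof -
    let ?c = "of_int (a - n - 1) :: complex"
    have "((\<lambda>y. ?T y - ?s (m + ?c) y) ^^ k) (wmode W u n w) =
        wmode W u n (((\<lambda>y. ?T y - ?s m y) ^^ k) w)" for k
    proof (induction k)
      case (Suc k)
      have "?T (wmode W u n y) - ?s (m + ?c) (wmode W u n y) = wmode W u n (?T y - ?s m y)" for y
      proof -
        have "wmode W u n (?T y - ?s m y) = wmode W u n (?T y) - ?s m (wmode W u n y)"
          by (simp add: module_hom.diff[OF wmode_linear_right[folded module_hom_iff_linear]] wmode_scale_right)
        then show ?thesis
          unfolding wvir_0_commutator[OF u] by (simp add: W.scale_left_distrib)
      qed
      then show ?case using Suc.IH by simp
    qed simp
    moreover obtain k where "((\<lambda>y. ?T y - ?s m y) ^^ k) w = 0"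
      using w by (auto simp: gen_eigenspace_def)
    ultimately show ?thesis
      unfolding gen_eigenspace_def by (auto intro!: exI[of _ k])
  qed
  show ?thesis
  proof (intro graded_voa_module.intro graded_voa_module_axioms.intro weak_voa_module_axioms)
    show "Vector_Spaces.linear ?s ?s (dgrad W)" by (rule lin)
    have "W.span ?E \<subseteq> W.span (\<Union>m. eigenspace ?s (dgrad W) m)"
      using dE by (intro W.span_mono) (fastforce simp: eigenspace_def)
    then show "W.span (\<Union>m. eigenspace ?s (dgrad W) m) = UNIV"
      using E_span by auto
    fix u a n w
    assume u: "vir V 0 u = vscale V (of_int a) u"
    have "w \<in> W.span ?E" using E_span by simp
    then show "dgrad W (wmode W u n w) = wmode W u n (dgrad W w) + ?s (of_int (a - n - 1)) (wmode W u n w)"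
    proof (induction rule: W.span_induct_alt)
      case base
      show ?case by (simp add: module_hom.zero[OF lin[folded module_hom_iff_linear]])
    next
      case (step c x y)
      then obtain U m where x: "U \<in> C" "x \<in> U" "x \<in> gen_eigenspace ?s ?T m" by auto
      have "wmode W u n x \<in> U"
        using sub[OF x(1)] x(2) by (simp add: submodule_of_def)
      then have "dgrad W (wmode W u n x) = wmode W u n (dgrad W x) + ?s (of_int (a - n - 1)) (wmode W u n x)"
        using dE[OF x(1) _ raise[OF u x(3)]] dE[OF x]
        by (simp only: wmode_scale_right) (simp add: W.scale_left_distrib add_ac)
      then show ?case
        using step.IH
        by (simp add: wmode_add_right wmode_scale_right lin' W.scale_right_distrib W.scale_left_commute)
    qed
  qed
qed

section \<open>Cosets and cohomology\<close>

lemma UN_const_eq: "X \<noteq> {} \<Longrightarrow> (\<And>x. x \<in> X \<Longrightarrow> f x = c) \<Longrightarrow> (\<Union>x\<in>X. f x) = c"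
  by auto

text \<open>Sums and multiples of cosets appear as unions over pairs of parameters. Fixing one of
  them at the neutral value \<open>e\<close> already gives all elements.\<close>

lemma UN_UN_singleton:
  assumes "\<And>z. k z e = z"
  shows "(\<Union>x. \<Union>y. {g (k x y)}) = range g"
proof
  show "range g \<subseteq> (\<Union>x. \<Union>y. {g (k x y)})"
  proof
    fix a assume "a \<in> range g"
    then obtain z where "a = g (k z e)" using assms by auto
    then show "a \<in> (\<Union>x. \<Union>y. {g (k x y)})" by blast
  qed
qed auto

section \<open>Computation with representatives in the quotients\<close>

context graded_voa_module
begin

abbreviation "alg \<equiv> A_alg V N"
abbreviation "bim \<equiv> A_mod V W N"
abbreviation "acls \<equiv> cls_alg V N"
abbreviation "mcls \<equiv> cls_mod V W N"

lemma subspace_O_alg: "subspace (O_alg V N)"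
  by (simp add: O_alg_def)

lemma mem_acls: "x \<in> acls v \<longleftrightarrow> x - v \<in> O_alg V N"
  by (auto simp: cls_alg_def a_r_coset_def' pre_alg_def intro!: bexI[of _ "x - v"])

lemma mem_mcls: "x \<in> mcls w \<longleftrightarrow> x - w \<in> O_W"
  by (auto simp: cls_mod_def a_r_coset_def' pre_mod_def intro!: bexI[of _ "x - w"])

lemma acls_self: "v \<in> acls v" and mcls_self: "w \<in> mcls w"
  by (simp_all add: mem_acls mem_mcls subspace_0[OF subspace_O_alg] O_0)

lemma acls_nonempty: "acls v \<noteq> {}"
  using acls_self by blast

lemma acls_eqI:
  assumes "u - v \<in> O_alg V N"
  shows "acls u = acls v"
proof -
  have "x - u \<in> O_alg V N \<longleftrightarrow> x - v \<in> O_alg V N" for x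
    using subspace_add[OF subspace_O_alg _ assms, of "x - u"] subspace_diff[OF subspace_O_alg _ assms, of "x - v"]
    by auto
  then show ?thesis by (auto simp: mem_acls)
qed

lemma mcls_eq_iff: "mcls u = mcls v \<longleftrightarrow> u - v \<in> O_W"
proof
  assume "mcls u = mcls v"
  then show "u - v \<in> O_W" using mcls_self[of u] by (simp add: mem_mcls)
next
  assume *: "u - v \<in> O_W"
  have "x - u \<in> O_W \<longleftrightarrow> x - v \<in> O_W" for x
    using O_add[OF _ *, of "x - u"] O_diff[OF _ *, of "x - v"] by auto
  then show "mcls u = mcls v" by (auto simp: mem_mcls)
qed

lemma carrier_alg: "carrier alg = range acls"
  by (auto simp: A_alg_def quotient_def A_RCOSETS_def' cls_alg_def pre_alg_def)

lemma bim_simps: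
  "carrier bim = a_rcosets\<^bsub>pre_mod W\<^esub> O_W"
  "zero bim = O_W"
  "add bim = set_add (pre_mod W)"
  "smult bim = (\<lambda>c X. \<Union>x\<in>X. mcls (wscale W c x))"
  "lact bim = (\<lambda>X Z. \<Union>v\<in>X. \<Union>w\<in>Z. mcls (star_left V W N v w))"
  "ract bim = (\<lambda>Z X. \<Union>w\<in>Z. \<Union>v\<in>X. mcls (star_right V W N w v))"
  by (simp_all add: A_mod_def quotient_def module.defs cls_mod_def pre_mod_def)

lemma carrier_bim: "carrier bim = range mcls"
  by (auto simp: bim_simps A_RCOSETS_def' cls_mod_def pre_mod_def)

lemma add_alg: "acls u \<oplus>\<^bsub>alg\<^esub> acls v = acls (u + v)"
proof -
  have "x \<in> acls u \<oplus>\<^bsub>alg\<^esub> acls v \<longleftrightarrow> (\<exists>y z. y - u \<in> O_alg V N \<and> z - v \<in> O_alg V N \<and> x = y + z)" for x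
    by (auto simp: A_alg_def quotient_def set_add_def' pre_alg_def mem_acls[symmetric])
  moreover have "(\<exists>y z. y - u \<in> O_alg V N \<and> z - v \<in> O_alg V N \<and> x = y + z) \<longleftrightarrow> x - (u + v) \<in> O_alg V N" for x
  proof
    assume "\<exists>y z. y - u \<in> O_alg V N \<and> z - v \<in> O_alg V N \<and> x = y + z"
    then obtain y z where "y - u \<in> O_alg V N" "z - v \<in> O_alg V N" "x = y + z" by blast
    then show "x - (u + v) \<in> O_alg V N"
      using subspace_add[OF subspace_O_alg, of "y - u" "z - v"] by (simp add: algebra_simps)
  next
    assume "x - (u + v) \<in> O_alg V N"
    then show "\<exists>y z. y - u \<in> O_alg V N \<and> z - v \<in> O_alg V N \<and> x = y + z"
      using subspace_0[OF subspace_O_alg]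
      by (intro exI[of _ u] exI[of _ "x - u"]) (simp add: algebra_simps)
  qed
  ultimately show ?thesis by (auto simp: mem_acls)
qed

lemma add_bim: "mcls u \<oplus>\<^bsub>bim\<^esub> mcls v = mcls (u + v)"
proof -
  have "x \<in> mcls u \<oplus>\<^bsub>bim\<^esub> mcls v \<longleftrightarrow> (\<exists>y z. y - u \<in> O_W \<and> z - v \<in> O_W \<and> x = y + z)" for x
    by (auto simp: bim_simps set_add_def' pre_mod_def mem_mcls[symmetric])
  moreover have "(\<exists>y z. y - u \<in> O_W \<and> z - v \<in> O_W \<and> x = y + z) \<longleftrightarrow> x - (u + v) \<in> O_W" for x
  proof
    assume "\<exists>y z. y - u \<in> O_W \<and> z - v \<in> O_W \<and> x = y + z"
    then obtain y z where "y - u \<in> O_W" "z - v \<in> O_W" "x = y + z" by blast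
    then show "x - (u + v) \<in> O_W"
      using O_add[of "y - u" "z - v"] by (simp add: algebra_simps)
  next
    assume "x - (u + v) \<in> O_W"
    then show "\<exists>y z. y - u \<in> O_W \<and> z - v \<in> O_W \<and> x = y + z"
      using O_0 by (intro exI[of _ u] exI[of _ "x - u"]) (simp add: algebra_simps)
  qed
  ultimately show ?thesis by (auto simp: mem_mcls)
qed

lemma smult_alg: "c \<odot>\<^bsub>alg\<^esub> acls v = acls (vscale V c v)"
proof -
  have "c \<odot>\<^bsub>alg\<^esub> acls v = (\<Union>x\<in>acls v. acls (vscale V c x))"
    by (simp add: A_alg_def quotient_def cls_alg_def pre_alg_def)
  also have "\<dots> = acls (vscale V c v)"
  proof (rule UN_const_eq)
    fix x assume "x \<in> acls v"
    then show "acls (vscale V c x) = acls (vscale V c v)"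
      using subspace_scale[OF subspace_O_alg, of "x - v" c]
      by (intro acls_eqI) (simp add: mem_acls scale_right_diff_distrib)
  qed (use acls_self in blast)
  finally show ?thesis .
qed

lemma smult_bim: "c \<odot>\<^bsub>bim\<^esub> mcls w = mcls (wscale W c w)"
  unfolding bim_simps
proof (rule UN_const_eq)
  fix x assume "x \<in> mcls w"
  then show "mcls (wscale W c x) = mcls (wscale W c w)"
    using O_scale[of "x - w" c] by (simp add: mcls_eq_iff mem_mcls W.scale_right_diff_distrib)
qed (use mcls_self in blast)

lemma star_left_diff_left: "star_left V W N (u - u') w = star_left V W N u w - star_left V W N u' w"
  using star_left_add_left[of "u - u'" u' w] by simp

lemma star_left_diff_right: "star_left V W N u (w - w') = star_left V W N u w - star_left V W N u w'"
  using star_left_add_right[of u "w - w'" w'] by simp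

lemma star_right_diff_left: "star_right V W N (w - w') v = star_right V W N w v - star_right V W N w' v"
  using star_right_add_left[of "w - w'" w' v] by simp

lemma star_right_diff_right: "star_right V W N w (v - v') = star_right V W N w v - star_right V W N w v'"
  using star_right_add_right[of w "v - v'" v'] by simp

lemma lact_bim: "lact bim (acls u) (mcls w) = mcls (star_left V W N u w)"
  unfolding bim_simps
proof (intro UN_const_eq)
  fix x z assume "x \<in> acls u" "z \<in> mcls w"
  then have "star_left V W N (x - u) z + star_left V W N u (z - w) \<in> O_W"
    by (intro O_add star_left_mem_O star_left_O_alg_mem_O) (simp_all add: mem_acls mem_mcls)
  then show "mcls (star_left V W N x z) = mcls (star_left V W N u w)"
    by (simp add: mcls_eq_iff star_left_diff_left star_left_diff_right)
qed (use acls_self mcls_self in blast)+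

lemma ract_bim: "ract bim (mcls w) (acls u) = mcls (star_right V W N w u)"
  unfolding bim_simps
proof (intro UN_const_eq)
  fix x z assume "x \<in> acls u" "z \<in> mcls w"
  then have "star_right V W N z (x - u) + star_right V W N (z - w) u \<in> O_W"
    by (intro O_add star_right_mem_O star_right_O_alg_mem_O) (simp_all add: mem_acls mem_mcls)
  then show "mcls (star_right V W N z x) = mcls (star_right V W N w u)"
    by (simp add: mcls_eq_iff star_right_diff_left star_right_diff_right)
qed (use acls_self mcls_self in blast)+

lemma mult_alg: "acls u \<otimes>\<^bsub>alg\<^esub> acls v = acls (star_alg V N u v)"
proof -
  interpret adj: graded_voa_module V "adjoint V" N by (rule graded_voa_module_adjoint)
  \<comment> \<open>With this equality, the product being well defined on cosets is the case W = V
    of the results on the left action.\<close>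
  have O: "O_alg V N = O_mod V (adjoint V) N"
  proof
    show "O_alg V N \<subseteq> O_mod V (adjoint V) N" by (rule O_alg_subset)
    have "Res_xpow (- 2 * int N - 2) (twisted (vscale V) (vir V 0) N (Yser (vmode V)) u v) \<in>
        {Res_xpow (- 2 * int N - 2 - int n) (twisted (vscale V) (vir V 0) N (Yser (vmode V)) u v)
          |u v n. True}" for u v
      by (intro CollectI exI[of _ u] exI[of _ v] exI[of _ 0]) simp
    then show "O_mod V (adjoint V) N \<subseteq> O_alg V N"
      unfolding O_mod_def O_alg_def adjoint_simps by (intro span_mono) blast
  qed
  have star: "star_alg V N = star_left V (adjoint V) N"
    by (simp add: fun_eq_iff star_alg_def star_left_def)
  have "acls u \<otimes>\<^bsub>alg\<^esub> acls v = (\<Union>x\<in>acls u. \<Union>y\<in>acls v. acls (star_alg V N x y))"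
    by (simp add: A_alg_def quotient_def rcoset_mult_def cls_alg_def pre_alg_def)
  also have "\<dots> = acls (star_alg V N u v)"
  proof (intro UN_const_eq)
    fix x z assume "x \<in> acls u" "z \<in> acls v"
    then have "star_alg V N (x - u) z + star_alg V N u (z - v) \<in> O_alg V N"
      unfolding star mem_acls O
      by (intro adj.O_add adj.star_left_mem_O adj.star_left_O_alg_mem_O) (simp_all add: O)
    then show "acls (star_alg V N x z) = acls (star_alg V N u v)"
      by (intro acls_eqI) (simp add: star adj.star_left_diff_left adj.star_left_diff_right)
  qed (use acls_self in blast)+
  finally show ?thesis .
qed

lemma minus_bim: "mcls u \<ominus>\<^bsub>bim\<^esub> mcls v = mcls (u - v)"
proof -
  have zero: "\<zero>\<^bsub>bim\<^esub> = mcls 0"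
    by (auto simp: bim_simps mem_mcls)
  have "\<ominus>\<^bsub>bim\<^esub> mcls v = mcls (- v)"
    unfolding a_inv_def m_inv_def
  proof (rule the_equality)
    show "mcls (- v) \<in> carrier (add_monoid bim) \<and> mcls v \<otimes>\<^bsub>add_monoid bim\<^esub> mcls (- v) = \<one>\<^bsub>add_monoid bim\<^esub>
        \<and> mcls (- v) \<otimes>\<^bsub>add_monoid bim\<^esub> mcls v = \<one>\<^bsub>add_monoid bim\<^esub>"
      by (simp add: carrier_bim add_bim zero)
    fix Y assume Y: "Y \<in> carrier (add_monoid bim) \<and> mcls v \<otimes>\<^bsub>add_monoid bim\<^esub> Y = \<one>\<^bsub>add_monoid bim\<^esub>
        \<and> Y \<otimes>\<^bsub>add_monoid bim\<^esub> mcls v = \<one>\<^bsub>add_monoid bim\<^esub>"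
    then obtain y where "Y = mcls y" by (auto simp: carrier_bim)
    then show "Y = mcls (- v)"
      using Y by (simp add: add_bim zero mcls_eq_iff)
  qed
  then show ?thesis by (simp add: a_minus_def add_bim)
qed

definition descends :: "('v \<Rightarrow> 'w) \<Rightarrow> bool" where
  "descends \<phi> \<longleftrightarrow> (\<forall>x y. x - y \<in> O_alg V N \<longrightarrow> \<phi> x - \<phi> y \<in> O_W)"

lemma induced_acls: "descends \<phi> \<Longrightarrow> induced V W N \<phi> (acls v) = mcls (\<phi> v)"
  unfolding induced_def
proof (subst restrict_apply')
  assume "descends \<phi>"
  then show "(\<Union>x\<in>acls v. mcls (\<phi> x)) = mcls (\<phi> v)"
    using acls_nonempty by (intro UN_const_eq) (simp_all add: mem_acls mcls_eq_iff descends_def)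
qed (simp add: carrier_alg)

lemma induced_eqI:
  assumes "descends \<phi>" and "f \<in> extensional (carrier alg)" and "\<And>v. f (acls v) = mcls (\<phi> v)"
  shows "f = induced V W N \<phi>"
proof
  fix X
  show "f X = induced V W N \<phi> X"
  proof (cases "X \<in> carrier alg")
    case True
    then show ?thesis using assms(3) induced_acls[OF assms(1)] by (auto simp: carrier_alg)
  next
    case False
    then show ?thesis using assms(2) by (simp add: extensional_def induced_def)
  qed
qed

lemma descends_add: "descends \<phi> \<Longrightarrow> descends \<psi> \<Longrightarrow> descends (\<lambda>v. \<phi> v + \<psi> v)"
  unfolding descends_def by (metis O_add add_diff_add)

lemma descends_scale: "descends \<phi> \<Longrightarrow> descends (\<lambda>v. wscale W c (\<phi> v))"
  unfolding descends_def by (metis O_scale W.scale_right_diff_distrib)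

text \<open>The inner derivations lifted to maps from \<open>V\<close> to \<open>W\<close>, so that
  cosets of them can be handled through representatives.\<close>

definition ad :: "'w \<Rightarrow> 'v \<Rightarrow> 'w" where
  "ad w v = star_left V W N v w - star_right V W N w v"

lemma descends_ad: "descends (ad w)"
  unfolding descends_def
proof (intro allI impI)
  fix x y assume "x - y \<in> O_alg V N"
  then have "star_left V W N (x - y) w - star_right V W N w (x - y) \<in> O_W"
    by (intro O_diff star_left_O_alg_mem_O star_right_O_alg_mem_O)
  then show "ad w x - ad w y \<in> O_W"
    by (simp add: ad_def star_left_diff_left star_right_diff_right algebra_simps)
qed

lemma ad_add: "ad (w + w') v = ad w v + ad w' v"
  and ad_scale: "ad (wscale W c w) v = wscale W c (ad w v)"
proof -
  show "ad (w + w') v = ad w v + ad w' v"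
    by (simp add: ad_def star_left_add_right star_right_add_left)
  show "ad (wscale W c w) v = wscale W c (ad w v)"
    by (simp add: ad_def star_left_scale_right star_right_scale_left W.scale_right_diff_distrib)
qed

lemma inner_derivations_eq: "inner_derivations alg bim = range (\<lambda>w. induced V W N (ad w))"
proof -
  have "(\<lambda>X\<in>carrier alg. lact bim X (mcls w) \<ominus>\<^bsub>bim\<^esub> ract bim (mcls w) X) = induced V W N (ad w)" for w
    by (rule induced_eqI[OF descends_ad])
      (simp_all add: carrier_alg lact_bim ract_bim minus_bim ad_def)
  moreover have "inner_derivations alg bim =
      (\<lambda>Z. \<lambda>X\<in>carrier alg. lact bim X Z \<ominus>\<^bsub>bim\<^esub> ract bim Z X) ` range mcls"
    by (auto simp: inner_derivations_def carrier_bim)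
  ultimately show ?thesis
    by (simp only: image_image)
qed

abbreviation "der \<equiv> derivation_space alg bim"

lemma add_der:
  assumes "descends \<phi>" "descends \<psi>"
  shows "induced V W N \<phi> \<oplus>\<^bsub>der\<^esub> induced V W N \<psi> = induced V W N (\<lambda>v. \<phi> v + \<psi> v)"
  by (rule induced_eqI[OF descends_add[OF assms]])
    (simp_all add: derivation_space_def carrier_alg induced_acls assms add_bim)

lemma smult_der:
  assumes "descends \<phi>"
  shows "c \<odot>\<^bsub>der\<^esub> induced V W N \<phi> = induced V W N (\<lambda>v. wscale W c (\<phi> v))"
  by (rule induced_eqI[OF descends_scale[OF assms]])
    (simp_all add: derivation_space_def carrier_alg induced_acls assms smult_bim)

text \<open>A class becomes a family of induced maps with parameter \<open>w\<close>. Arithmetic of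
  classes thereby turns into arithmetic of the parameter, by linearity of \<open>ad\<close>.\<close>

lemma H1_class_induced:
  assumes "descends \<phi>"
  shows "H1_class alg bim (induced V W N \<phi>) = range (\<lambda>w. induced V W N (\<lambda>v. ad w v + \<phi> v))"
  unfolding H1_class_def a_r_coset_def' inner_derivations_eq
  by (auto simp: add_der[OF descends_ad assms])

lemma descends_derivation:
  assumes "voa_derivation V W F"
  shows "descends F"
  using derivation_mem_O[OF assms] module_hom.diff[of "vscale V" "wscale W" F] assms
  by (metis descends_def module_hom_iff_linear voa_derivation_def)

lemma induced_derivation:
  assumes F: "voa_derivation V W F"
  shows "induced V W N F \<in> derivations alg bim"
proof -
  note d = induced_acls[OF descends_derivation[OF F]]
  have "F (x + y) = F x + F y" "F (vscale V c x) = wscale W c (F x)" for x y c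
    using F by (auto simp: voa_derivation_def Vector_Spaces.linear_iff)
  moreover have "induced V W N F \<in> extensional (carrier alg)"
    by (simp add: induced_def)
  ultimately show ?thesis
    by (auto simp: derivations_def linear_maps_def PiE_def carrier_alg carrier_bim d add_alg add_bim
        smult_alg smult_bim mult_alg lact_bim ract_bim derivation_star[OF F])
qed

lemma voa_derivation_add:
  assumes "voa_derivation V W F" "voa_derivation V W G"
  shows "voa_derivation V W (\<lambda>v. F v + G v)"
  using assms
  by (simp add: voa_derivation_def Vector_Spaces.linear_iff dgrad_add Yskew_add_left Yser_def
      wmode_add_right W.scale_right_distrib algebra_simps)

lemma voa_derivation_scale:
  assumes "voa_derivation V W F"
  shows "voa_derivation V W (\<lambda>v. wscale W c (F v))"
  using assms
  by (simp add: voa_derivation_def Vector_Spaces.linear_iff dgrad_scale Yskew_scale_left Yser_def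
      wmode_scale_right W.scale_right_distrib mult.commute)

lemma H1_map_linear:
  "(\<lambda>F\<in>carrier (voa_H1 V W). H1_class alg bim (induced V W N F)) \<in> linear_maps (voa_H1 V W) (assoc_H1 alg bim)"
proof -
  let ?I = "inner_derivations alg bim" and ?H = "\<lambda>F. H1_class alg bim (induced V W N F)"
  have carrier: "?H F \<in> carrier (assoc_H1 alg bim)" if "voa_derivation V W F" for F
    using induced_derivation[OF that]
    by (auto simp: assoc_H1_def quotient_def A_RCOSETS_def' derivation_space_def H1_class_def)
  have add: "?H (\<lambda>v. F v + G v) = ?H F \<oplus>\<^bsub>assoc_H1 alg bim\<^esub> ?H G"
    if F: "voa_derivation V W F" and G: "voa_derivation V W G" for F G
  proof -
    note dF = descends_derivation[OF F] and dG = descends_derivation[OF G]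
    have "?H F \<oplus>\<^bsub>assoc_H1 alg bim\<^esub> ?H G =
        (\<Union>w w'. {induced V W N (\<lambda>v. ad w v + F v) \<oplus>\<^bsub>der\<^esub> induced V W N (\<lambda>v. ad w' v + G v)})"
      by (simp add: assoc_H1_def quotient_def set_add_def' H1_class_induced[OF dF] H1_class_induced[OF dG])
    also have "\<dots> = (\<Union>w w'. {induced V W N (\<lambda>v. ad (w + w') v + (F v + G v))})"
      by (simp only: add_der[OF descends_add[OF descends_ad dF] descends_add[OF descends_ad dG]])
        (simp add: ad_add add_ac)
    also have "\<dots> = range (\<lambda>w. induced V W N (\<lambda>v. ad w v + (F v + G v)))"
      by (rule UN_UN_singleton[where k = "(+)" and e = 0 and
            g = "\<lambda>w. induced V W N (\<lambda>v. ad w v + (F v + G v))"]) simp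
    also have "\<dots> = ?H (\<lambda>v. F v + G v)"
      by (rule H1_class_induced[OF descends_add[OF dF dG], symmetric])
    finally show ?thesis ..
  qed
  have smult: "?H (\<lambda>v. wscale W c (F v)) = c \<odot>\<^bsub>assoc_H1 alg bim\<^esub> ?H F"
    if F: "voa_derivation V W F" for F c
  proof -
    note dF = descends_derivation[OF F]
    have "c \<odot>\<^bsub>assoc_H1 alg bim\<^esub> ?H F =
        (\<Union>w. H1_class alg bim (c \<odot>\<^bsub>der\<^esub> induced V W N (\<lambda>v. ad w v + F v)))"
      by (simp add: assoc_H1_def quotient_def H1_class_def[symmetric] H1_class_induced[OF dF])
    also have "\<dots> = (\<Union>w. H1_class alg bim (induced V W N (\<lambda>v. ad (wscale W c w) v + wscale W c (F v))))"
      by (simp add: smult_der[OF descends_add[OF descends_ad dF]] ad_scale W.scale_right_distrib)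
    also have "\<dots> = (\<Union>w w'. {induced V W N (\<lambda>v. ad (wscale W c w + w') v + wscale W c (F v))})"
    proof (rule SUP_cong[OF refl])
      fix w
      have "H1_class alg bim (induced V W N (\<lambda>v. ad (wscale W c w) v + wscale W c (F v))) =
          range (\<lambda>w'. induced V W N (\<lambda>v. ad w' v + (ad (wscale W c w) v + wscale W c (F v))))"
        by (rule H1_class_induced[OF descends_add[OF descends_ad descends_scale[OF dF]]])
      also have "\<dots> = (\<Union>w'. {induced V W N (\<lambda>v. ad (wscale W c w + w') v + wscale W c (F v))})"
        by (simp add: ad_add add_ac image_def full_SetCompr_eq[symmetric]) blast
      finally show "H1_class alg bim (induced V W N (\<lambda>v. ad (wscale W c w) v + wscale W c (F v))) =
          (\<Union>w'. {induced V W N (\<lambda>v. ad (wscale W c w + w') v + wscale W c (F v))})" .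
    qed
    also have "\<dots> = (\<Union>w' w. {induced V W N (\<lambda>v. ad (wscale W c w + w') v + wscale W c (F v))})"
      by blast
    \<comment> \<open>The parameter \<open>w'\<close> already runs through all of \<open>W\<close>
      with \<open>w = 0\<close>, so c = 0 needs no separate case.\<close>
    also have "\<dots> = range (\<lambda>w. induced V W N (\<lambda>v. ad w v + wscale W c (F v)))"
      by (rule UN_UN_singleton[where k = "\<lambda>w' w. wscale W c w + w'" and e = 0 and
            g = "\<lambda>w. induced V W N (\<lambda>v. ad w v + wscale W c (F v))"]) simp
    also have "\<dots> = ?H (\<lambda>v. wscale W c (F v))"
      by (rule H1_class_induced[OF descends_scale[OF dF], symmetric])
    finally show ?thesis ..
  qed
  show ?thesis
    using carrier add smult voa_derivation_add voa_derivation_scale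
    by (auto simp: linear_maps_def voa_H1_def)
qed

end

theorem proposition2p23:
  fixes V :: "'v::ab_group_add voa" and W :: "('v, 'w::ab_group_add) voa_module" and N :: nat
  assumes "vertex_operator_algebra V"
    and "generalized_module V W"
    and "grading_operator V W"
  shows "(\<forall>F. voa_derivation V W F \<longrightarrow>
            (\<forall>v. induced V W N F (cls_alg V N v) = cls_mod V W N (F v)) \<and>
            induced V W N F \<in> derivations (A_alg V N) (A_mod V W N)) \<and>
         (\<lambda>F\<in>carrier (voa_H1 V W). H1_class (A_alg V N) (A_mod V W N) (induced V W N F))
            \<in> linear_maps (voa_H1 V W) (assoc_H1 (A_alg V N) (A_mod V W N))"
proof -
  interpret graded_voa_module V W N
    by (rule graded_voa_moduleI[OF assms])
  show ?thesis
    using induced_acls[OF descends_derivation] induced_derivation H1_map_linear by blast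
qed

end
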